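(* Assume the regularity condition $f^*=L^r u^*$ holds for some $u^*\in L^2_{\rho_{\mathcal X}}$ with $\frac12\le r\le2$. If there are constants $C_0>0$ and $0<\beta\le1$ such that $\mathcal N(\lambda)\le C_0\lambda^{-\beta}$ for all $\lambda>0$, if $|D_1|=|D_2|=\dots=|D_m|$, $\lambda=|D|^{-\frac1{2r+\beta}}$, and the number $m$ of local machines (blocks) satisfies $$m\le|D|^{\min\left\{\frac2{2r+\beta},\frac{2r-1}{2r+\beta}\right\}},$$ then $$\mathbf E\left[\|\overline f_{D,\lambda}^\sharp-f^*\|_{L^2_{\rho_{\mathcal X}}}^2\right]=\mathcal O\left(|D|^{-\frac{2r}{2r+\beta}}\right).$$
   Context: Setting. $\mathcal X$ is a compact metric space, $\rho$ is a probability distribution on $\mathcal X\times\mathbb R$ with marginal $\rho_{\mathcal X}$ on $\mathcal X$, and the data follow the model $y=f^*(x)+\epsilon$ with zero-mean noise $\epsilon$, where $f^*$ is the unknown true model. $K:\mathcal X\times\mathcal X\to\mathbb R$ is a Mercer kernel (continuous, symmetric, positive semidefinite), $\mathcal H_K$ its reproducing kernel Hilbert space with norm $\|\cdot\|_K$, and $K_x=K(x,\cdot)$. The integral operator $Lf(x)=\int_{\mathcal X}K(x,t)f(t)\,d\rho_{\mathcal X}(t)$ is compact, symmetric and positive on $L^2_{\rho_{\mathcal X}}$; $L_K$ denotes its restriction to $\mathcal H_K$. Powers of operators are defined by spectral calculus. For $r\ge\frac12$, the condition $f^*=L^ru^*$ implies $f^*\in\mathcal H_K$. The effective dimension is $\mathcal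 N(\lambda)=\mathrm{Tr}((L_K+\lambda I)^{-1}L_K)$. Estimator on one data set. For a sample $D=\{(x_i,y_i)\}_{i=1}^{|D|}$ of size $|D|$ with $\mathbf y_D=(y_1,\dots,y_{|D|})^\top$, let $S_D:\mathcal H_K\to\mathbb R^{|D|}$, $S_Df=(f(x_1),\dots,f(x_{|D|}))^\top$, $S_D^*\mathbf c=\sum_i c_iK_{x_i}$, $L_{K,D}=\frac1{|D|}S_D^*S_D$, $f_{D,\lambda}=(\lambda I+L_{K,D})^{-1}\frac1{|D|}S_D^*\mathbf y_D$ (the regularization kernel network estimator, i.e. the minimizer over $f\in\mathcal H_K$ of $\frac1{|D|}\sum_i(y_i-f(x_i))^2+\lambda\|f\|_K^2$), and $f_{D,\lambda}^\sharp=f_{D,\lambda}+\lambda(\lambda I+L_{K,D})^{-1}f_{D,\lambda}$ (the bias corrected regularization kernel network, BCRKN). Distributed estimator. The sample $D$, drawn independently from $\rho$, is split into $m$ disjoint blocks $D_1,\dots,D_m$, and $\overline f_{D,\lambda}^\sharp=\sum_{j=1}^m\frac{|D_j|}{|D|}f_{D_j,\lambda}^\sharp$.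
   Formalization: The noise is additionally assumed to have conditional variance given x bounded by a constant σ² (and zero conditional mean); without a second-moment condition the expected squared error can be infinite, e.g. for a constant kernel, f*=0 and infinite-variance noise. *)

theory Defs
  imports "HOL-Probability.Probability" "HOL-Library.Disjoint_Sets"
begin

text \<open>Throughout, the input space is a whole type of class
  \<open>{metric_space, second_countable_topology}\<close> whose universe is assumed compact; the class
  \<open>second_countable_topology\<close> is automatic for a compact metric space.  Likewise the RKHS of a
  continuous kernel on such a space is separable, so asking its type to be second countable is no
  restriction.\<close>

definition mercer_kernel :: "('a::metric_space \<Rightarrow> 'a \<Rightarrow> real) \<Rightarrow> bool" where
  "mercer_kernel K \<longleftrightarrow>
     continuous_on UNIV (\<lambda>(x, t). K x t) \<and>
     (\<forall>x t. K x t = K t x) \<and>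
     (\<forall>A c. finite A \<longrightarrow> 0 \<le> (\<Sum>x\<in>A. \<Sum>t\<in>A. c x * c t * K x t))"

text \<open>The reproducing kernel Hilbert space of \<open>K\<close> is a Hilbert space of functions.  It is presented
  by a Hilbert space type \<open>'h\<close> together with the injective map \<open>emb\<close> that sends an element to the
  function it is.  Linearity of \<open>emb\<close> follows from the reproducing property, so \<open>range emb\<close>, with
  the inner product carried over from \<open>'h\<close>, is a Hilbert space of functions that contains every
  \<open>K x\<close> and in which \<open>K x\<close> reproduces the value at \<open>x\<close>.\<close>

definition rkhs :: "('a \<Rightarrow> 'a \<Rightarrow> real) \<Rightarrow> ('h::{real_inner, banach} \<Rightarrow> 'a \<Rightarrow> real) \<Rightarrow> bool" where
  "rkhs K emb \<longleftrightarrow> inj emb \<and> (\<forall>x. \<exists>k. emb k = K x \<and> (\<forall>f. inner f k = emb f x))"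

definition kernel_section :: "('a \<Rightarrow> 'a \<Rightarrow> real) \<Rightarrow> ('h \<Rightarrow> 'a \<Rightarrow> real) \<Rightarrow> 'a \<Rightarrow> 'h" where
  "kernel_section K emb x = inv emb (K x)"

definition integral_op :: "('a \<Rightarrow> 'a \<Rightarrow> real) \<Rightarrow> 'a measure \<Rightarrow> ('a \<Rightarrow> real) \<Rightarrow> 'a \<Rightarrow> real" where
  "integral_op K \<mu> f x = (LINT t|\<mu>. K x t * f t)"

definition rkhs_integral_op ::
  "('a \<Rightarrow> 'a \<Rightarrow> real) \<Rightarrow> ('h \<Rightarrow> 'a \<Rightarrow> real) \<Rightarrow> 'a measure \<Rightarrow> 'h \<Rightarrow> 'h" where
  "rkhs_integral_op K emb \<mu> f = inv emb (integral_op K \<mu> (emb f))"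

definition L2 :: "'a measure \<Rightarrow> ('a \<Rightarrow> real) set" where
  "L2 \<mu> = {f \<in> borel_measurable \<mu>. integrable \<mu> (\<lambda>x. (f x)\<^sup>2)}"

definition L2_inner :: "'a measure \<Rightarrow> ('a \<Rightarrow> real) \<Rightarrow> ('a \<Rightarrow> real) \<Rightarrow> real" where
  "L2_inner \<mu> f g = (LINT x|\<mu>. f x * g x)"

text \<open>Extended valued, so that a bound on it really asserts square integrability.\<close>

definition L2_norm_sq :: "'a measure \<Rightarrow> ('a \<Rightarrow> real) \<Rightarrow> ennreal" where
  "L2_norm_sq \<mu> f = (\<integral>\<^sup>+x. ennreal ((f x)\<^sup>2) \<partial>\<mu>)"

text \<open>A spectral decomposition of the compact positive operator \<open>L\<close> on \<open>L\<^sup>2\<close>: an orthonormal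
  system of eigenfunctions with positive eigenvalues, on whose orthogonal complement \<open>L\<close> vanishes.
  The index set \<open>I\<close> may be finite or infinite.\<close>

definition spectral_system ::
  "('a \<Rightarrow> 'a \<Rightarrow> real) \<Rightarrow> 'a measure \<Rightarrow> nat set \<Rightarrow> (nat \<Rightarrow> real) \<Rightarrow> (nat \<Rightarrow> 'a \<Rightarrow> real) \<Rightarrow> bool" where
  "spectral_system K \<mu> I s \<phi> \<longleftrightarrow>
     (\<forall>i\<in>I. \<phi> i \<in> L2 \<mu> \<and> 0 < s i \<and> (AE x in \<mu>. integral_op K \<mu> (\<phi> i) x = s i * \<phi> i x)) \<and>
     (\<forall>i\<in>I. \<forall>j\<in>I. L2_inner \<mu> (\<phi> i) (\<phi> j) = (if i = j then 1 else 0)) \<and>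
     (\<forall>f\<in>L2 \<mu>. (\<forall>i\<in>I. L2_inner \<mu> f (\<phi> i) = 0) \<longrightarrow> (AE x in \<mu>. integral_op K \<mu> f x = 0))"

text \<open>\<open>f = L\<^sup>r u\<close> as elements of \<open>L\<^sup>2\<close>, for \<open>r > 0\<close>: spectral calculus gives
  \<open>L\<^sup>r u = (\<Sum>i\<in>I. s\<^sub>i\<^sup>r \<langle>u, \<phi>\<^sub>i\<rangle> \<phi>\<^sub>i)\<close> with convergence in \<open>L\<^sup>2\<close>; the kernel of \<open>L\<close> contributes nothing.
  Neither the choice of the spectral system nor the order of summation matters.\<close>

definition is_integral_op_power ::
  "('a \<Rightarrow> 'a \<Rightarrow> real) \<Rightarrow> 'a measure \<Rightarrow> real \<Rightarrow> ('a \<Rightarrow> real) \<Rightarrow> ('a \<Rightarrow> real) \<Rightarrow> bool" where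
  "is_integral_op_power K \<mu> r u f \<longleftrightarrow> u \<in> L2 \<mu> \<and> f \<in> L2 \<mu> \<and>
     (\<exists>I s \<phi>. spectral_system K \<mu> I s \<phi> \<and>
        (\<lambda>n. L2_norm_sq \<mu>
           (\<lambda>x. f x - (\<Sum>i\<in>I \<inter> {..<n}. s i powr r * L2_inner \<mu> u (\<phi> i) * \<phi> i x)))
        \<longlonglongrightarrow> 0)"

definition orthonormal_basis :: "'h::real_inner set \<Rightarrow> bool" where
  "orthonormal_basis B \<longleftrightarrow>
     pairwise orthogonal B \<and> (\<forall>e\<in>B. norm e = 1) \<and> closure (span B) = UNIV"

text \<open>Trace of a positive operator, possibly infinite; it does not depend on the basis.\<close>

definition positive_trace :: "('h::real_inner \<Rightarrow> 'h) \<Rightarrow> ennreal" where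
  "positive_trace T = (\<Sum>\<^sub>\<infinity>e\<in>(SOME B. orthonormal_basis B). ennreal (inner (T e) e))"

definition effective_dim ::
  "('a \<Rightarrow> 'a \<Rightarrow> real) \<Rightarrow> ('h::real_inner \<Rightarrow> 'a \<Rightarrow> real) \<Rightarrow> 'a measure \<Rightarrow> real \<Rightarrow> ennreal" where
  "effective_dim K emb \<mu> lam =
     positive_trace (\<lambda>f. inv (\<lambda>g. rkhs_integral_op K emb \<mu> g + lam *\<^sub>R g) (rkhs_integral_op K emb \<mu> f))"

text \<open>A data set is a finite index set \<open>J\<close> with a family \<open>z\<close> of input-output pairs; vectors in
  \<open>\<real>\<^sup>|\<^sup>D\<^sup>|\<close> are functions read only at the indices in \<open>J\<close>.\<close>

definition sampling_op ::
  "('h \<Rightarrow> 'a \<Rightarrow> real) \<Rightarrow> (nat \<Rightarrow> 'a \<times> real) \<Rightarrow> 'h \<Rightarrow> nat \<Rightarrow> real" where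
  "sampling_op emb z f i = emb f (fst (z i))"

definition sampling_adj ::
  "('a \<Rightarrow> 'a \<Rightarrow> real) \<Rightarrow> ('h::real_vector \<Rightarrow> 'a \<Rightarrow> real) \<Rightarrow> nat set \<Rightarrow> (nat \<Rightarrow> 'a \<times> real)
     \<Rightarrow> (nat \<Rightarrow> real) \<Rightarrow> 'h" where
  "sampling_adj K emb J z c = (\<Sum>i\<in>J. c i *\<^sub>R kernel_section K emb (fst (z i)))"

definition empirical_op ::
  "('a \<Rightarrow> 'a \<Rightarrow> real) \<Rightarrow> ('h::real_vector \<Rightarrow> 'a \<Rightarrow> real) \<Rightarrow> nat set \<Rightarrow> (nat \<Rightarrow> 'a \<times> real)
     \<Rightarrow> 'h \<Rightarrow> 'h" where
  "empirical_op K emb J z f = (1 / real (card J)) *\<^sub>R sampling_adj K emb J z (sampling_op emb z f)"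

definition empirical_resolvent ::
  "('a \<Rightarrow> 'a \<Rightarrow> real) \<Rightarrow> ('h::real_vector \<Rightarrow> 'a \<Rightarrow> real) \<Rightarrow> real \<Rightarrow> nat set \<Rightarrow> (nat \<Rightarrow> 'a \<times> real)
     \<Rightarrow> 'h \<Rightarrow> 'h" where
  "empirical_resolvent K emb lam J z = inv (\<lambda>f. lam *\<^sub>R f + empirical_op K emb J z f)"

definition rkn ::
  "('a \<Rightarrow> 'a \<Rightarrow> real) \<Rightarrow> ('h::real_vector \<Rightarrow> 'a \<Rightarrow> real) \<Rightarrow> real \<Rightarrow> nat set \<Rightarrow> (nat \<Rightarrow> 'a \<times> real)
     \<Rightarrow> 'h" where
  "rkn K emb lam J z = empirical_resolvent K emb lam J z
     ((1 / real (card J)) *\<^sub>R sampling_adj K emb J z (\<lambda>i. snd (z i)))"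

definition bcrkn ::
  "('a \<Rightarrow> 'a \<Rightarrow> real) \<Rightarrow> ('h::real_vector \<Rightarrow> 'a \<Rightarrow> real) \<Rightarrow> real \<Rightarrow> nat set \<Rightarrow> (nat \<Rightarrow> 'a \<times> real)
     \<Rightarrow> 'h" where
  "bcrkn K emb lam J z =
     rkn K emb lam J z + lam *\<^sub>R empirical_resolvent K emb lam J z (rkn K emb lam J z)"

text \<open>The blocks are the members of the partition \<open>P\<close> of the index set \<open>\<Union>P\<close> of the whole sample.\<close>

definition distributed_bcrkn ::
  "('a \<Rightarrow> 'a \<Rightarrow> real) \<Rightarrow> ('h::real_vector \<Rightarrow> 'a \<Rightarrow> real) \<Rightarrow> real \<Rightarrow> nat set set
     \<Rightarrow> (nat \<Rightarrow> 'a \<times> real) \<Rightarrow> 'h" where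
  "distributed_bcrkn K emb lam P z =
     (\<Sum>J\<in>P. (real (card J) / real (card (\<Union>P))) *\<^sub>R bcrkn K emb lam J z)"

text \<open>The model \<open>y = f*(x) + \<epsilon>\<close>, where \<open>\<epsilon> = y - f*(x)\<close> has conditional mean zero given \<open>x\<close> and
  conditional variance at most \<open>\<sigma>\<^sup>2\<close>.  Noise independent of \<open>x\<close> with mean zero and finite variance
  is a special case.  Integrability of \<open>\<epsilon>\<^sup>2\<close> is stated first because \<^const>\<open>real_cond_exp\<close> is only
  meaningful under integrability.\<close>

definition noise :: "('a \<Rightarrow> real) \<Rightarrow> 'a \<times> real \<Rightarrow> real" where
  "noise fstar z = snd z - fstar (fst z)"

definition regression_model ::
  "('a::topological_space \<times> real) measure \<Rightarrow> ('a \<Rightarrow> real) \<Rightarrow> real \<Rightarrow> bool" where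
  "regression_model \<rho> fstar \<sigma> \<longleftrightarrow>
     (let G = vimage_algebra (space \<rho>) fst borel in
       fstar \<in> borel_measurable borel \<and>
       integrable \<rho> (\<lambda>z. (noise fstar z)\<^sup>2) \<and>
       (AE z in \<rho>. real_cond_exp \<rho> G (noise fstar) z = 0) \<and>
       (AE z in \<rho>. real_cond_exp \<rho> G (\<lambda>z. (noise fstar z)\<^sup>2) z \<le> \<sigma>\<^sup>2))"

end

theory Submission
  imports Defs
begin

text \<open>Write \<open>T\<close> for \<open>L\<^sub>K\<close>.  If \<open>f*\<close> is the function of \<open>g \<in> H\<^sub>K\<close>, then the error of BCRKN on a
  block \<open>B\<close> is \<open>- \<lambda>\<^sup>2 (\<lambda> + L\<^bsub>K,B\<^esub>)\<^bsup>-2\<^esup> g\<close> plus a term linear in the noise.  The noise terms of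
  different samples are uncorrelated, so averaging over the blocks divides their variance by the
  number of blocks; the bias terms are only averaged by convexity.

  No concentration inequality for \<open>L\<^bsub>K,B\<^esub>\<close> is used: all bounds are obtained in expectation by
  leaving one point out.  The test point is treated as one more sample point, the Sherman--Morrison
  formula relates the resolvents with and without it, and exchangeability turns a prediction error at
  the test point into an in-sample average.  Jensen's inequality bounds the expected empirical
  effective dimension by \<open>\<N>(\<lambda>)\<close>.  The central estimate is a stability bound: with
  \<open>h = (\<lambda> + T) q\<close> and \<open>d = (\<lambda> + L\<^bsub>K,B\<^esub>)\<^bsup>-1\<^esup> h - q\<close>, the expectation of
  \<open>\<langle>d, (\<lambda> + L\<^bsub>K,B\<^esub>) d\<rangle>\<close> is at most a constant times \<open>\<N>(\<lambda>) \<parallel>q\<parallel>\<^sup>2 / |B|\<close>.  Applied to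
  \<open>q = (\<lambda> + T)\<^bsup>-1\<^esup> g\<close> and to \<open>q = (\<lambda> + T)\<^bsup>-2\<^esup> g\<close> it controls the bias, and the restriction on the
  number of blocks is what makes that bound \<open>O(\<lambda>\<^bsup>2r\<^esup>)\<close>.\<close>

section \<open>Regularised Gram operators\<close>

text \<open>Exchangeability applies only to the resolvent that has seen the test point, independence
  only to the one that has not. Evaluated at the test point they differ by the factor 1 + a, where a
  is its leverage; a is at most \<open>\<kappa>\<^sup>2\<close> once |B| \<lambda> \<ge> 1, and its
  mean is of order \<N>(\<lambda>) / |B|.

  The limit on the number of blocks comes from the fluctuation part of the bias, of order
  \<lambda>^2 (\<N>(\<lambda>) / |B|) times the squared norm of the inverse of \<lambda> + T applied
  to g. By the source condition that squared norm is of order \<lambda>^(2r-3) for r \<le> 3/2 and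
  bounded for r \<ge> 3/2, so \<N>(\<lambda>) / |B| must be of order \<lambda>^max(1, 2r-2). With
  |D| = \<lambda>^-(2r+\<beta>) each regime gives one entry of the minimum. The population part of
  the bias is of order \<lambda>^(2r) up to r = 2, the qualification of the bias corrected
  filter.\<close>

lemma coercive_bij:
  fixes A :: "'h::{real_inner,banach} \<Rightarrow> 'h"
  assumes A: "bounded_linear A" and t: "0 < t" and co: "\<And>f. t * (norm f)\<^sup>2 \<le> inner f (A f)"
  shows "bij A"
proof -
  interpret A: bounded_linear A by fact
  have "inj A"
  proof (rule injI)
    fix f g assume "A f = A g"
    then have "A (f - g) = 0" by (simp add: A.diff)
    with co[of "f - g"] have "t * (norm (f - g))\<^sup>2 \<le> 0" by simp
    with t show "f = g" by (simp add: mult_le_0_iff)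
  qed
  moreover have "\<exists>f. A f = h" for h
  proof -
    obtain B0 where B0: "\<And>f. norm (A f) \<le> norm f * B0" using A.bounded by blast
    define B where "B = max B0 (max t 1)"
    have B: "norm (A f) \<le> B * norm f" "t \<le> B" "1 \<le> B" for f
      using B0[of f] mult_left_mono[of B0 B "norm f"] by (auto simp: B_def mult.commute)
    \<comment> \<open>Richardson iteration. This step size minimises 1 - 2 c t + c^2 B^2, the bound
      on the squared contraction factor, and leaves 1 - t^2 / B^2; \<open>t \<le> B\<close> keeps
      that nonnegative.\<close>
    define c where "c = t / B\<^sup>2"
    have c: "0 < c" using t B by (simp add: c_def)
    define L where "L = sqrt (1 - t\<^sup>2 / B\<^sup>2)"
    have tB: "t\<^sup>2 / B\<^sup>2 \<le> 1" using t B by (simp add: divide_simps power_mono)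
    have L: "0 \<le> L" "L < 1" using t B tB by (auto simp: L_def)
    have contr: "norm (d - c *\<^sub>R A d) \<le> L * norm d" for d
    proof -
      have "(norm (d - c *\<^sub>R A d))\<^sup>2 = (norm d)\<^sup>2 - 2 * c * inner d (A d) + c\<^sup>2 * (norm (A d))\<^sup>2"
        by (simp only: power2_norm_eq_inner) (simp add: inner_diff inner_commute power2_eq_square algebra_simps)
      also have "\<dots> \<le> (norm d)\<^sup>2 - 2 * c * (t * (norm d)\<^sup>2) + c\<^sup>2 * (B * norm d)\<^sup>2"
        using c co[of d] B(1)[of d] by (intro add_mono diff_mono mult_left_mono power_mono) auto
      also have "\<dots> = (1 - t\<^sup>2 / B\<^sup>2) * (norm d)\<^sup>2"
        using B(3) by (simp add: c_def power2_eq_square field_simps)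
      also have "\<dots> = (L * norm d)\<^sup>2"
        using tB by (simp add: L_def power_mult_distrib)
      finally show ?thesis by (rule power2_le_imp_le) (simp add: L)
    qed
    let ?F = "\<lambda>f. f - c *\<^sub>R (A f - h)"
    have "\<exists>!f. ?F f = f"
    proof (rule banach_fix_type)
      show "\<forall>x y. dist (?F x) (?F y) \<le> L * dist x y"
      proof (intro allI)
        fix x y
        have "?F x - ?F y = (x - y) - c *\<^sub>R A (x - y)"
          by (simp add: A.diff algebra_simps)
        then show "dist (?F x) (?F y) \<le> L * dist x y"
          using contr[of "x - y"] by (simp only: dist_norm)
      qed
    qed (use L in auto)
    then obtain f where "?F f = f" by blast
    then show ?thesis using c by (intro exI[of _ f]) simp
  qed
  ultimately show ?thesis by (metis bij_def surjI surj_def)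
qed

text \<open>The operators are not normalised by the sample size: \<open>reg k t J\<close> is \<open>|J| (\<lambda> + L\<^bsub>K,J\<^esub>)\<close> for
  \<open>t = |J| \<lambda>\<close>, so that \<open>t\<close> can be kept fixed when a point is added or removed.\<close>

definition reg :: "('i \<Rightarrow> 'h::real_inner) \<Rightarrow> real \<Rightarrow> 'i set \<Rightarrow> 'h \<Rightarrow> 'h" where
  "reg k t J f = t *\<^sub>R f + (\<Sum>i\<in>J. inner (k i) f *\<^sub>R k i)"

definition res :: "('i \<Rightarrow> 'h::real_inner) \<Rightarrow> real \<Rightarrow> 'i set \<Rightarrow> 'h \<Rightarrow> 'h" where
  "res k t J = inv (reg k t J)"

lemma bounded_linear_reg: "bounded_linear (reg k t J)"
  unfolding reg_def
  by (intro bounded_linear_add bounded_linear_scaleR_right bounded_linear_sum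
      bounded_linear_scaleR_const bounded_linear_inner_right)

lemma inner_reg: "inner f (reg k t J g) = t * inner f g + (\<Sum>i\<in>J. inner (k i) f * inner (k i) g)"
  by (simp add: reg_def inner_add_right inner_sum_right inner_commute mult.commute)

lemma reg_symmetric: "inner f (reg k t J g) = inner (reg k t J f) g"
  by (simp add: inner_reg inner_commute[of "reg k t J f"] inner_commute[of f] mult.commute)

lemma reg_insert:
  "finite J \<Longrightarrow> j \<notin> J \<Longrightarrow> reg k t (insert j J) f = reg k t J f + inner (k j) f *\<^sub>R k j"
  by (simp add: reg_def)

lemma reg_cong: "(\<And>i. i \<in> J \<Longrightarrow> k i = k' i) \<Longrightarrow> reg k t J = reg k' t J"
  by (auto simp: reg_def fun_eq_iff intro!: sum.cong)

lemma res_cong: "(\<And>i. i \<in> J \<Longrightarrow> k i = k' i) \<Longrightarrow> res k t J = res k' t J"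
  by (simp add: res_def cong: reg_cong)

lemma res_reindex: "bij_betw p J J \<Longrightarrow> res (\<lambda>i. k (p i)) t J = res k t J"
  unfolding res_def
  by (rule arg_cong[where f = inv])
    (auto simp: reg_def fun_eq_iff intro!: sum.reindex_bij_betw[where g = "\<lambda>i. inner (k i) _ *\<^sub>R k i"])

lemma reg_coercive: "t * (norm f)\<^sup>2 \<le> inner f (reg k t J f)"
  by (simp add: inner_reg power2_norm_eq_inner sum_nonneg)

context
  fixes k :: "'i \<Rightarrow> 'h::{real_inner,banach}" and t :: real
  assumes t: "0 < t"
begin

lemma bij_reg: "bij (reg k t J)"
  using bounded_linear_reg t reg_coercive by (rule coercive_bij)

lemma reg_res [simp]: "reg k t J (res k t J f) = f"
  unfolding res_def by (rule surj_f_inv_f) (use bij_reg in \<open>auto simp: bij_def\<close>)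

lemma res_reg [simp]: "res k t J (reg k t J f) = f"
  unfolding res_def by (rule inv_f_f) (use bij_reg in \<open>auto simp: bij_def\<close>)

lemma res_unique: "reg k t J f = h \<Longrightarrow> res k t J h = f"
  by auto

lemma res_add: "res k t J (f + g) = res k t J f + res k t J g"
  by (rule res_unique) (simp add: linear_add[OF bounded_linear.linear[OF bounded_linear_reg]])

lemma res_scaleR: "res k t J (c *\<^sub>R f) = c *\<^sub>R res k t J f"
  by (rule res_unique) (simp add: linear_cmul[OF bounded_linear.linear[OF bounded_linear_reg]])

lemma linear_res: "linear (res k t J)"
  by (rule linearI) (simp_all add: res_add res_scaleR)

lemma res_symmetric: "inner f (res k t J g) = inner (res k t J f) g"
  using reg_symmetric[of "res k t J f" k t J "res k t J g"] by simp

text \<open>Pair \<open>reg k t J (res k t J f) = f\<close> with \<open>res k t J f\<close>. Both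
  terms on the right are nonnegative, and the estimates that follow come from discarding one or
  both.\<close>

lemma res_energy:
  "inner f (res k t J f) = t * (norm (res k t J f))\<^sup>2 + (\<Sum>i\<in>J. (inner (k i) (res k t J f))\<^sup>2)"
  using inner_reg[of "res k t J f" k t J "res k t J f"]
  by (simp add: power2_norm_eq_inner power2_eq_square[of "inner _ _"] inner_commute[of _ f])

lemma res_nonneg: "0 \<le> inner f (res k t J f)"
  using t by (simp add: res_energy sum_nonneg)

lemma res_energy_norm: "t * (norm (res k t J f))\<^sup>2 \<le> inner f (res k t J f)"
  by (simp add: res_energy sum_nonneg)

lemma res_energy_sample: "(\<Sum>i\<in>J. (inner (k i) (res k t J f))\<^sup>2) \<le> inner f (res k t J f)"
  using t by (simp add: res_energy)

lemma norm_res_le: "norm (res k t J f) \<le> norm f / t"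
proof (cases "res k t J f = 0")
  case False
  have "t * norm (res k t J f) * norm (res k t J f) \<le> norm f * norm (res k t J f)"
    using res_energy_norm[of J f] norm_cauchy_schwarz[of f "res k t J f"]
    by (simp add: power2_eq_square mult.assoc)
  then show ?thesis using False t by (simp add: field_simps)
qed (use t in simp)

lemma res_inner_le: "inner f (res k t J f) \<le> (norm f)\<^sup>2 / t"
proof -
  have "inner f (res k t J f) \<le> norm f * norm (res k t J f)" by (rule norm_cauchy_schwarz)
  also have "\<dots> \<le> norm f * (norm f / t)" by (intro mult_left_mono norm_res_le) auto
  finally show ?thesis by (simp add: power2_eq_square)
qed

text \<open>Each of the two resolvents costs 1 / t. Hence the correction term of the noise weights,
  which carries a factor t, can be treated like the uncorrected one.\<close>

lemma sample_res_res_le: "(\<Sum>i\<in>J. (inner (k i) (res k t J (res k t J f)))\<^sup>2) \<le> inner f (res k t J f) / t\<^sup>2"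
proof -
  have "(\<Sum>i\<in>J. (inner (k i) (res k t J (res k t J f)))\<^sup>2) \<le> (norm (res k t J f))\<^sup>2 / t"
    using res_energy_sample[of J "res k t J f"] res_inner_le[of "res k t J f" J] by simp
  also have "\<dots> \<le> inner f (res k t J f) / t / t"
    using res_energy_norm[of J f] t by (intro divide_right_mono) (auto simp: field_simps)
  finally show ?thesis by (simp add: power2_eq_square)
qed

context
  fixes J :: "'i set" and j :: 'i
  assumes J: "finite J" "j \<notin> J"
begin

text \<open>The resolvent identity for the rank-one difference of the two \<open>reg\<close>
  operators. The next three lemmas pair it with \<open>k j\<close>, specialise it to
  \<open>k j\<close> and solve it for the larger sample.\<close>

lemma res_remove: "res k t J f = res k t (insert j J) f
    + inner (k j) (res k t (insert j J) f) *\<^sub>R res k t J (k j)"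
proof -
  have "f = reg k t J (res k t (insert j J) f) + inner (k j) (res k t (insert j J) f) *\<^sub>R k j"
    using reg_insert[OF J, of k t "res k t (insert j J) f"] by simp
  then have "res k t J f = res k t J (reg k t J (res k t (insert j J) f)
      + inner (k j) (res k t (insert j J) f) *\<^sub>R k j)" by simp
  then show ?thesis by (simp only: res_add res_scaleR res_reg)
qed

lemma leverage_remove:
  "inner (k j) (res k t J f) = (1 + inner (k j) (res k t J (k j))) * inner (k j) (res k t (insert j J) f)"
  by (subst res_remove) (simp add: inner_add_right algebra_simps)

lemma res_remove_self:
  "res k t J (k j) = (1 + inner (k j) (res k t J (k j))) *\<^sub>R res k t (insert j J) (k j)"
proof -
  let ?a = "inner (k j) (res k t J (k j))" and ?a' = "inner (k j) (res k t (insert j J) (k j))"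
  have 1: "res k t J (k j) = res k t (insert j J) (k j) + ?a' *\<^sub>R res k t J (k j)"
    by (rule res_remove)
  have "0 \<le> ?a" by (rule res_nonneg)
  moreover have "?a = (1 + ?a) * ?a'" by (rule leverage_remove)
  \<comment> \<open>\<open>?a\<close> and \<open>?a'\<close> are the leverages of j outside and
    inside the sample.\<close>
  ultimately have *: "(1 + ?a) * (1 - ?a') = 1" by (simp add: algebra_simps)
  have "res k t (insert j J) (k j) = (1 - ?a') *\<^sub>R res k t J (k j)"
    using 1 by (simp add: algebra_simps)
  from arg_cong[OF this, of "\<lambda>x. (1 + ?a) *\<^sub>R x"] show ?thesis
    by (simp only: scaleR_scaleR * scaleR_one)
qed

lemma sherman_morrison: "res k t (insert j J) f = res k t J f
    - (inner (k j) (res k t J f) / (1 + inner (k j) (res k t J (k j)))) *\<^sub>R res k t J (k j)"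
proof -
  have "0 \<le> inner (k j) (res k t J (k j))" by (rule res_nonneg)
  then show ?thesis using res_remove[of f] leverage_remove[of f]
    by (simp add: field_simps)
qed

end

end

text \<open>\<open>res\<close> is an inverse function taken pointwise, so its definition does not
  show how it depends on the design. Sherman-Morrison rebuilds it one point at a time by algebraic
  operations; \<open>h\<close> is arbitrary in the induction because the update also needs the
  smaller resolvent at \<open>k j\<close>.\<close>

lemma borel_measurable_res [measurable (raw)]:
  fixes k :: "'i \<Rightarrow> 'c \<Rightarrow> 'h::{real_inner,banach,second_countable_topology}"
  assumes "finite J" and "\<And>i. i \<in> J \<Longrightarrow> k i \<in> borel_measurable M" and "0 < t"
    and "h \<in> borel_measurable M"
  shows "(\<lambda>z. res (\<lambda>i. k i z) t J (h z)) \<in> borel_measurable M"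
  using assms(1,2,4)
proof (induction J arbitrary: h)
  case empty
  have "res (\<lambda>i. k i z) t {} (h z) = (1 / t) *\<^sub>R h z" for z
    by (rule res_unique) (use \<open>0 < t\<close> in \<open>auto simp: reg_def\<close>)
  then show ?case using empty by simp
next
  case (insert j J)
  have [measurable]: "k j \<in> borel_measurable M" "h \<in> borel_measurable M" using insert by auto
  have [measurable]: "(\<lambda>z. res (\<lambda>i. k i z) t J (h z)) \<in> borel_measurable M"
    "(\<lambda>z. res (\<lambda>i. k i z) t J (k j z)) \<in> borel_measurable M"
    using insert by (auto intro!: insert.IH)
  show ?case
    using insert.hyps \<open>0 < t\<close> by (subst sherman_morrison) measurable
qed

section \<open>Orthonormal bases of separable spaces\<close>

text \<open>One step of Gram-Schmidt with residual \<open>y\<close>; a zero residual means that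
  \<open>B\<close> already suffices.\<close>

lemma finite_orthonormal_extend:
  fixes B :: "'h::real_inner set"
  assumes B: "finite B" "pairwise orthogonal B" "\<forall>e\<in>B. norm e = 1"
  obtains B' where "B \<subseteq> B'" "finite B'" "pairwise orthogonal B'" "\<forall>e\<in>B'. norm e = 1" "x \<in> span B'"
proof -
  define y where "y = x - (\<Sum>e\<in>B. inner x e *\<^sub>R e)"
  have orth: "inner y e = 0" if "e \<in> B" for e
  proof -
    have "(\<Sum>b\<in>B. inner x b * inner b e) = (\<Sum>b\<in>B. if b = e then inner x e else 0)"
    proof (rule sum.cong)
      fix b assume b: "b \<in> B"
      show "inner x b * inner b e = (if b = e then inner x e else 0)"
      proof (cases "b = e")
        case True
        then show ?thesis using B(3) that by (simp add: norm_eq_1)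
      next
        case False
        then show ?thesis using B(2) b that by (auto simp: pairwise_def orthogonal_def)
      qed
    qed simp
    then show ?thesis using that B(1) by (simp add: y_def inner_diff_left inner_sum_left)
  qed
  have xy: "x = y + (\<Sum>e\<in>B. inner x e *\<^sub>R e)" by (simp add: y_def)
  have span: "(\<Sum>e\<in>B. inner x e *\<^sub>R e) \<in> span B"
    by (intro span_sum span_scale span_base)
  show ?thesis
  proof (cases "y = 0")
    case True
    show ?thesis by (rule that[of B]) (use B True xy span in auto)
  next
    case False
    let ?u = "(1 / norm y) *\<^sub>R y"
    have "y = norm y *\<^sub>R ?u" using False by simp
    then have "y \<in> span (insert ?u B)" by (metis insertI1 span_base span_scale)
    moreover have "(\<Sum>e\<in>B. inner x e *\<^sub>R e) \<in> span (insert ?u B)"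
      using span span_mono[of B "insert ?u B"] by blast
    ultimately have "x \<in> span (insert ?u B)" by (metis xy span_add)
    moreover have "pairwise orthogonal (insert ?u B)"
      using B(2) orth by (auto simp: pairwise_insert orthogonal_def inner_commute)
    ultimately show ?thesis
      by (intro that[of "insert ?u B"]) (use B False in auto)
  qed
qed

text \<open>Gram-Schmidt along a dense sequence. \<open>positive_trace\<close> works with a basis
  picked by \<open>SOME\<close>, which is meaningful only once a basis is known to exist.\<close>

lemma orthonormal_basis_exists:
  "\<exists>B :: 'h::{real_inner,second_countable_topology} set. orthonormal_basis B"
proof -
  obtain D :: "'h set" where D: "countable D" "\<And>X. open X \<Longrightarrow> X \<noteq> {} \<Longrightarrow> \<exists>d\<in>D. d \<in> X"
    using countable_dense_setE[where 'a = 'h] by metis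
  have "D \<noteq> {}" using D(2)[of UNIV] by auto
  define d where "d = from_nat_into D"
  have rd: "range d = D" unfolding d_def using D(1) \<open>D \<noteq> {}\<close> by simp
  let ?ON = "\<lambda>B::'h set. finite B \<and> pairwise orthogonal B \<and> (\<forall>e\<in>B. norm e = 1)"
  have "\<exists>F. \<forall>n. ?ON (F n) \<and> (F n \<subseteq> F (Suc n) \<and> d n \<in> span (F (Suc n)))"
  proof (rule dependent_nat_choice)
    show "\<exists>x. ?ON x" by (intro exI[of _ "{}"]) (simp add: pairwise_def)
  next
    fix B n assume "?ON B"
    then show "\<exists>y. ?ON y \<and> B \<subseteq> y \<and> d n \<in> span y"
      by (metis finite_orthonormal_extend[of B "d n"])
  qed
  then obtain F where F: "\<And>n. ?ON (F n)" "\<And>n. F n \<subseteq> F (Suc n)" "\<And>n. d n \<in> span (F (Suc n))"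
    by blast
  have mono: "m \<le> n \<Longrightarrow> F m \<subseteq> F n" for m n using F(2) by (rule lift_Suc_mono_le)
  let ?B = "\<Union>n. F n"
  have "pairwise orthogonal ?B"
    unfolding pairwise_def
  proof (intro ballI impI)
    fix x y assume xy: "x \<in> ?B" "y \<in> ?B" "x \<noteq> y"
    then obtain m n where "x \<in> F m" "y \<in> F n" by blast
    then have "x \<in> F (max m n)" "y \<in> F (max m n)"
      using mono[of m "max m n"] mono[of n "max m n"] by auto
    then show "orthogonal x y" using F(1)[of "max m n"] xy(3) by (auto simp: pairwise_def)
  qed
  moreover have "D \<subseteq> span ?B"
    using F(3) span_mono[of "F _" ?B] by (fastforce simp flip: rd)
  have "closure (span ?B) = UNIV"
  proof (rule ccontr)
    assume "closure (span ?B) \<noteq> UNIV"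
    then obtain x where "x \<in> D" "x \<notin> closure (span ?B)"
      using D(2)[of "- closure (span ?B)"] by auto
    then show False using \<open>D \<subseteq> span ?B\<close> closure_subset[of "span ?B"] by blast
  qed
  ultimately have "orthonormal_basis ?B"
    using F(1) by (auto simp: orthonormal_basis_def)
  then show ?thesis by blast
qed

lemma orthonormal_projection_le:
  fixes F :: "'h::real_inner set"
  assumes F: "finite F" "pairwise orthogonal F" "\<forall>e\<in>F. norm e = 1" and y: "y \<in> span F"
  shows "norm (p - (\<Sum>e\<in>F. inner p e *\<^sub>R e)) \<le> norm (p - y)"
proof -
  let ?P = "\<Sum>e\<in>F. inner p e *\<^sub>R e"
  have orth: "inner (p - ?P) e = 0" if "e \<in> F" for e
  proof -
    have "(\<Sum>b\<in>F. inner p b * inner b e) = (\<Sum>b\<in>F. if b = e then inner p e else 0)"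
      using F that by (intro sum.cong) (auto simp: pairwise_def orthogonal_def norm_eq_1)
    then show ?thesis using that F(1) by (simp add: inner_diff_left inner_sum_left)
  qed
  have orth': "orthogonal (p - ?P) z" if "z \<in> span F" for z
    using orth orthogonal_to_span[OF that, of "p - ?P"] by (simp add: orthogonal_def)
  have "?P - y \<in> span F" by (intro span_diff y span_sum span_scale span_base)
  then have "(norm (p - y))\<^sup>2 = (norm (p - ?P))\<^sup>2 + (norm (?P - y))\<^sup>2"
    using norm_add_Pythagorean[OF orth', of "?P - y"] by simp
  then have "(norm (p - ?P))\<^sup>2 \<le> (norm (p - y))\<^sup>2" by simp
  then show ?thesis by (rule power2_le_imp_le) simp
qed

text \<open>The basis is arbitrary, so its countability comes first: distinct elements are at
  distance sqrt 2, and the balls of radius 1/2 around them are disjoint. The sets \<open>F n\<close>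
  serve all p and q at once, so that partial traces of random operators can be taken along one
  sequence.\<close>

lemma orthonormal_basis_parseval:
  fixes B :: "'h::{real_inner,second_countable_topology} set"
  assumes "orthonormal_basis B"
  obtains F where "\<And>n::nat. finite (F n)" "\<And>n. F n \<subseteq> B"
    "\<And>p q. (\<lambda>n. \<Sum>e\<in>F n. inner p e * inner e q) \<longlonglongrightarrow> inner p q"
proof -
  have B: "pairwise orthogonal B" "\<And>e. e \<in> B \<Longrightarrow> norm e = 1" "closure (span B) = UNIV"
    using assms by (auto simp: orthonormal_basis_def)
  have far: "1 < dist x y" if "x \<in> B" "y \<in> B" "x \<noteq> y" for x y
  proof -
    have "orthogonal x (- y)" using B(1) that by (auto simp: pairwise_def orthogonal_def)
    from norm_add_Pythagorean[OF this] have "(norm (x - y))\<^sup>2 = 2" using B(2) that by simp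
    then have "1\<^sup>2 < (norm (x - y))\<^sup>2" by simp
    then show ?thesis unfolding dist_norm by (rule power2_less_imp_less) simp
  qed
  have "countable ((\<lambda>e. ball e (1/2)) ` B)"
  proof (rule countable_disjoint_open_subsets)
    show "pairwise disjnt ((\<lambda>e. ball e (1/2)) ` B)"
    proof (rule pairwise_imageI)
      fix a b assume "a \<in> B" "b \<in> B" "a \<noteq> b"
      then have "1 < dist a b" by (rule far)
      then show "disjnt (ball a (1/2)) (ball b (1/2))"
        by (simp add: disjnt_def disjoint_ballI)
    qed
  qed auto
  moreover have "inj_on (\<lambda>e. ball e (1/2)) B"
  proof (rule inj_onI, rule ccontr)
    fix x y assume "x \<in> B" "y \<in> B" "ball x (1/2) = ball y (1/2)" "x \<noteq> y"
    moreover have "x \<in> ball x (1/2)" by simp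
    ultimately show False using far[of y x] by auto
  qed
  ultimately have "countable B" by (rule countable_image_inj_on)
  show ?thesis
  proof (cases "B = {}")
    case True
    then have "(x::'h) = 0" for x using B(3) by auto
    then have "inner p q = 0" for p q :: 'h by (metis inner_zero_left)
    then show ?thesis by (intro that[of "\<lambda>_. {}"]) auto
  next
    case False
    define F where "F n = from_nat_into B ` {..<n}" for n
    have F: "finite (F n)" "F n \<subseteq> B" for n
      using from_nat_into[OF False] by (auto simp: F_def)
    have mono: "m \<le> n \<Longrightarrow> F m \<subseteq> F n" for m n by (auto simp: F_def)
    have B_eq: "B = (\<Union>n. F n)"
    proof -
      have "B = range (from_nat_into B)" using \<open>countable B\<close> False by (simp add: range_from_nat_into)
      then show ?thesis unfolding F_def by (metis UN_lessThan_UNIV image_UN)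
    qed
    have on: "pairwise orthogonal (F n)" "\<forall>e\<in>F n. norm e = 1" for n
      using F[of n] B by (auto intro: pairwise_subset)
    define P where "P n p = (\<Sum>e\<in>F n. inner p e *\<^sub>R e)" for n p
    have lim: "(\<lambda>n. P n p) \<longlonglongrightarrow> p" for p
    proof (rule LIMSEQ_I)
      fix \<epsilon> :: real assume "0 < \<epsilon>"
      moreover have "p \<in> closure (span B)" by (simp add: B(3))
      ultimately obtain y where y: "y \<in> span B" "dist y p < \<epsilon>"
        by (auto simp: closure_approachable)
      have "\<exists>N. y \<in> span (F N)"
        using y(1)
      proof (induction rule: span_induct_alt)
        case base
        then show ?case by (auto intro: span_zero)
      next
        case (step c x z)
        then obtain N M where "z \<in> span (F N)" "x \<in> F M" by (auto simp: B_eq)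
        then have "z \<in> span (F (max N M))" "x \<in> span (F (max N M))"
          using span_mono[OF mono[of N "max N M"]] mono[of M "max N M"] span_base by auto
        then show ?case by (auto intro!: exI[of _ "max N M"] span_add span_scale)
      qed
      then obtain N where N: "y \<in> span (F N)" by blast
      have "norm (P n p - p) < \<epsilon>" if "N \<le> n" for n
      proof -
        have "y \<in> span (F n)" using N span_mono[OF mono[OF that]] by blast
        from orthonormal_projection_le[OF F(1) on this, of p] y(2)
        show ?thesis by (simp add: P_def dist_norm norm_minus_commute)
      qed
      then show "\<exists>N. \<forall>n\<ge>N. norm (P n p - p) < \<epsilon>" by blast
    qed
    have "(\<lambda>n. \<Sum>e\<in>F n. inner p e * inner e q) \<longlonglongrightarrow> inner p q" for p q
      using tendsto_inner[OF lim[of p] tendsto_const[of q]]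
      by (simp add: P_def inner_sum_left)
    then show ?thesis using F that by blast
  qed
qed

section \<open>Random designs\<close>

text \<open>The bound holds at every point, without null sets or membership in the space, so that
  closure under products and resolvents is a pointwise matter.\<close>

definition bounded_measurable :: "'c measure \<Rightarrow> ('c \<Rightarrow> 'd::real_normed_vector) \<Rightarrow> bool" where
  "bounded_measurable M X \<longleftrightarrow> X \<in> borel_measurable M \<and> (\<exists>B. \<forall>z. norm (X z) \<le> B)"

lemma bounded_measurableI:
  "X \<in> borel_measurable M \<Longrightarrow> (\<And>z. norm (X z) \<le> B) \<Longrightarrow> bounded_measurable M X"
  by (auto simp: bounded_measurable_def)

lemma bounded_measurable_const: "bounded_measurable M (\<lambda>_. c)"
  by (rule bounded_measurableI) auto

context
  fixes X Y :: "'c \<Rightarrow> 'd::{real_inner,second_countable_topology}" and u v :: "'c \<Rightarrow> real"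
    and M :: "'c measure"
begin

lemma bounded_measurable_add:
  assumes "bounded_measurable M X" "bounded_measurable M Y"
  shows "bounded_measurable M (\<lambda>z. X z + Y z)"
proof -
  obtain a b where "\<And>z. norm (X z) \<le> a" "\<And>z. norm (Y z) \<le> b"
    using assms by (auto simp: bounded_measurable_def)
  then show ?thesis using assms
    by (intro bounded_measurableI[where B = "a + b"] norm_triangle_mono)
      (auto simp: bounded_measurable_def)
qed

lemma bounded_measurable_diff:
  assumes "bounded_measurable M X" "bounded_measurable M Y"
  shows "bounded_measurable M (\<lambda>z. X z - Y z)"
proof -
  obtain a b where "\<And>z. norm (X z) \<le> a" "\<And>z. norm (Y z) \<le> b"
    using assms by (auto simp: bounded_measurable_def)
  then show ?thesis using assms
    by (intro bounded_measurableI[where B = "a + b"] order_trans[OF norm_triangle_ineq4] add_mono)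
      (auto simp: bounded_measurable_def)
qed

lemma bounded_measurable_inner:
  assumes "bounded_measurable M X" "bounded_measurable M Y"
  shows "bounded_measurable M (\<lambda>z. inner (X z) (Y z))"
proof -
  obtain a b where ab: "\<And>z. norm (X z) \<le> a" "\<And>z. norm (Y z) \<le> b"
    using assms by (auto simp: bounded_measurable_def)
  have [measurable]: "X \<in> borel_measurable M" "Y \<in> borel_measurable M"
    using assms by (auto simp: bounded_measurable_def)
  have "\<bar>inner (X z) (Y z)\<bar> \<le> a * b" for z
    using Cauchy_Schwarz_ineq2[of "X z" "Y z"] mult_mono'[OF ab(1)[of z] ab(2)[of z]] by simp
  then show ?thesis by (intro bounded_measurableI[where B = "a * b"]) auto
qed

lemma bounded_measurable_scaleR:
  assumes "bounded_measurable M u" "bounded_measurable M X"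
  shows "bounded_measurable M (\<lambda>z. u z *\<^sub>R X z)"
proof -
  obtain a b where ab: "\<And>z. norm (u z) \<le> a" "\<And>z. norm (X z) \<le> b"
    using assms by (auto simp: bounded_measurable_def)
  have [measurable]: "u \<in> borel_measurable M" "X \<in> borel_measurable M"
    using assms by (auto simp: bounded_measurable_def)
  have "norm (u z *\<^sub>R X z) \<le> a * b" for z
    using mult_mono'[OF ab(1)[of z] ab(2)[of z]] by simp
  then show ?thesis by (intro bounded_measurableI[where B = "a * b"]) auto
qed

lemma bounded_measurable_mult:
  assumes "bounded_measurable M u" "bounded_measurable M v"
  shows "bounded_measurable M (\<lambda>z. u z * v z)"
proof -
  obtain a b where ab: "\<And>z. norm (u z) \<le> a" "\<And>z. norm (v z) \<le> b"
    using assms by (auto simp: bounded_measurable_def)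
  have [measurable]: "u \<in> borel_measurable M" "v \<in> borel_measurable M"
    using assms by (auto simp: bounded_measurable_def)
  have "norm (u z * v z) \<le> a * b" for z
    using mult_mono'[OF ab(1)[of z] ab(2)[of z]] by (simp add: abs_mult)
  then show ?thesis by (intro bounded_measurableI[where B = "a * b"]) auto
qed

end

lemma bounded_measurable_sum:
  fixes X :: "'i \<Rightarrow> 'c \<Rightarrow> 'd::{real_inner,second_countable_topology}"
  shows "(\<And>i. i \<in> F \<Longrightarrow> bounded_measurable M (X i)) \<Longrightarrow> bounded_measurable M (\<lambda>z. \<Sum>i\<in>F. X i z)"
  by (induction F rule: infinite_finite_induct)
    (auto intro: bounded_measurable_const bounded_measurable_add)

lemma bounded_measurable_power2:
  fixes u :: "'c \<Rightarrow> real"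
  shows "bounded_measurable M u \<Longrightarrow> bounded_measurable M (\<lambda>z. (u z)\<^sup>2)"
  by (simp add: power2_eq_square bounded_measurable_mult)

lemma bounded_measurable_divide:
  fixes u :: "'c \<Rightarrow> real"
  shows "bounded_measurable M u \<Longrightarrow> bounded_measurable M (\<lambda>z. u z / c)"
  using bounded_measurable_mult[of M u "\<lambda>_. 1 / c"] bounded_measurable_const[of M "1 / c"] by simp

lemma bounded_measurable_norm:
  fixes X :: "'c \<Rightarrow> 'd::{real_inner,second_countable_topology}"
  shows "bounded_measurable M X \<Longrightarrow> bounded_measurable M (\<lambda>z. norm (X z))"
  by (auto simp: bounded_measurable_def)

lemmas bm_intros = bounded_measurable_const bounded_measurable_add bounded_measurable_diff
  bounded_measurable_inner bounded_measurable_scaleR bounded_measurable_mult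
  bounded_measurable_sum bounded_measurable_power2 bounded_measurable_divide bounded_measurable_norm

lemma (in finite_measure) bounded_measurable_integrable:
  fixes X :: "'a \<Rightarrow> 'd::{banach,second_countable_topology}"
  shows "bounded_measurable M X \<Longrightarrow> integrable M X"
  by (auto simp: bounded_measurable_def intro: integrable_const_bound)

lemma integrable_mult_bounded_measurable:
  fixes u v :: "'c \<Rightarrow> real"
  assumes "integrable M u" "bounded_measurable M v"
  shows "integrable M (\<lambda>z. u z * v z)"
proof -
  obtain b where b: "\<And>z. norm (v z) \<le> b" using assms by (auto simp: bounded_measurable_def)
  have [measurable]: "u \<in> borel_measurable M" "v \<in> borel_measurable M"
    using assms by (auto simp: bounded_measurable_def)
  show ?thesis
  proof (rule Bochner_Integration.integrable_bound)
    show "integrable M (\<lambda>z. b * u z)" using assms(1) by simp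
    have "norm (u z * v z) \<le> norm (b * u z)" for z
      using mult_left_mono[of "\<bar>v z\<bar>" "\<bar>b\<bar>" "\<bar>u z\<bar>"] b[of z] by (simp add: abs_mult mult.commute)
    then show "AE z in M. norm (u z * v z) \<le> norm (b * u z)" by simp
  qed measurable
qed

section \<open>The covariance operator and its resolvent\<close>

definition cov_op :: "'b measure \<Rightarrow> ('b \<Rightarrow> 'h) \<Rightarrow> 'h \<Rightarrow> 'h::{real_inner,banach,second_countable_topology}" where
  "cov_op S kf f = (LINT y|S. inner (kf y) f *\<^sub>R kf y)"

text \<open>Population counterpart of \<open>res\<close>: n sample points contribute n T in the
  mean. It equals 1 / n times the inverse of t / n + T when n is positive.\<close>

definition pop_res :: "'b measure \<Rightarrow> ('b \<Rightarrow> 'h) \<Rightarrow> real \<Rightarrow> real \<Rightarrow> 'h \<Rightarrow> 'h::{real_inner,banach,second_countable_topology}" where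
  "pop_res S kf t n = inv (\<lambda>f. t *\<^sub>R f + n *\<^sub>R cov_op S kf f)"

locale random_design = prob_space S
  for S :: "'b measure" +
  fixes kf :: "'b \<Rightarrow> 'h::{real_inner,banach,second_countable_topology}" and \<kappa> :: real
  assumes kf_measurable [measurable]: "kf \<in> borel_measurable S"
    and norm_kf: "norm (kf y) \<le> \<kappa>"
begin

abbreviation "T \<equiv> cov_op S kf"

lemma kappa_nonneg: "0 \<le> \<kappa>"
  using norm_kf[of undefined] norm_ge_zero[of "kf undefined"] by linarith

lemma inner_kf_le: "(inner (kf y) f)\<^sup>2 \<le> \<kappa>\<^sup>2 * (norm f)\<^sup>2"
proof -
  have "\<bar>inner (kf y) f\<bar> \<le> norm (kf y) * norm f" by (rule Cauchy_Schwarz_ineq2)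
  also have "\<dots> \<le> \<kappa> * norm f" by (intro mult_right_mono norm_kf) simp
  finally show ?thesis using power_mono[of "\<bar>inner (kf y) f\<bar>" "\<kappa> * norm f" 2]
    by (simp add: power_mult_distrib)
qed

lemma kf_bm: "bounded_measurable S kf"
  by (rule bounded_measurableI[OF kf_measurable norm_kf])

lemma integrable_cov: "integrable S (\<lambda>y. inner (kf y) f *\<^sub>R kf y)"
  by (intro bounded_measurable_integrable bm_intros kf_bm)

lemma inner_T: "inner g (T f) = (LINT y|S. inner (kf y) g * inner (kf y) f)"
  unfolding cov_op_def
  by (subst integral_inner_right[symmetric])
    (simp_all add: integrable_cov inner_commute[of g] mult.commute)

lemma T_nonneg: "0 \<le> inner f (T f)"
  by (auto simp: inner_T intro!: integral_nonneg)

lemma bounded_linear_T: "bounded_linear T"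
proof (rule bounded_linear_intro)
  show "T (f + g) = T f + T g" for f g
    using Bochner_Integration.integral_add[OF integrable_cov[of f] integrable_cov[of g]]
    by (simp add: cov_op_def inner_add_right scaleR_add_left)
  show "T (c *\<^sub>R f) = c *\<^sub>R T f" for c f
    by (simp add: cov_op_def flip: scaleR_scaleR)
  show "norm (T f) \<le> norm f * \<kappa>\<^sup>2" for f
  proof -
    have "norm (inner (kf y) f *\<^sub>R kf y) \<le> norm f * \<kappa>\<^sup>2" for y
    proof -
      have "\<bar>inner (kf y) f\<bar> * norm (kf y) \<le> (norm (kf y) * norm f) * norm (kf y)"
        by (intro mult_right_mono Cauchy_Schwarz_ineq2) simp
      also have "\<dots> = norm f * (norm (kf y))\<^sup>2" by (simp add: power2_eq_square)
      also have "\<dots> \<le> norm f * \<kappa>\<^sup>2" by (intro mult_left_mono power_mono norm_kf) auto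
      finally show ?thesis by simp
    qed
    then have "(LINT y|S. norm (inner (kf y) f *\<^sub>R kf y)) \<le> (LINT y|S. norm f * \<kappa>\<^sup>2)"
      by (intro integral_mono integrable_norm integrable_cov) auto
    moreover have "norm (T f) \<le> (LINT y|S. norm (inner (kf y) f *\<^sub>R kf y))"
      unfolding cov_op_def by (rule integral_norm_bound)
    ultimately show ?thesis by (simp add: prob_space)
  qed
qed

lemma bij_pop: "0 < t \<Longrightarrow> 0 \<le> n \<Longrightarrow> bij (\<lambda>f. t *\<^sub>R f + n *\<^sub>R T f)"
proof (rule coercive_bij)
  show "bounded_linear (\<lambda>f. t *\<^sub>R f + n *\<^sub>R T f)"
    by (intro bounded_linear_add bounded_linear_scaleR_right bounded_linear_compose[OF bounded_linear_scaleR_right bounded_linear_T])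
qed (auto simp: inner_add_right power2_norm_eq_inner T_nonneg)

context
  fixes t n :: real
  assumes tn: "0 < t" "0 \<le> n"
begin

lemma pop_res_right [simp]: "t *\<^sub>R pop_res S kf t n f + n *\<^sub>R T (pop_res S kf t n f) = f"
  using surj_f_inv_f[OF bij_is_surj[OF bij_pop[OF tn]], of f] by (simp add: pop_res_def)

lemma pop_res_unique: "t *\<^sub>R f + n *\<^sub>R T f = h \<Longrightarrow> pop_res S kf t n h = f"
  using inv_f_f[OF bij_is_inj[OF bij_pop[OF tn]], of f] by (simp add: pop_res_def)

lemma norm_pop_res_le: "norm (pop_res S kf t n f) \<le> norm f / t"
proof -
  let ?q = "pop_res S kf t n f"
  have "t * (norm ?q)\<^sup>2 \<le> t * inner ?q ?q + n * inner ?q (T ?q)"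
    using tn T_nonneg by (simp add: power2_norm_eq_inner)
  also have "\<dots> = inner ?q f"
    using arg_cong[where f = "inner ?q", OF pop_res_right[of f]]
    by (simp add: inner_add_right del: pop_res_right)
  also have "\<dots> \<le> norm f * norm ?q" using norm_cauchy_schwarz[of ?q f] by (simp add: mult.commute)
  finally show ?thesis using tn
    by (cases "?q = 0") (auto simp: power2_eq_square field_simps)
qed

lemma bounded_linear_pop_res: "bounded_linear (pop_res S kf t n)"
proof (rule bounded_linear_intro)
  interpret T: bounded_linear T by (rule bounded_linear_T)
  show "pop_res S kf t n (f + g) = pop_res S kf t n f + pop_res S kf t n g" for f g
  proof (rule pop_res_unique)
    show "t *\<^sub>R (pop_res S kf t n f + pop_res S kf t n g) + n *\<^sub>R T (pop_res S kf t n f + pop_res S kf t n g) = f + g"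
      using arg_cong2[where f = plus, OF pop_res_right[of f] pop_res_right[of g]]
      by (simp add: T.add algebra_simps del: pop_res_right)
  qed
  show "pop_res S kf t n (c *\<^sub>R f) = c *\<^sub>R pop_res S kf t n f" for c f
  proof (rule pop_res_unique)
    show "t *\<^sub>R (c *\<^sub>R pop_res S kf t n f) + n *\<^sub>R T (c *\<^sub>R pop_res S kf t n f) = c *\<^sub>R f"
      using arg_cong[where f = "scaleR c", OF pop_res_right[of f]]
      by (simp add: T.scaleR algebra_simps del: pop_res_right)
  qed
  show "norm (pop_res S kf t n f) \<le> norm f * (1 / t)" for f
    using norm_pop_res_le by simp
qed

end

end

section \<open>Independent samples and integration over one coordinate\<close>

locale product_design = random_design S kf \<kappa>
  for S :: "'b measure" and kf :: "'b \<Rightarrow> 'h::{real_inner,banach,second_countable_topology}" and \<kappa> :: real +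
  fixes I :: "nat set"
  assumes finite_I: "finite I"
begin

abbreviation "P \<equiv> Pi\<^sub>M I (\<lambda>_. S)"

sublocale P: prob_space P
  by (intro prob_space_PiM) (rule prob_space_axioms)

sublocale PS: product_sigma_finite "\<lambda>_::nat. S"
  by unfold_locales

text \<open>Fubini with all other coordinates frozen; this stands in for conditional expectations
  given the remaining sample points.\<close>

lemma coordinate_nonneg:
  fixes \<Phi> :: "(nat \<Rightarrow> 'b) \<Rightarrow> real"
  assumes "i \<in> I" "integrable P \<Phi>" "\<And>z. 0 \<le> (LINT y|S. \<Phi> (z(i := y)))"
  shows "0 \<le> (LINT z|P. \<Phi> z)"
proof -
  have "insert i (I - {i}) = I" using \<open>i \<in> I\<close> by auto
  then have "(LINT z|P. \<Phi> z) = (LINT z|Pi\<^sub>M (I - {i}) (\<lambda>_. S). LINT y|S. \<Phi> (z(i := y)))"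
    using PS.product_integral_insert[of "I - {i}" i \<Phi>] assms finite_I by simp
  then show ?thesis using assms(3) by (simp add: integral_nonneg)
qed

lemma coordinate_zero:
  fixes \<Phi> :: "(nat \<Rightarrow> 'b) \<Rightarrow> real"
  assumes "i \<in> I" "integrable P \<Phi>" "\<And>z. (LINT y|S. \<Phi> (z(i := y))) = 0"
  shows "(LINT z|P. \<Phi> z) = 0"
  using coordinate_nonneg[of i \<Phi>] coordinate_nonneg[of i "\<lambda>z. - \<Phi> z"] assms by simp

lemma expectation_coordinate:
  fixes \<phi> :: "'b \<Rightarrow> real"
  assumes "i \<in> I" and [measurable]: "\<phi> \<in> borel_measurable S"
  shows "(LINT z|P. \<phi> (z i)) = (LINT y|S. \<phi> y)"
proof -
  have "(LINT y|S. \<phi> y) = (LINT y|distr P S (\<lambda>z. z i). \<phi> y)"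
    using distr_PiM_component[of I "\<lambda>_. S" i] prob_space_axioms assms(1) by simp
  also have "\<dots> = (LINT z|P. \<phi> (z i))"
    by (rule integral_distr) (use \<open>i \<in> I\<close> in measurable)
  finally show ?thesis by simp
qed

lemma kf_coordinate_bm: "i \<in> I \<Longrightarrow> bounded_measurable P (\<lambda>z. kf (z i))"
  by (rule bounded_measurableI[OF _ norm_kf]) measurable

lemma res_bm:
  assumes "L \<subseteq> I" "0 < t" "bounded_measurable P h"
  shows "bounded_measurable P (\<lambda>z. res (\<lambda>i. kf (z i)) t L (h z))"
proof -
  obtain B where B: "\<And>z. norm (h z) \<le> B" and [measurable]: "h \<in> borel_measurable P"
    using assms(3) by (auto simp: bounded_measurable_def)
  show ?thesis
  proof (rule bounded_measurableI)
    show "norm (res (\<lambda>i. kf (z i)) t L (h z)) \<le> B / t" for z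
      using norm_res_le[OF \<open>0 < t\<close>, of "\<lambda>i. kf (z i)" L "h z"] divide_right_mono[OF B[of z], of t] \<open>0 < t\<close>
      by linarith
    show "(\<lambda>z. res (\<lambda>i. kf (z i)) t L (h z)) \<in> borel_measurable P"
      using assms finite_I by (intro borel_measurable_res) (auto intro: finite_subset)
  qed
qed

end

section \<open>Leave-one-out estimates\<close>

text \<open>\<open>j\<close> is the test point and \<open>J - {j}\<close> the training set; \<open>D\<close> bounds the effective dimension at
  \<open>t / n\<close>, because \<open>(T + (t/n))\<^bsup>-1\<^esup> T = 1 - t (t + n T)\<^bsup>-1\<^esup>\<close>.\<close>

locale leave_one_out = product_design S kf \<kappa> I
  for S :: "'b measure" and kf :: "'b \<Rightarrow> 'h::{real_inner,banach,second_countable_topology}" and \<kappa> :: real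
    and I :: "nat set" +
  fixes J :: "nat set" and j :: nat and t n D :: real
  assumes J: "J \<subseteq> I" "j \<in> J" and n_def: "n = real (card J)"
    and t: "1 \<le> t" "t \<le> n"
    and trace_bound: "\<exists>B. orthonormal_basis B \<and>
      (\<forall>F. finite F \<longrightarrow> F \<subseteq> B \<longrightarrow> (\<Sum>e\<in>F. inner e e - t * inner e (pop_res S kf t n e)) \<le> D)"
begin

abbreviation "G z \<equiv> res (\<lambda>i. kf (z i)) t J"
abbreviation "G' z \<equiv> res (\<lambda>i. kf (z i)) t (J - {j})"
abbreviation "A z \<equiv> reg (\<lambda>i. kf (z i)) t J"
abbreviation "R \<equiv> pop_res S kf t n"
abbreviation "lev z \<equiv> inner (kf (z j)) (G' z (kf (z j)))"
abbreviation "E X \<equiv> (LINT z|P. X z)"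

lemma t_pos: "0 < t" and n_pos: "0 < n" and n_nonneg: "0 \<le> n" and t_nonneg: "0 \<le> t" using t by auto

lemma finite_J: "finite J" using J finite_I finite_subset by blast

lemma j_I: "j \<in> I" using J by auto

lemma J_sub: "i \<in> J \<Longrightarrow> i \<in> I" using J by auto

lemmas bms = bm_intros kf_coordinate_bm[OF J_sub] kf_coordinate_bm[OF j_I]
  res_bm[OF J(1) t_pos] res_bm[of "J - {j}", OF _ t_pos]

lemmas bm_int = P.bounded_measurable_integrable

lemma J_minus: "J - {j} \<subseteq> I" using J by auto

text \<open>\<open>G z\<close> is symmetric in the points of J, and the product measure is invariant
  under the transposition of i and j, so all summands have the same mean. \<open>G'\<close> singles
  out j and admits no such exchange.\<close>

lemma exchange:
  fixes F :: "'b \<Rightarrow> ('h \<Rightarrow> 'h) \<Rightarrow> real"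
  assumes F: "\<And>i. i \<in> J \<Longrightarrow> integrable P (\<lambda>z. F (z i) (G z))"
  shows "E (\<lambda>z. \<Sum>i\<in>J. F (z i) (G z)) = n * E (\<lambda>z. F (z j) (G z))"
proof -
  have "E (\<lambda>z. F (z i) (G z)) = E (\<lambda>z. F (z j) (G z))" if i: "i \<in> J" for i
  proof -
    let ?p = "\<lambda>l. if l = i then j else if l = j then i else l"
    let ?s = "\<lambda>z. \<lambda>l\<in>I. z (?p l)"
    have p: "inj_on ?p I" "?p \<in> I \<rightarrow> I" "bij_betw ?p J J"
      using i J by (auto simp: inj_on_def bij_betw_def image_iff)
    have [measurable]: "?s \<in> measurable P P"
      by (rule measurable_restrict, rule measurable_component_singleton) (use J_sub[OF i] j_I in auto)
    have "distr P P ?s = P"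
      using distr_PiM_reindex[of I "\<lambda>_. S" ?p I] p prob_space_axioms by simp
    then have "E (\<lambda>z. F (z j) (G z)) = (LINT z|distr P P ?s. F (z j) (G z))" by simp
    also have "\<dots> = E (\<lambda>z. F (?s z j) (G (?s z)))"
      by (rule integral_distr) (use F[OF J(2)] in auto)
    also have "\<dots> = E (\<lambda>z. F (z i) (G z))"
    proof -
      have "G (?s z) = G z" for z
      proof -
        have "G (?s z) = res (\<lambda>l. kf (z (?p l))) t J"
          by (rule res_cong) (use J in auto)
        also have "\<dots> = G z" by (rule res_reindex[OF p(3)])
        finally show ?thesis .
      qed
      moreover have "?s z j = z i" for z using j_I by auto
      ultimately have "F (?s z j) (G (?s z)) = F (z i) (G z)" for z by metis
      then show ?thesis by (rule Bochner_Integration.integral_cong[OF refl])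
    qed
    finally show ?thesis by simp
  qed
  then have "(\<Sum>i\<in>J. E (\<lambda>z. F (z i) (G z))) = (\<Sum>i\<in>J. E (\<lambda>z. F (z j) (G z)))"
    by (intro sum.cong) auto
  then show ?thesis using F by (simp add: n_def)
qed

lemma E_quadratic: "E (\<lambda>z. \<Sum>i\<in>J. inner (kf (z i)) f * inner (kf (z i)) g) = n * inner f (T g)"
proof -
  have "E (\<lambda>z. \<Sum>i\<in>J. inner (kf (z i)) f * inner (kf (z i)) g)
      = (\<Sum>i\<in>J. E (\<lambda>z. inner (kf (z i)) f * inner (kf (z i)) g))"
    by (intro Bochner_Integration.integral_sum bm_int bms)
  also have "\<dots> = (\<Sum>i\<in>J. inner f (T g))"
    using J_sub expectation_coordinate[where \<phi> = "\<lambda>y. inner (kf y) f * inner (kf y) g"]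
    by (intro sum.cong) (auto simp: inner_T)
  finally show ?thesis by (simp add: n_def)
qed

lemma E_reg: "E (\<lambda>z. inner f (A z g)) = inner f (t *\<^sub>R g + n *\<^sub>R T g)"
proof -
  have "E (\<lambda>z. inner f (A z g)) = E (\<lambda>z. t * inner f g + (\<Sum>i\<in>J. inner (kf (z i)) f * inner (kf (z i)) g))"
    by (simp add: inner_reg)
  also have "\<dots> = t * inner f g + E (\<lambda>z. \<Sum>i\<in>J. inner (kf (z i)) f * inner (kf (z i)) g)"
    by (subst Bochner_Integration.integral_add)
      (auto simp: P.prob_space intro!: bm_int bms)
  finally show ?thesis by (simp add: E_quadratic inner_add_right)
qed

text \<open>The quadratic form of an inverse is a supremum of affine functions of the operator, so its
  mean dominates its value at the mean operator.\<close>

lemma E_res_ge: "inner e (R e) \<le> E (\<lambda>z. inner e (G z e))"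
proof -
  define p where "p = R e"
  have p: "t *\<^sub>R p + n *\<^sub>R T p = e" unfolding p_def by (rule pop_res_right[OF t_pos n_nonneg])
  \<comment> \<open>The affine lower bound for a trial vector p, obtained from the nonnegative form
    at the residual \<open>e - A z p\<close>. The trial vector \<open>R e\<close> is the optimal one
    for the mean operator.\<close>
  have "2 * inner e p - inner p (A z p) \<le> inner e (G z e)" for z
  proof -
    have "0 \<le> inner (e - A z p) (G z (e - A z p))" by (rule res_nonneg[OF t_pos])
    also have "G z (e - A z p) = G z e - p"
      by (simp add: linear_diff[OF linear_res[OF t_pos]] res_reg[OF t_pos])
    also have "inner (e - A z p) (G z e - p) = inner e (G z e) - inner e p - inner (A z p) (G z e) + inner (A z p) p"
      by (simp add: inner_diff)
    also have "inner (A z p) (G z e) = inner p e"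
      by (simp add: reg_symmetric[symmetric] reg_res[OF t_pos])
    finally show ?thesis by (simp add: inner_commute)
  qed
  then have "E (\<lambda>z. 2 * inner e p - inner p (A z p)) \<le> E (\<lambda>z. inner e (G z e))"
    by (intro integral_mono) (auto simp: inner_reg intro!: bm_int bms)
  also have "E (\<lambda>z. 2 * inner e p - inner p (A z p)) = 2 * inner e p - E (\<lambda>z. inner p (A z p))"
    by (subst Bochner_Integration.integral_diff)
      (auto simp: inner_reg P.prob_space intro!: bm_int bms)
  also have "\<dots> = inner e p" by (simp add: E_reg p inner_commute)
  finally show ?thesis by (simp add: p_def)
qed

text \<open>The in-sample leverages add up to the trace of 1 - t G, the effective dimension of the
  sample. \<open>E_res_ge\<close> compares it with the population one basis vector at a time. The
  partial traces \<open>X m\<close> are nonnegative, so Fatou's lemma carries the bound to the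
  limit.\<close>

lemma E_leverage_sum: "E (\<lambda>z. \<Sum>i\<in>J. inner (kf (z i)) (G z (kf (z i)))) \<le> D"
proof -
  obtain B where B: "orthonormal_basis B"
    "\<And>F. finite F \<Longrightarrow> F \<subseteq> B \<Longrightarrow> (\<Sum>e\<in>F. inner e e - t * inner e (R e)) \<le> D"
    using trace_bound by blast
  obtain F where F: "\<And>m::nat. finite (F m)" "\<And>m. F m \<subseteq> B"
    "\<And>p q. (\<lambda>m. \<Sum>e\<in>F m. inner p e * inner e q) \<longlonglongrightarrow> inner p q"
    using orthonormal_basis_parseval[OF B(1)] by metis
  define X where "X m z = (\<Sum>e\<in>F m. inner e e - t * inner e (G z e))" for m z
  have X_bm: "bounded_measurable P (X m)" for m
    unfolding X_def by (intro bms)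
  have expand: "inner e e - t * inner e (G z e) = (\<Sum>i\<in>J. inner (G z (kf (z i))) e * inner e (kf (z i)))" for e z
  proof -
    have "inner e e = inner e (A z (G z e))" by (simp add: reg_res[OF t_pos])
    also have "\<dots> = t * inner e (G z e) + (\<Sum>i\<in>J. inner (kf (z i)) e * inner (kf (z i)) (G z e))"
      by (rule inner_reg)
    finally have "inner e e - t * inner e (G z e) = (\<Sum>i\<in>J. inner (kf (z i)) e * inner (kf (z i)) (G z e))"
      by simp
    also have "\<dots> = (\<Sum>i\<in>J. inner (G z (kf (z i))) e * inner e (kf (z i)))"
    proof (rule sum.cong[OF refl])
      fix i
      show "inner (kf (z i)) e * inner (kf (z i)) (G z e) = inner (G z (kf (z i))) e * inner e (kf (z i))"
        using res_symmetric[OF t_pos, of "kf (z i)" "\<lambda>i. kf (z i)" J e] inner_commute[of e "kf (z i)"] by simp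
    qed
    finally show ?thesis .
  qed
  have X_nonneg: "0 \<le> X m z" for m z
  proof -
    have "t * inner e (G z e) \<le> inner e e" for e
      using res_inner_le[OF t_pos, of e "\<lambda>i. kf (z i)" J] t_pos
      by (simp add: field_simps power2_norm_eq_inner)
    then show ?thesis by (auto simp: X_def intro!: sum_nonneg)
  qed
  have lim: "(\<lambda>m. X m z) \<longlonglongrightarrow> (\<Sum>i\<in>J. inner (kf (z i)) (G z (kf (z i))))" for z
  proof -
    have "X m z = (\<Sum>i\<in>J. \<Sum>e\<in>F m. inner (G z (kf (z i))) e * inner e (kf (z i)))" for m
      unfolding X_def expand by (rule sum.swap)
    moreover have "(\<lambda>m. \<Sum>i\<in>J. \<Sum>e\<in>F m. inner (G z (kf (z i))) e * inner e (kf (z i)))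
        \<longlonglongrightarrow> (\<Sum>i\<in>J. inner (G z (kf (z i))) (kf (z i)))"
      by (intro tendsto_sum F(3))
    ultimately show ?thesis by (simp add: inner_commute)
  qed
  have EX: "E (X m) \<le> D" for m
  proof -
    have "E (X m) = (\<Sum>e\<in>F m. inner e e - t * E (\<lambda>z. inner e (G z e)))"
    proof -
      have "E (X m) = (\<Sum>e\<in>F m. E (\<lambda>z. inner e e - t * inner e (G z e)))"
        unfolding X_def by (intro Bochner_Integration.integral_sum bm_int bms)
      moreover have "E (\<lambda>z. inner e e - t * inner e (G z e)) = inner e e - t * E (\<lambda>z. inner e (G z e))" for e
        by (subst Bochner_Integration.integral_diff) (auto simp: P.prob_space intro!: bm_int bms)
      ultimately show ?thesis by simp
    qed
    also have "\<dots> \<le> (\<Sum>e\<in>F m. inner e e - t * inner e (R e))"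
      using E_res_ge t_nonneg by (intro sum_mono) (simp add: mult_left_mono)
    also have "\<dots> \<le> D" using F B(2) by blast
    finally show ?thesis .
  qed
  have "0 \<le> D" using B(2)[of "{}"] by simp
  have nn: "(\<integral>\<^sup>+z. ennreal (\<Sum>i\<in>J. inner (kf (z i)) (G z (kf (z i)))) \<partial>P) \<le> ennreal D"
  proof -
    have "(\<integral>\<^sup>+z. ennreal (\<Sum>i\<in>J. inner (kf (z i)) (G z (kf (z i)))) \<partial>P)
        = (\<integral>\<^sup>+z. liminf (\<lambda>m. ennreal (X m z)) \<partial>P)"
      by (intro nn_integral_cong lim_imp_Liminf[symmetric] tendsto_ennrealI lim) simp
    also have "\<dots> \<le> liminf (\<lambda>m. \<integral>\<^sup>+z. ennreal (X m z) \<partial>P)"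
    proof (rule nn_integral_liminf)
      have [measurable]: "X m \<in> borel_measurable P" for m
        using X_bm by (auto simp: bounded_measurable_def)
      show "(\<lambda>z. ennreal (X m z)) \<in> borel_measurable P" for m by measurable
    qed
    also have "\<dots> \<le> ennreal D"
    proof (rule Liminf_le)
      have "(\<integral>\<^sup>+z. ennreal (X m z) \<partial>P) \<le> ennreal D" for m
        using EX[of m] X_nonneg by (subst nn_integral_eq_integral) (auto intro!: bm_int X_bm ennreal_leI)
      then show "\<forall>\<^sub>F m in sequentially. (\<integral>\<^sup>+z. ennreal (X m z) \<partial>P) \<le> ennreal D" by simp
    qed simp
    finally show ?thesis .
  qed
  moreover have "bounded_measurable P (\<lambda>z. \<Sum>i\<in>J. inner (kf (z i)) (G z (kf (z i))))"
    by (intro bms)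
  moreover have "0 \<le> (\<Sum>i\<in>J. inner (kf (z i)) (G z (kf (z i))))" for z
    by (intro sum_nonneg res_nonneg[OF t_pos])
  ultimately show ?thesis using \<open>0 \<le> D\<close>
    by (subst (asm) nn_integral_eq_integral) (auto intro: bm_int)
qed

section \<open>Removing the test point\<close>

lemma G'_eq: "G' z f = G z f + inner (kf (z j)) (G z f) *\<^sub>R G' z (kf (z j))"
  using res_remove[OF t_pos, of "J - {j}" j "\<lambda>i. kf (z i)" f] finite_J by (simp add: insert_absorb[OF J(2)])

lemma inner_G': "inner (kf (z j)) (G' z f) = (1 + lev z) * inner (kf (z j)) (G z f)"
  using leverage_remove[OF t_pos, of "J - {j}" j "\<lambda>i. kf (z i)" f] finite_J by (simp add: insert_absorb[OF J(2)])

lemma G'_self: "G' z (kf (z j)) = (1 + lev z) *\<^sub>R G z (kf (z j))"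
  using res_remove_self[OF t_pos, of "J - {j}" j "\<lambda>i. kf (z i)"] finite_J by (simp add: insert_absorb[OF J(2)])

lemma lev_nonneg: "0 \<le> lev z"
  by (rule res_nonneg[OF t_pos])

lemma lev_le: "lev z \<le> \<kappa>\<^sup>2"
proof -
  have "lev z \<le> (norm (kf (z j)))\<^sup>2 / t" by (rule res_inner_le[OF t_pos])
  \<comment> \<open>Here \<open>1 \<le> t\<close> enters: it keeps every factor
    \<open>1 + lev z\<close> bounded independently of \<lambda> and of the sample size.\<close>
  also have "\<dots> \<le> \<kappa>\<^sup>2 / 1" using t by (intro frac_le power_mono norm_kf) auto
  finally show ?thesis by simp
qed

lemma lev_bm: "bounded_measurable P lev"
  by (intro bms Diff_subset[THEN subset_trans] J)

text \<open>The out-of-sample leverage is \<open>1 + lev z\<close> times the in-sample one, and by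
  exchangeability the latter has as its mean 1 / n of the mean effective dimension of the
  sample.\<close>

lemma E_lev: "E lev \<le> (1 + \<kappa>\<^sup>2) * D / n"
proof -
  have "lev z \<le> (1 + \<kappa>\<^sup>2) * inner (kf (z j)) (G z (kf (z j)))" for z
    by (subst inner_G') (intro mult_right_mono add_left_mono lev_le res_nonneg[OF t_pos])
  then have "E lev \<le> E (\<lambda>z. (1 + \<kappa>\<^sup>2) * inner (kf (z j)) (G z (kf (z j))))"
    by (intro integral_mono bm_int lev_bm) (auto intro!: bms)
  also have "\<dots> = (1 + \<kappa>\<^sup>2) * E (\<lambda>z. inner (kf (z j)) (G z (kf (z j))))" by simp
  also have "E (\<lambda>z. inner (kf (z j)) (G z (kf (z j)))) \<le> D / n"
  proof -
    have "E (\<lambda>z. \<Sum>i\<in>J. inner (kf (z i)) (G z (kf (z i)))) = n * E (\<lambda>z. inner (kf (z j)) (G z (kf (z j))))"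
      by (rule exchange[of "\<lambda>y g. inner (kf y) (g (kf y))"]) (intro bm_int bms)
    with E_leverage_sum n_pos show ?thesis by (simp add: field_simps)
  qed
  finally show ?thesis by (simp add: mult_left_mono divide_simps)
qed

text \<open>\<open>G z\<close> maps \<open>t q + n T q\<close> to the minimiser of a random quadratic functional whose mean is
  minimised by \<open>q\<close>; \<open>energy q z\<close> is the excess of the random functional at \<open>q\<close>.\<close>

definition energy :: "'h \<Rightarrow> (nat \<Rightarrow> 'b) \<Rightarrow> real" where
  "energy q z = (let d = G z (t *\<^sub>R q + n *\<^sub>R T q) - q in inner d (A z d))"

text \<open>In the bracket, 1 / 4 comes from the facts \<open>third\<close> and the other terms from
  \<open>first\<close> in \<open>energy_pointwise\<close>; \<open>1 + \<kappa>\<^sup>2\<close> is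
  the price of \<open>E_lev\<close>, and the leading 2 that of absorbing half of the energy.\<close>

abbreviation "C1 \<equiv> 2 * (\<kappa>\<^sup>2 + \<kappa>\<^sup>2 * \<kappa>\<^sup>2 / 2 + 1 / 4) * (1 + \<kappa>\<^sup>2)"

lemma D_nonneg: "0 \<le> D" using trace_bound by (metis empty_subsetI finite.emptyI sum.empty)

lemma C1_nonneg: "0 \<le> C1" by simp

context
  fixes q :: 'h
begin

abbreviation "tgt \<equiv> t *\<^sub>R q + n *\<^sub>R T q"
abbreviation "\<Delta> z \<equiv> G z tgt - q"
abbreviation "kj z \<equiv> kf (z j)"

lemma energy_split: "energy q z = t * (norm (\<Delta> z))\<^sup>2 + (\<Sum>i\<in>J. (inner (kf (z i)) (\<Delta> z))\<^sup>2)"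
  by (simp add: energy_def Let_def inner_reg power2_norm_eq_inner power2_eq_square[of "inner _ _"])

lemma energy_bm: "bounded_measurable P (energy q)"
  unfolding energy_split by (intro bms)

lemma energy_sample_le: "(\<Sum>i\<in>J. (inner (kf (z i)) (\<Delta> z))\<^sup>2) \<le> energy q z"
  and energy_norm_le: "t * (norm (\<Delta> z))\<^sup>2 \<le> energy q z"
  using t_nonneg by (auto simp: energy_split intro!: sum_nonneg)

lemma E_energy_point: "n * E (\<lambda>z. (inner (kj z) (\<Delta> z))\<^sup>2) \<le> E (energy q)"
proof -
  have "n * E (\<lambda>z. (inner (kj z) (\<Delta> z))\<^sup>2) = E (\<lambda>z. \<Sum>i\<in>J. (inner (kf (z i)) (\<Delta> z))\<^sup>2)"
    by (rule exchange[symmetric, of "\<lambda>y g. (inner (kf y) (g tgt - q))\<^sup>2"]) (intro bm_int bms)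
  also have "\<dots> \<le> E (energy q)"
    by (intro integral_mono bm_int energy_bm energy_sample_le) (intro bms)
  finally show ?thesis .
qed

text \<open>\<open>G'\<close> does not involve the point j, so T may be replaced by the rank-one
  operator of \<open>kj z\<close>, whose mean it is.\<close>

lemma E_independent: "E (\<lambda>z. inner (G' z tgt) (T q)) = E (\<lambda>z. inner (kj z) (G' z tgt) * inner (kj z) q)"
proof -
  let ?\<Phi> = "\<lambda>z. inner (G' z tgt) (T q) - inner (kj z) (G' z tgt) * inner (kj z) q"
  have 1: "bounded_measurable P (\<lambda>z. inner (G' z tgt) (T q))"
    "bounded_measurable P (\<lambda>z. inner (kj z) (G' z tgt) * inner (kj z) q)"
    by (intro bms J_minus)+
  have "E ?\<Phi> = 0"
  proof (rule coordinate_zero[OF j_I])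
    show "integrable P ?\<Phi>" by (intro bm_int bounded_measurable_diff 1)
    fix z :: "nat \<Rightarrow> 'b"
    have "G' (z(j := y)) = G' z" for y by (rule res_cong) auto
    moreover have "(LINT y|S. inner g (T q) - inner (kf y) g * inner (kf y) q) = 0" for g
    proof (subst Bochner_Integration.integral_diff)
      show "integrable S (\<lambda>y. inner (kf y) g * inner (kf y) q)"
        by (intro bounded_measurable_integrable bm_intros kf_bm)
    qed (auto simp: prob_space inner_T)
    ultimately show "(LINT y|S. ?\<Phi> (z(j := y))) = 0" by simp
  qed
  then show ?thesis using 1 by (subst (asm) Bochner_Integration.integral_diff) (auto intro: bm_int)
qed

text \<open>Since \<open>A z (\<Delta> z) = tgt - A z q\<close>, the energy pairs
  \<open>\<Delta> z\<close> with the fluctuation of the Gram operator at the fixed vector q. Trading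
  \<open>G\<close> for \<open>G'\<close> in the population half yields, by independence, the leading
  term that exchangeability yields in the sample half. These cancel; what survives carries
  \<open>lev z\<close> or stems from the rank-one correction.\<close>

lemma E_energy_eq:
  "E (energy q) = n * E (\<lambda>z. lev z * (inner (kj z) (G z tgt) * inner (kj z) q)
     - inner (G' z (kj z)) (T q) * inner (kj z) (G z tgt))"
proof -
  let ?b = "\<lambda>z. inner q (n *\<^sub>R T q) - (\<Sum>i\<in>J. inner (kf (z i)) q * inner (kf (z i)) q)"
  let ?x = "\<lambda>z. inner (G z tgt) (n *\<^sub>R T q)"
  let ?y = "\<lambda>z. \<Sum>i\<in>J. inner (kf (z i)) (G z tgt) * inner (kf (z i)) q"
  have eq: "energy q z = ?x z - ?y z - ?b z" for z
  proof -
    have "A z (\<Delta> z) = tgt - A z q"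
      using linear_diff[OF bounded_linear.linear[OF bounded_linear_reg]] by (metis reg_res[OF t_pos])
    then have "energy q z = inner (\<Delta> z) tgt - inner (\<Delta> z) (A z q)"
      by (simp add: energy_def Let_def inner_diff_right)
    also have "\<dots> = ?x z - ?y z - ?b z"
      by (simp add: inner_reg inner_diff_left inner_diff_right inner_add_right algebra_simps sum_subtractf)
    finally show ?thesis .
  qed
  have xbm: "bounded_measurable P ?x" and ybm: "bounded_measurable P ?y"
    by (intro bms)+
  have "bounded_measurable P (\<lambda>z. \<Sum>i\<in>J. inner (kf (z i)) q * inner (kf (z i)) q)" by (intro bms)
  then have bbm: "bounded_measurable P ?b" by (rule bounded_measurable_diff[OF bounded_measurable_const])
  \<comment> \<open>The vector q is deterministic, so its own pairing with the fluctuation has mean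
    zero.\<close>
  have "E ?b = 0"
    by (subst Bochner_Integration.integral_diff)
      (auto simp: P.prob_space E_quadratic intro!: bm_int bms)
  moreover have "E (\<lambda>z. ?x z - ?y z - ?b z) = E (\<lambda>z. ?x z - ?y z) - E ?b"
    by (rule Bochner_Integration.integral_diff[OF bm_int[OF bounded_measurable_diff[OF xbm ybm]] bm_int[OF bbm]])
  moreover have "E (\<lambda>z. ?x z - ?y z) = E ?x - E ?y"
    by (rule Bochner_Integration.integral_diff[OF bm_int[OF xbm] bm_int[OF ybm]])
  ultimately have "E (energy q) = E ?x - E ?y" unfolding eq by linarith
  also have "E ?y = n * E (\<lambda>z. inner (kj z) (G z tgt) * inner (kj z) q)"
    by (rule exchange[of "\<lambda>y g. inner (kf y) (g tgt) * inner (kf y) q"]) (intro bm_int bms)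
  also have "E ?x = n * E (\<lambda>z. inner (G z tgt) (T q))" by simp
  also have "E (\<lambda>z. inner (G z tgt) (T q))
      = E (\<lambda>z. inner (G' z tgt) (T q) - inner (G' z (kj z)) (T q) * inner (kj z) (G z tgt))"
    by (subst G'_eq[of _ tgt]) (simp add: inner_add_left)
  also have "\<dots> = E (\<lambda>z. inner (G' z tgt) (T q)) - E (\<lambda>z. inner (G' z (kj z)) (T q) * inner (kj z) (G z tgt))"
    by (intro Bochner_Integration.integral_diff bm_int bms J_minus)
  also have "E (\<lambda>z. inner (G' z tgt) (T q)) = E (\<lambda>z. (1 + lev z) * (inner (kj z) (G z tgt) * inner (kj z) q))"
    unfolding E_independent by (subst inner_G') (simp add: mult.assoc)
  also have "n * (E (\<lambda>z. (1 + lev z) * (inner (kj z) (G z tgt) * inner (kj z) q))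
      - E (\<lambda>z. inner (G' z (kj z)) (T q) * inner (kj z) (G z tgt)))
      - n * E (\<lambda>z. inner (kj z) (G z tgt) * inner (kj z) q)
      = n * (E (\<lambda>z. (1 + lev z) * (inner (kj z) (G z tgt) * inner (kj z) q))
      - E (\<lambda>z. inner (G' z (kj z)) (T q) * inner (kj z) (G z tgt))
      - E (\<lambda>z. inner (kj z) (G z tgt) * inner (kj z) q))"
    by (simp add: algebra_simps)
  also have "E (\<lambda>z. (1 + lev z) * (inner (kj z) (G z tgt) * inner (kj z) q))
      - E (\<lambda>z. inner (G' z (kj z)) (T q) * inner (kj z) (G z tgt))
      - E (\<lambda>z. inner (kj z) (G z tgt) * inner (kj z) q)
     = E (\<lambda>z. (1 + lev z) * (inner (kj z) (G z tgt) * inner (kj z) q)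
       - inner (G' z (kj z)) (T q) * inner (kj z) (G z tgt) - inner (kj z) (G z tgt) * inner (kj z) q)"
  proof (subst Bochner_Integration.integral_diff)
    show "integrable P (\<lambda>z. (1 + lev z) * (inner (kj z) (G z tgt) * inner (kj z) q)
       - inner (G' z (kj z)) (T q) * inner (kj z) (G z tgt))"
      by (intro bm_int bms J_minus)
    show "integrable P (\<lambda>z. inner (kj z) (G z tgt) * inner (kj z) q)" by (intro bm_int bms)
    show "E (\<lambda>z. (1 + lev z) * (inner (kj z) (G z tgt) * inner (kj z) q))
      - E (\<lambda>z. inner (G' z (kj z)) (T q) * inner (kj z) (G z tgt))
      - E (\<lambda>z. inner (kj z) (G z tgt) * inner (kj z) q)
     = E (\<lambda>z. (1 + lev z) * (inner (kj z) (G z tgt) * inner (kj z) q)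
       - inner (G' z (kj z)) (T q) * inner (kj z) (G z tgt))
     - E (\<lambda>z. inner (kj z) (G z tgt) * inner (kj z) q)"
      by (subst Bochner_Integration.integral_diff) (intro bm_int bms J_minus refl)+
  qed
  also have "\<dots> = E (\<lambda>z. lev z * (inner (kj z) (G z tgt) * inner (kj z) q)
     - inner (G' z (kj z)) (T q) * inner (kj z) (G z tgt))"
    by (intro Bochner_Integration.integral_cong refl) (simp add: algebra_simps)
  finally show ?thesis .
qed

text \<open>The last summand averages to at most half of the energy, so it is absorbed by the left-hand
  side of the stability bound.\<close>

lemma energy_pointwise:
  "n * (lev z * (inner (kj z) (G z tgt) * inner (kj z) q) - inner (G' z (kj z)) (T q) * inner (kj z) (G z tgt))
   \<le> n * (\<kappa>\<^sup>2 + \<kappa>\<^sup>2 * \<kappa>\<^sup>2 / 2 + 1 / 4) * (norm q)\<^sup>2 * lev z + n / 2 * (inner (kj z) (\<Delta> z))\<^sup>2"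
proof -
  define a where "a = lev z"
  define x where "x = inner (kj z) (G z tgt)"
  define d where "d = inner (kj z) (\<Delta> z)"
  define y where "y = inner (G z (kj z)) q"
  define p where "p = inner (kj z) q"
  define N where "N = (norm q)\<^sup>2"
  have a: "0 \<le> a" "a \<le> \<kappa>\<^sup>2" by (simp_all add: a_def lev_nonneg lev_le)
  have xd: "x = p + d" by (simp add: x_def p_def d_def inner_diff_right)
  have p: "p\<^sup>2 \<le> \<kappa>\<^sup>2 * N" unfolding p_def N_def by (rule inner_kf_le)
  have N: "0 \<le> N" by (simp add: N_def)
  \<comment> \<open>Young's inequality after x = p + d. The square of d, the in-sample error at j,
    is kept with coefficient 1 / 2, a share that can be absorbed.\<close>
  have first: "a * (x * p) \<le> a * (\<kappa>\<^sup>2 + \<kappa>\<^sup>2 * \<kappa>\<^sup>2 / 2) * N + d\<^sup>2 / 2"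
  proof -
    have "a * (d * p) \<le> d\<^sup>2 / 2 + a * a * p\<^sup>2 / 2"
      using zero_le_power2[of "d - a * p"] by (simp add: power2_eq_square algebra_simps)
    moreover have "a * a * p\<^sup>2 \<le> a * \<kappa>\<^sup>2 * (\<kappa>\<^sup>2 * N)"
      using a p by (intro mult_mono) auto
    moreover have "a * p\<^sup>2 \<le> a * (\<kappa>\<^sup>2 * N)" using a p by (intro mult_left_mono) auto
    ultimately show ?thesis by (simp add: xd power2_eq_square algebra_simps)
  qed
  \<comment> \<open>Writing \<open>n *\<^sub>R T q\<close> as \<open>tgt - t *\<^sub>R q\<close>
    trades the population operator for x and y, and the factor n disappears with it.\<close>
  have second: "n * inner (G' z (kj z)) (T q) = (1 + a) * (x - t * y)"
  proof -
    have "n *\<^sub>R T q = tgt - t *\<^sub>R q" by simp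
    then have "n * inner (G' z (kj z)) (T q) = inner (G' z (kj z)) (tgt - t *\<^sub>R q)"
      by (metis inner_scaleR_right)
    also have "\<dots> = (1 + a) * (inner (G z (kj z)) tgt - t * y)"
      by (subst G'_self) (simp add: a_def y_def inner_diff_right algebra_simps)
    also have "inner (G z (kj z)) tgt = x"
      by (simp add: x_def res_symmetric[OF t_pos])
    finally show ?thesis .
  qed
  \<comment> \<open>Completing the square removes x, for which no small bound is available. The
    remaining t y^2 is paid for by \<open>res_energy_norm\<close>, and \<open>t \<le> n\<close>
    restores the scale n.\<close>
  have third: "- ((1 + a) * (x - t * y) * x) \<le> n / 4 * N * a"
  proof -
    have "- ((x - t * y) * x) \<le> t\<^sup>2 * y\<^sup>2 / 4"
      using zero_le_power2[of "x - t * y / 2"] by (simp add: power2_eq_square algebra_simps)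
    then have "(1 + a) * - ((x - t * y) * x) \<le> (1 + a) * (t\<^sup>2 * y\<^sup>2 / 4)"
      using a by (intro mult_left_mono) auto
    also have "(1 + a) * (t\<^sup>2 * y\<^sup>2 / 4) \<le> t * N * a / 4"
    proof -
      have "y\<^sup>2 \<le> (norm (G z (kj z)))\<^sup>2 * N"
        using power_mono[OF Cauchy_Schwarz_ineq2[of "G z (kj z)" q], of 2]
        by (simp add: y_def N_def power_mult_distrib)
      then have "t * y\<^sup>2 \<le> (t * (norm (G z (kj z)))\<^sup>2) * N"
        using t_nonneg by (simp add: mult_left_mono mult.assoc)
      also have "\<dots> \<le> inner (kj z) (G z (kj z)) * N"
        using N by (intro mult_right_mono res_energy_norm[OF t_pos])
      finally have "(1 + a) * (t * y\<^sup>2) \<le> (1 + a) * (inner (kj z) (G z (kj z)) * N)"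
        using a by (intro mult_left_mono) auto
      also have "\<dots> = a * N" using inner_G'[of z "kj z"] by (simp add: a_def)
      finally have "t * ((1 + a) * (t * y\<^sup>2)) \<le> t * (a * N)"
        using t_nonneg by (intro mult_left_mono) auto
      then show ?thesis by (simp add: power2_eq_square algebra_simps)
    qed
    also have "\<dots> \<le> n * N * a / 4" using t a N by (intro divide_right_mono mult_right_mono) auto
    finally show ?thesis by (simp add: algebra_simps)
  qed
  have "n * (a * (x * p) - inner (G' z (kj z)) (T q) * x)
      = n * (a * (x * p)) - (n * inner (G' z (kj z)) (T q)) * x" by (simp add: algebra_simps)
  also have "\<dots> \<le> n * (a * (\<kappa>\<^sup>2 + \<kappa>\<^sup>2 * \<kappa>\<^sup>2 / 2) * N + d\<^sup>2 / 2) + n / 4 * N * a"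
    unfolding second using mult_left_mono[OF first n_nonneg] third by simp
  also have "\<dots> = n * (\<kappa>\<^sup>2 + \<kappa>\<^sup>2 * \<kappa>\<^sup>2 / 2 + 1 / 4) * N * a + n / 2 * d\<^sup>2"
    by (simp add: algebra_simps)
  finally show ?thesis unfolding a_def x_def p_def d_def N_def .
qed

lemma E_energy_le: "E (energy q) \<le> C1 * D * (norm q)\<^sup>2"
proof -
  let ?c = "\<kappa>\<^sup>2 + \<kappa>\<^sup>2 * \<kappa>\<^sup>2 / 2 + 1 / 4"
  have "E (energy q) = E (\<lambda>z. n * (lev z * (inner (kj z) (G z tgt) * inner (kj z) q)
     - inner (G' z (kj z)) (T q) * inner (kj z) (G z tgt)))"
    by (simp add: E_energy_eq)
  also have "\<dots> \<le> E (\<lambda>z. n * ?c * (norm q)\<^sup>2 * lev z + n / 2 * (inner (kj z) (\<Delta> z))\<^sup>2)"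
    by (intro integral_mono energy_pointwise) (intro bm_int bms J_minus)+
  also have "\<dots> = n * ?c * (norm q)\<^sup>2 * E lev + (n * E (\<lambda>z. (inner (kj z) (\<Delta> z))\<^sup>2)) / 2"
    by (subst Bochner_Integration.integral_add) ((intro bm_int bms J_minus)+, simp)
  also have "\<dots> \<le> n * ?c * (norm q)\<^sup>2 * ((1 + \<kappa>\<^sup>2) * D / n) + E (energy q) / 2"
    using n_nonneg by (intro add_mono mult_left_mono divide_right_mono E_lev E_energy_point) auto
  also have "n * ?c * (norm q)\<^sup>2 * ((1 + \<kappa>\<^sup>2) * D / n) = C1 * D * (norm q)\<^sup>2 / 2"
    using n_pos by simp
  finally have *: "E (energy q) \<le> C1 * D * (norm q)\<^sup>2 / 2 + E (energy q) / 2" .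
  have "x \<le> y" if "x \<le> y / 2 + x / 2" for x y :: real using that by simp
  from this[OF *] show ?thesis .
qed

text \<open>Converse of \<open>E_res_ge\<close> up to an error: the nonnegative form discarded there
  is exactly the energy, so keeping it gives an identity, and the stability bound controls its
  mean.\<close>

lemma E_res_le: "E (\<lambda>z. inner tgt (G z tgt)) \<le> inner tgt q + C1 * D * (norm q)\<^sup>2"
proof -
  have eq: "inner tgt (G z tgt) = energy q z + 2 * inner tgt q - inner q (A z q)" for z
  proof -
    have "energy q z = inner (\<Delta> z) (A z (G z tgt)) - inner (\<Delta> z) (A z q)"
      by (simp add: energy_def Let_def linear_diff[OF bounded_linear.linear[OF bounded_linear_reg]] inner_diff_right)
    also have "inner (\<Delta> z) (A z q) = inner (A z (\<Delta> z)) q" by (rule reg_symmetric)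
    also have "A z (\<Delta> z) = tgt - A z q"
      by (simp add: linear_diff[OF bounded_linear.linear[OF bounded_linear_reg]] reg_res[OF t_pos])
    finally show ?thesis by (simp add: reg_res[OF t_pos] inner_diff_left inner_diff_right inner_commute algebra_simps)
  qed
  have "E (\<lambda>z. inner tgt (G z tgt)) = E (\<lambda>z. energy q z + 2 * inner tgt q) - E (\<lambda>z. inner q (A z q))"
    unfolding eq by (rule Bochner_Integration.integral_diff)
      (auto simp: inner_reg intro!: bm_int bms energy_bm)
  also have "E (\<lambda>z. energy q z + 2 * inner tgt q) = E (energy q) + 2 * inner tgt q"
    by (subst Bochner_Integration.integral_add) (auto simp: P.prob_space intro!: bm_int energy_bm)
  finally show ?thesis using E_energy_le by (simp add: E_reg inner_commute)
qed

end

end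

text \<open>\<open>c\<close> repeats \<open>C1\<close> outside the locale. The prefactor is that of
  \<open>bias_out_of_sample_le\<close>; in the sum, 2 + 4 c comes from \<open>E_bias_point\<close>,
  and the last two terms from the means of the leverage and of the squared error at the test
  point.\<close>

definition bias_const :: "real \<Rightarrow> real" where
  "bias_const \<kappa> = (let c = 2 * (\<kappa>\<^sup>2 + \<kappa>\<^sup>2 * \<kappa>\<^sup>2 / 2 + 1 / 4) * (1 + \<kappa>\<^sup>2) in
     2 * (1 + \<kappa>\<^sup>2)\<^sup>2 * (2 + 4 * c + 2 * (\<kappa>\<^sup>2 * \<kappa>\<^sup>2) * (1 + \<kappa>\<^sup>2) + 2 * (\<kappa>\<^sup>2 * \<kappa>\<^sup>2) * c))"

lemma bias_const_nonneg: "0 \<le> bias_const \<kappa>"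
  by (auto simp: bias_const_def Let_def intro!: mult_nonneg_nonneg add_nonneg_nonneg)

lemma sum_power2_le: "(a + b)\<^sup>2 \<le> 2 * a\<^sup>2 + 2 * (b::real)\<^sup>2"
  using zero_le_power2[of "a - b"] by (simp add: power2_eq_square algebra_simps)

lemma (in random_design) inner_pop_res_nonneg:
  assumes "0 < t" "0 \<le> n"
  shows "0 \<le> inner f (pop_res S kf t n f)"
proof -
  let ?q = "pop_res S kf t n f"
  have "inner f ?q = t * inner ?q ?q + n * inner ?q (T ?q)"
    using arg_cong[where f = "inner ?q", OF pop_res_right[OF assms, of f]]
    by (simp add: inner_add_right inner_commute[of f])
  then show ?thesis using assms T_nonneg by simp
qed

section \<open>Bias and noise weights at the test point\<close>

context leave_one_out
begin

lemma tgt_R: "tgt (R f) = f"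
  by (rule pop_res_right[OF t_pos n_nonneg])

text \<open>Only the inner resolvent is replaced by its population version. The outer one stays
  empirical, because it is what bounds the sum over the sample; the error
  \<open>\<Delta> (R g) z\<close> passes through it and leaves its energy divided by
  \<open>t\<^sup>2\<close>.\<close>

lemma bias_sample_le:
  "(\<Sum>i\<in>J. (inner (kf (z i)) (G z (G z g)))\<^sup>2) \<le> 2 * inner (R g) (G z (R g)) + 2 * (energy (R g) z / t\<^sup>2)"
proof -
  let ?d = "\<Delta> (R g) z"
  have "G z g = R g + ?d" by (simp add: tgt_R)
  then have split: "G z (G z g) = G z (R g) + G z ?d" by (metis res_add[OF t_pos])
  have "(\<Sum>i\<in>J. (inner (kf (z i)) (G z ?d))\<^sup>2) \<le> inner ?d (G z ?d)"
    by (rule res_energy_sample[OF t_pos])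
  also have "\<dots> \<le> (norm ?d)\<^sup>2 / t" by (rule res_inner_le[OF t_pos])
  also have "\<dots> = t * (norm ?d)\<^sup>2 / t\<^sup>2" using t_pos by (simp add: power2_eq_square)
  also have "\<dots> \<le> energy (R g) z / t\<^sup>2" by (intro divide_right_mono energy_norm_le) simp
  finally have d: "(\<Sum>i\<in>J. (inner (kf (z i)) (G z ?d))\<^sup>2) \<le> energy (R g) z / t\<^sup>2" .
  have "(\<Sum>i\<in>J. (inner (kf (z i)) (G z (G z g)))\<^sup>2)
      \<le> (\<Sum>i\<in>J. 2 * (inner (kf (z i)) (G z (R g)))\<^sup>2 + 2 * (inner (kf (z i)) (G z ?d))\<^sup>2)"
    unfolding split inner_add_right by (intro sum_mono sum_power2_le)
  also have "\<dots> = 2 * (\<Sum>i\<in>J. (inner (kf (z i)) (G z (R g)))\<^sup>2) + 2 * (\<Sum>i\<in>J. (inner (kf (z i)) (G z ?d))\<^sup>2)"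
    by (simp add: sum.distrib sum_distrib_left)
  also have "\<dots> \<le> 2 * inner (R g) (G z (R g)) + 2 * (energy (R g) z / t\<^sup>2)"
    using d by (intro add_mono mult_left_mono res_energy_sample[OF t_pos]) auto
  finally show ?thesis .
qed

text \<open>The outer resolvent is compared with the population through \<open>E_res_le\<close> at
  \<open>R (R g)\<close>, whose target is \<open>R g\<close>. As R divides norms by at least t, this
  error has the same size as that of the inner replacement.\<close>

lemma E_bias_point:
  "n * E (\<lambda>z. (inner (kj z) (G z (G z g)))\<^sup>2)
   \<le> 2 * inner (R g) (R (R g)) + 4 * C1 * D * (norm (R g))\<^sup>2 / t\<^sup>2"
proof -
  have "n * E (\<lambda>z. (inner (kj z) (G z (G z g)))\<^sup>2) = E (\<lambda>z. \<Sum>i\<in>J. (inner (kf (z i)) (G z (G z g)))\<^sup>2)"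
    by (rule exchange[symmetric, of "\<lambda>y G. (inner (kf y) (G (G g)))\<^sup>2"]) (intro bm_int bms)
  also have "\<dots> \<le> E (\<lambda>z. 2 * inner (R g) (G z (R g)) + 2 / t\<^sup>2 * energy (R g) z)"
    using bias_sample_le by (intro integral_mono) (auto intro!: bm_int bms energy_bm)
  also have "\<dots> = 2 * E (\<lambda>z. inner (R g) (G z (R g))) + 2 / t\<^sup>2 * E (energy (R g))"
    by (subst Bochner_Integration.integral_add) ((intro bm_int bms energy_bm)+, simp)
  also have "\<dots> \<le> 2 * (inner (R g) (R (R g)) + C1 * D * ((norm (R g))\<^sup>2 / t\<^sup>2)) + 2 / t\<^sup>2 * (C1 * D * (norm (R g))\<^sup>2)"
  proof (intro add_mono mult_left_mono E_energy_le)
    have "(norm (R (R g)))\<^sup>2 \<le> (norm (R g))\<^sup>2 / t\<^sup>2"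
      using power_mono[OF norm_pop_res_le[OF t_pos n_nonneg, of "R g"], of 2]
      by (simp add: power_divide)
    then have "C1 * D * (norm (R (R g)))\<^sup>2 \<le> C1 * D * ((norm (R g))\<^sup>2 / t\<^sup>2)"
      by (intro mult_left_mono mult_nonneg_nonneg C1_nonneg D_nonneg)
    with E_res_le[of "R (R g)"] show "E (\<lambda>z. inner (R g) (G z (R g)))
        \<le> inner (R g) (R (R g)) + C1 * D * ((norm (R g))\<^sup>2 / t\<^sup>2)"
      unfolding tgt_R by linarith
  qed auto
  also have "\<dots> = 2 * inner (R g) (R (R g)) + 4 * C1 * D * (norm (R g))\<^sup>2 / t\<^sup>2"
  proof -
    have "2 * (i + c * D * (N / s)) + 2 / s * (c * D * N) = 2 * i + 4 * c * D * N / s" for i c N s :: real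
      by (simp add: divide_inverse algebra_simps)
    then show ?thesis .
  qed
  finally show ?thesis .
qed

text \<open>The bias is of second order in the resolvent, so removing the test point also produces first
  order residuals; they do not spoil the rate because they carry the factor \<open>lev z\<close>, or are
  controlled by the energy.\<close>

lemma bias_out_of_sample_le:
  "(inner (kj z) (G' z (G' z g)))\<^sup>2 \<le> 2 * (1 + \<kappa>\<^sup>2)\<^sup>2 * ((inner (kj z) (G z (G z g)))\<^sup>2
     + (2 * (\<kappa>\<^sup>2 * \<kappa>\<^sup>2) * (norm (R g))\<^sup>2 * lev z + 2 * (\<kappa>\<^sup>2 * \<kappa>\<^sup>2) * (inner (kj z) (\<Delta> (R g) z))\<^sup>2) / t\<^sup>2)"
proof -
  define a where "a = lev z"
  define u where "u = inner (kj z) (G z g)"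
  define v where "v = inner (kj z) (G z (G z g))"
  define w where "w = (norm (G z (kj z)))\<^sup>2"
  have a: "0 \<le> a" "a \<le> \<kappa>\<^sup>2" by (simp_all add: a_def lev_nonneg lev_le)
  have "inner (kj z) (G' z (G' z g)) = (1 + a) * inner (kj z) (G z (G' z g))"
    unfolding a_def by (rule inner_G')
  also have "inner (kj z) (G z (G' z g)) = v + u * inner (G z (kj z)) (G' z (kj z))"
    by (subst G'_eq) (simp add: res_add[OF t_pos] res_scaleR[OF t_pos] inner_add_right v_def u_def
        res_symmetric[OF t_pos, of "kj z" _ J "G' z (kj z)"])
  also have "inner (G z (kj z)) (G' z (kj z)) = (1 + a) * w"
    by (subst G'_self) (simp add: a_def w_def power2_norm_eq_inner)
  finally have b: "inner (kj z) (G' z (G' z g)) = (1 + a) * (v + u * ((1 + a) * w))" .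
  \<comment> \<open>The rank-one correction is at most a / t, because 1 + a times the in-sample
    leverage is a.\<close>
  have "t * w \<le> inner (kj z) (G z (kj z))" unfolding w_def by (rule res_energy_norm[OF t_pos])
  then have "(1 + a) * (t * w) \<le> (1 + a) * inner (kj z) (G z (kj z))"
    using a by (intro mult_left_mono) auto
  also have "\<dots> = a" using inner_G'[of z "kj z"] by (simp add: a_def)
  finally have w: "(1 + a) * w \<le> a / t" using t_pos by (simp add: field_simps)
  have "0 \<le> w" by (simp add: w_def)
  then have w2: "((1 + a) * w)\<^sup>2 \<le> (a / t)\<^sup>2" using a w by (intro power_mono) auto
  have "u = inner (kj z) (R g) + inner (kj z) (\<Delta> (R g) z)"
    by (simp add: u_def tgt_R inner_diff_right)
  then have "u\<^sup>2 \<le> 2 * (inner (kj z) (R g))\<^sup>2 + 2 * (inner (kj z) (\<Delta> (R g) z))\<^sup>2"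
    using sum_power2_le by simp
  then have "u\<^sup>2 \<le> 2 * (\<kappa>\<^sup>2 * (norm (R g))\<^sup>2) + 2 * (inner (kj z) (\<Delta> (R g) z))\<^sup>2"
    using inner_kf_le[of "z j" "R g"] by simp
  then have "a\<^sup>2 * u\<^sup>2 \<le> a\<^sup>2 * (2 * (\<kappa>\<^sup>2 * (norm (R g))\<^sup>2) + 2 * (inner (kj z) (\<Delta> (R g) z))\<^sup>2)"
    by (intro mult_left_mono) auto
  also have "\<dots> = a * a * (2 * (\<kappa>\<^sup>2 * (norm (R g))\<^sup>2)) + a * a * (2 * (inner (kj z) (\<Delta> (R g) z))\<^sup>2)"
    by (simp add: power2_eq_square algebra_simps)
  \<comment> \<open>One factor a stays with the deterministic term, whose smallness is
    \<open>E_lev\<close>. The error term has a small mean already, so both of its factors a may be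
    bounded by \<open>\<kappa>\<^sup>2\<close>.\<close>
  also have "\<dots> \<le> \<kappa>\<^sup>2 * a * (2 * (\<kappa>\<^sup>2 * (norm (R g))\<^sup>2)) + \<kappa>\<^sup>2 * \<kappa>\<^sup>2 * (2 * (inner (kj z) (\<Delta> (R g) z))\<^sup>2)"
    using a by (intro add_mono mult_right_mono mult_mono) auto
  finally have au: "a\<^sup>2 * u\<^sup>2 \<le> 2 * (\<kappa>\<^sup>2 * \<kappa>\<^sup>2) * (norm (R g))\<^sup>2 * a + 2 * (\<kappa>\<^sup>2 * \<kappa>\<^sup>2) * (inner (kj z) (\<Delta> (R g) z))\<^sup>2"
    by (simp add: algebra_simps)
  have "(u * ((1 + a) * w))\<^sup>2 \<le> u\<^sup>2 * (a / t)\<^sup>2"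
    using w2 by (simp add: power_mult_distrib[of u] mult_left_mono)
  also have "\<dots> = a\<^sup>2 * u\<^sup>2 / t\<^sup>2" by (simp add: power_divide)
  also have "\<dots> \<le> (2 * (\<kappa>\<^sup>2 * \<kappa>\<^sup>2) * (norm (R g))\<^sup>2 * a + 2 * (\<kappa>\<^sup>2 * \<kappa>\<^sup>2) * (inner (kj z) (\<Delta> (R g) z))\<^sup>2) / t\<^sup>2"
    by (rule divide_right_mono[OF au]) simp
  finally have uw: "(u * ((1 + a) * w))\<^sup>2 \<le> \<dots>" .
  have "(inner (kj z) (G' z (G' z g)))\<^sup>2 = (1 + a)\<^sup>2 * (v + u * ((1 + a) * w))\<^sup>2"
    unfolding b by (rule power_mult_distrib)
  also have "\<dots> \<le> (1 + \<kappa>\<^sup>2)\<^sup>2 * (2 * v\<^sup>2 + 2 * (u * ((1 + a) * w))\<^sup>2)"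
    using a by (intro mult_mono power_mono sum_power2_le) auto
  also have "\<dots> \<le> (1 + \<kappa>\<^sup>2)\<^sup>2 * (2 * v\<^sup>2 + 2 * ((2 * (\<kappa>\<^sup>2 * \<kappa>\<^sup>2) * (norm (R g))\<^sup>2 * a + 2 * (\<kappa>\<^sup>2 * \<kappa>\<^sup>2) * (inner (kj z) (\<Delta> (R g) z))\<^sup>2) / t\<^sup>2))"
    using uw by (intro mult_left_mono add_left_mono) auto
  also have "\<dots> = 2 * (1 + \<kappa>\<^sup>2)\<^sup>2 * (v\<^sup>2 + (2 * (\<kappa>\<^sup>2 * \<kappa>\<^sup>2) * (norm (R g))\<^sup>2 * a + 2 * (\<kappa>\<^sup>2 * \<kappa>\<^sup>2) * (inner (kj z) (\<Delta> (R g) z))\<^sup>2) / t\<^sup>2)"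
    by (simp only: distrib_left mult.assoc mult.left_commute)
  finally show ?thesis unfolding a_def v_def .
qed

lemma bias_bm: "bounded_measurable P (\<lambda>z. inner (kj z) (t\<^sup>2 *\<^sub>R G' z (G' z g)))"
  by (intro bms J_minus)

text \<open>The mean of \<open>bias_out_of_sample_le\<close>: each of its three terms is 1 / n times
  a quantity already bounded, by exchangeability or by \<open>E_lev\<close>.\<close>

lemma E_bias_le:
  "E (\<lambda>z. (inner (kj z) (t\<^sup>2 *\<^sub>R G' z (G' z g)))\<^sup>2)
   \<le> bias_const \<kappa> / n * (t ^ 4 * inner (R g) (R (R g)) + t\<^sup>2 * D * (norm (R g))\<^sup>2)"
proof -
  let ?k = "\<kappa>\<^sup>2 * \<kappa>\<^sup>2" and ?N = "(norm (R g))\<^sup>2" and ?i = "inner (R g) (R (R g))"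
  let ?c = "2 * (1 + \<kappa>\<^sup>2)\<^sup>2"
  define v where "v = E (\<lambda>z. (inner (kj z) (G z (G z g)))\<^sup>2)"
  define d where "d = E (\<lambda>z. (inner (kj z) (\<Delta> (R g) z))\<^sup>2)"
  have "n * d \<le> C1 * D * ?N"
    unfolding d_def using E_energy_point[of "R g"] E_energy_le[of "R g"] by linarith
  then have d: "d \<le> C1 * D * ?N / n" using n_pos by (simp add: field_simps)
  have v: "v \<le> (2 * ?i + 4 * C1 * D * ?N / t\<^sup>2) / n"
    using E_bias_point[of g] n_pos by (simp add: v_def field_simps)
  have i: "0 \<le> ?i" by (rule inner_pop_res_nonneg[OF t_pos n_nonneg])
  have "E (\<lambda>z. (inner (kj z) (G' z (G' z g)))\<^sup>2)
    \<le> E (\<lambda>z. ?c * ((inner (kj z) (G z (G z g)))\<^sup>2 + 1 / t\<^sup>2 * (2 * ?k * ?N * lev z + 2 * ?k * (inner (kj z) (\<Delta> (R g) z))\<^sup>2)))"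
    using bias_out_of_sample_le by (intro integral_mono bm_int) (auto intro!: bms J_minus)
  also have "\<dots> = ?c * E (\<lambda>z. (inner (kj z) (G z (G z g)))\<^sup>2 + 1 / t\<^sup>2 * (2 * ?k * ?N * lev z + 2 * ?k * (inner (kj z) (\<Delta> (R g) z))\<^sup>2))"
    by (rule integral_mult_right_zero)
  also have "E (\<lambda>z. (inner (kj z) (G z (G z g)))\<^sup>2 + 1 / t\<^sup>2 * (2 * ?k * ?N * lev z + 2 * ?k * (inner (kj z) (\<Delta> (R g) z))\<^sup>2))
     = v + E (\<lambda>z. 1 / t\<^sup>2 * (2 * ?k * ?N * lev z + 2 * ?k * (inner (kj z) (\<Delta> (R g) z))\<^sup>2))"
    unfolding v_def by (intro Bochner_Integration.integral_add bm_int bms J_minus)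
  also have "E (\<lambda>z. 1 / t\<^sup>2 * (2 * ?k * ?N * lev z + 2 * ?k * (inner (kj z) (\<Delta> (R g) z))\<^sup>2))
     = 1 / t\<^sup>2 * E (\<lambda>z. 2 * ?k * ?N * lev z + 2 * ?k * (inner (kj z) (\<Delta> (R g) z))\<^sup>2)"
    by (rule integral_mult_right_zero)
  also have "E (\<lambda>z. 2 * ?k * ?N * lev z + 2 * ?k * (inner (kj z) (\<Delta> (R g) z))\<^sup>2)
     = E (\<lambda>z. 2 * ?k * ?N * lev z) + E (\<lambda>z. 2 * ?k * (inner (kj z) (\<Delta> (R g) z))\<^sup>2)"
    by (intro Bochner_Integration.integral_add bm_int bms J_minus)
  also have "E (\<lambda>z. 2 * ?k * ?N * lev z) = 2 * ?k * ?N * E lev"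
    by (rule integral_mult_right_zero)
  also have "E (\<lambda>z. 2 * ?k * (inner (kj z) (\<Delta> (R g) z))\<^sup>2) = 2 * ?k * d"
    unfolding d_def by (rule integral_mult_right_zero)
  also have "?c * (v + 1 / t\<^sup>2 * (2 * ?k * ?N * E lev + 2 * ?k * d))
     \<le> ?c * ((2 * ?i + 4 * C1 * D * ?N / t\<^sup>2) / n
        + 1 / t\<^sup>2 * (2 * ?k * ?N * ((1 + \<kappa>\<^sup>2) * D / n) + 2 * ?k * (C1 * D * ?N / n)))"
    by (intro mult_left_mono add_mono v d E_lev) auto
  also have "\<dots> = ?c / n * (2 * ?i + (4 * C1 + 2 * ?k * (1 + \<kappa>\<^sup>2) + 2 * ?k * C1) * (D * ?N / t\<^sup>2))"
    by (simp add: divide_simps) (simp add: algebra_simps)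
  also have "\<dots> \<le> ?c / n * ((2 + 4 * C1 + 2 * ?k * (1 + \<kappa>\<^sup>2) + 2 * ?k * C1) * (?i + D * ?N / t\<^sup>2))"
  proof -
    have "0 \<le> D * ?N / t\<^sup>2" using D_nonneg by simp
    moreover have "0 \<le> 4 * C1 + 2 * ?k * (1 + \<kappa>\<^sup>2) + 2 * ?k * C1"
      by (intro add_nonneg_nonneg mult_nonneg_nonneg C1_nonneg) auto
    moreover have "2 * i + c * x \<le> (2 + c) * (i + x)" if "0 \<le> i" "0 \<le> x" "0 \<le> c" for c i x :: real
      using that by (simp add: algebra_simps)
    ultimately have "2 * ?i + (4 * C1 + 2 * ?k * (1 + \<kappa>\<^sup>2) + 2 * ?k * C1) * (D * ?N / t\<^sup>2)
      \<le> (2 + (4 * C1 + 2 * ?k * (1 + \<kappa>\<^sup>2) + 2 * ?k * C1)) * (?i + D * ?N / t\<^sup>2)"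
      using i by blast
    then show ?thesis using n_nonneg by (intro mult_left_mono) (simp_all only: add.assoc, simp)
  qed
  also have "\<dots> = bias_const \<kappa> / n * (?i + D * ?N / t\<^sup>2)"
    by (simp add: bias_const_def Let_def)
  finally have *: "E (\<lambda>z. (inner (kj z) (G' z (G' z g)))\<^sup>2) \<le> bias_const \<kappa> / n * (?i + D * ?N / t\<^sup>2)" .
  have "E (\<lambda>z. (inner (kj z) (t\<^sup>2 *\<^sub>R G' z (G' z g)))\<^sup>2) = t ^ 4 * E (\<lambda>z. (inner (kj z) (G' z (G' z g)))\<^sup>2)"
    by (simp add: power_mult_distrib flip: power_mult)
  also have "\<dots> \<le> t ^ 4 * (bias_const \<kappa> / n * (?i + D * ?N / t\<^sup>2))"
    by (intro mult_left_mono *) simp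
  also have "\<dots> = bias_const \<kappa> / n * (t ^ 4 * ?i + t\<^sup>2 * D * ?N)"
  proof -
    have "t ^ 4 * (D * ?N / t\<^sup>2) = t\<^sup>2 * D * ?N" using t_pos by (simp add: power4_eq_xxxx power2_eq_square)
    then have "t ^ 4 * (?i + D * ?N / t\<^sup>2) = t ^ 4 * ?i + t\<^sup>2 * D * ?N" by (simp only: distrib_left)
    then show ?thesis by (metis mult.left_commute)
  qed
  finally show ?thesis .
qed

text \<open>At \<open>f = kf (z i)\<close> this is the coefficient with which the noise at the
  training point i enters the prediction at the test point.\<close>

definition weight :: "(nat \<Rightarrow> 'b) \<Rightarrow> 'h \<Rightarrow> real" where
  "weight z f = inner (kj z) (G' z f + t *\<^sub>R G' z (G' z f))"

lemma weight_bm: "bounded_measurable P f \<Longrightarrow> bounded_measurable P (\<lambda>z. weight z (f z))"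
  unfolding weight_def by (intro bms J_minus)

text \<open>By symmetry the resolvents can be moved to \<open>kj z\<close>. The sum over the
  training points is then an energy of \<open>kj z\<close>, at most a multiple of its
  leverage.\<close>

lemma E_weight_le: "E (\<lambda>z. \<Sum>i\<in>J - {j}. (weight z (kf (z i)))\<^sup>2) \<le> 4 * (1 + \<kappa>\<^sup>2) * D / n"
proof -
  have "(\<Sum>i\<in>J - {j}. (weight z (kf (z i)))\<^sup>2) \<le> 4 * lev z" for z
  proof -
    let ?x = "\<lambda>i. inner (kf (z i)) (G' z (kj z))" and ?y = "\<lambda>i. inner (kf (z i)) (G' z (G' z (kj z)))"
    have "weight z (kf (z i)) = ?x i + t * ?y i" for i
      by (simp add: weight_def inner_add_right res_symmetric[OF t_pos, of "kj z"]
          res_symmetric[OF t_pos, of "G' z (kj z)"] inner_commute[of "kf (z i)"])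
    then have "(weight z (kf (z i)))\<^sup>2 \<le> 2 * (?x i)\<^sup>2 + 2 * (t\<^sup>2 * (?y i)\<^sup>2)" for i
      using sum_power2_le[of "?x i" "t * ?y i"] by (simp add: power_mult_distrib)
    then have "(\<Sum>i\<in>J - {j}. (weight z (kf (z i)))\<^sup>2) \<le> (\<Sum>i\<in>J - {j}. 2 * (?x i)\<^sup>2 + 2 * (t\<^sup>2 * (?y i)\<^sup>2))"
      by (intro sum_mono)
    also have "\<dots> = 2 * (\<Sum>i\<in>J - {j}. (?x i)\<^sup>2) + 2 * (t\<^sup>2 * (\<Sum>i\<in>J - {j}. (?y i)\<^sup>2))"
      by (simp add: sum.distrib sum_distrib_left)
    also have "\<dots> \<le> 2 * lev z + 2 * (t\<^sup>2 * (lev z / t\<^sup>2))"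
      by (intro add_mono mult_left_mono res_energy_sample[OF t_pos] sample_res_res_le[OF t_pos]) auto
    also have "\<dots> = 4 * lev z" using t_pos by simp
    finally show ?thesis .
  qed
  then have "E (\<lambda>z. \<Sum>i\<in>J - {j}. (weight z (kf (z i)))\<^sup>2) \<le> E (\<lambda>z. 4 * lev z)"
    using J_sub by (intro integral_mono bm_int bounded_measurable_mult bounded_measurable_const lev_bm)
      (auto intro!: bm_intros weight_bm kf_coordinate_bm)
  also have "\<dots> = 4 * E lev" by simp
  also have "\<dots> \<le> 4 * ((1 + \<kappa>\<^sup>2) * D / n)" by (intro mult_left_mono E_lev) simp
  finally show ?thesis by (simp only: mult.assoc times_divide_eq_right)
qed

end

text \<open>The same weight with the training block as a parameter, since averaging uses many blocks
  for one test point.\<close>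

definition weight_vec :: "(nat \<Rightarrow> 'h::{real_inner,banach}) \<Rightarrow> real \<Rightarrow> nat set \<Rightarrow> nat \<Rightarrow> nat \<Rightarrow> real" where
  "weight_vec k t B j i = inner (k j) (res k t B (k i) + t *\<^sub>R res k t B (res k t B (k i)))"

section \<open>Noise and averaging over blocks\<close>

text \<open>The last two conditions express \<open>E(e | kf) = 0\<close> and \<open>E(e\<^sup>2 | kf) \<le> \<sigma>\<^sup>2\<close> by test functions of
  \<open>kf\<close>, which need only be bounded on the range of \<open>kf\<close>.\<close>

locale noisy_design = product_design S kf \<kappa> I
  for S :: "'b measure" and kf :: "'b \<Rightarrow> 'h::{real_inner,banach,second_countable_topology}" and \<kappa> :: real
    and I :: "nat set" +
  fixes e :: "'b \<Rightarrow> real" and \<sigma> :: real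
  assumes e_measurable [measurable]: "e \<in> borel_measurable S"
    and e_square: "integrable S (\<lambda>y. (e y)\<^sup>2)"
    and e_mean: "\<And>\<psi>. \<psi> \<in> borel_measurable borel \<Longrightarrow> bounded_measurable S (\<lambda>y. \<psi> (kf y)) \<Longrightarrow>
      (LINT y|S. e y * \<psi> (kf y)) = 0"
    and e_variance: "\<And>\<psi>. \<psi> \<in> borel_measurable borel \<Longrightarrow> bounded_measurable S (\<lambda>y. \<psi> (kf y)) \<Longrightarrow>
      (\<And>x. 0 \<le> \<psi> x) \<Longrightarrow> (LINT y|S. (e y)\<^sup>2 * \<psi> (kf y)) \<le> \<sigma>\<^sup>2 * (LINT y|S. \<psi> (kf y))"
begin

lemma integrable_e_coordinate: "i \<in> I \<Longrightarrow> integrable P (\<lambda>z. (e (z i))\<^sup>2)"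
proof -
  assume i: "i \<in> I"
  have "distr P S (\<lambda>z. z i) = S"
    using distr_PiM_component[of I "\<lambda>_. S" i] prob_space_axioms i by simp
  then have "integrable (distr P S (\<lambda>z. z i)) (\<lambda>y. (e y)\<^sup>2)" using e_square by simp
  then show ?thesis by (rule integrable_distr[rotated]) (use i in measurable)
qed

lemma integrable_e_product:
  assumes "i \<in> I" "l \<in> I"
  shows "integrable P (\<lambda>z. e (z i) * e (z l))"
proof (rule Bochner_Integration.integrable_bound)
  show "integrable P (\<lambda>z. (e (z i))\<^sup>2 + (e (z l))\<^sup>2)"
    using assms integrable_e_coordinate by simp
  have "\<bar>a * b\<bar> \<le> a\<^sup>2 + b\<^sup>2" for a b :: real
  proof -
    have "2 * (\<bar>a\<bar> * \<bar>b\<bar>) \<le> a\<^sup>2 + b\<^sup>2"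
      using zero_le_power2[of "\<bar>a\<bar> - \<bar>b\<bar>"] by (simp add: power2_eq_square algebra_simps)
    moreover have "0 \<le> \<bar>a\<bar> * \<bar>b\<bar>" by simp
    ultimately show ?thesis by (simp only: abs_mult)
  qed
  then show "AE z in P. norm (e (z i) * e (z l)) \<le> norm ((e (z i))\<^sup>2 + (e (z l))\<^sup>2)" by simp
qed (use assms in measurable)

text \<open>Cross terms vanish on integrating over the point l: with the others frozen, both weights
  depend on it only through \<open>kf\<close>, as \<open>dep\<close> demands, so the centring of the
  noise given \<open>kf\<close> applies. The diagonal terms use the variance bound in the same
  way.\<close>

lemma noise_sum:
  fixes W :: "nat \<Rightarrow> (nat \<Rightarrow> 'b) \<Rightarrow> real"
  assumes L: "L \<subseteq> I" and W: "\<And>i. i \<in> L \<Longrightarrow> bounded_measurable P (W i)"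
    and dep: "\<And>i l z. i \<in> L \<Longrightarrow> l \<in> L \<Longrightarrow> \<exists>\<psi>. \<psi> \<in> borel_measurable borel \<and>
      bounded_measurable S (\<lambda>y. \<psi> (kf y)) \<and> (\<forall>y. W i (z(l := y)) = \<psi> (kf y))"
  shows "integrable P (\<lambda>z. (\<Sum>i\<in>L. e (z i) * W i z)\<^sup>2)"
    and "(LINT z|P. (\<Sum>i\<in>L. e (z i) * W i z)\<^sup>2) \<le> \<sigma>\<^sup>2 * (LINT z|P. (\<Sum>i\<in>L. (W i z)\<^sup>2))"
proof -
  let ?X = "\<lambda>i l z. (e (z i) * e (z l)) * (W i z * W l z)"
  have square: "(\<Sum>i\<in>L. e (z i) * W i z)\<^sup>2 = (\<Sum>i\<in>L. \<Sum>l\<in>L. ?X i l z)" for z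
    by (simp add: power2_eq_square sum_product mult_ac)
  have int: "integrable P (?X i l)" if "i \<in> L" "l \<in> L" for i l
    using that L by (intro integrable_mult_bounded_measurable integrable_e_product bounded_measurable_mult W) auto
  show "integrable P (\<lambda>z. (\<Sum>i\<in>L. e (z i) * W i z)\<^sup>2)"
    unfolding square by (intro Bochner_Integration.integrable_sum int)
  have off: "(LINT z|P. ?X i l z) = 0" if il: "i \<in> L" "l \<in> L" "i \<noteq> l" for i l
  proof (rule coordinate_zero)
    show "l \<in> I" using L il by auto
    show "integrable P (?X i l)" using il by (intro int)
    fix z
    obtain \<psi>i \<psi>l where \<psi>: "\<psi>i \<in> borel_measurable borel" "bounded_measurable S (\<lambda>y. \<psi>i (kf y))" "\<And>y. W i (z(l := y)) = \<psi>i (kf y)"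
      "\<psi>l \<in> borel_measurable borel" "bounded_measurable S (\<lambda>y. \<psi>l (kf y))" "\<And>y. W l (z(l := y)) = \<psi>l (kf y)"
      using dep il by metis
    have upd: "?X i l (z(l := y)) = e (z i) * (e y * (\<psi>i (kf y) * \<psi>l (kf y)))" for y
      by (simp only: \<psi>(3,6) fun_upd_same fun_upd_other[OF il(3)] mult.assoc)
    have "(LINT y|S. ?X i l (z(l := y))) = (LINT y|S. e (z i) * (e y * (\<psi>i (kf y) * \<psi>l (kf y))))"
      by (simp only: upd)
    also have "\<dots> = e (z i) * (LINT y|S. e y * (\<psi>i (kf y) * \<psi>l (kf y)))" by simp
    also have "(LINT y|S. e y * (\<psi>i (kf y) * \<psi>l (kf y))) = 0"
      using e_mean[of "\<lambda>x. \<psi>i x * \<psi>l x"] \<psi> by (simp add: bounded_measurable_mult)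
    finally show "(LINT y|S. ?X i l (z(l := y))) = 0" by (simp only: mult_zero_right)
  qed
  have diag: "(LINT z|P. ?X i i z) \<le> \<sigma>\<^sup>2 * (LINT z|P. (W i z)\<^sup>2)" if i: "i \<in> L" for i
  proof -
    have Wi: "integrable P (\<lambda>z. \<sigma>\<^sup>2 * (W i z)\<^sup>2)"
      by (intro P.bounded_measurable_integrable bm_intros W i)
    have "0 \<le> (LINT z|P. \<sigma>\<^sup>2 * (W i z)\<^sup>2 - ?X i i z)"
    proof (rule coordinate_nonneg)
      show "i \<in> I" using L i by auto
      show "integrable P (\<lambda>z. \<sigma>\<^sup>2 * (W i z)\<^sup>2 - ?X i i z)"
        using i by (intro Bochner_Integration.integrable_diff Wi int)
      fix z
      obtain \<psi> where \<psi>: "\<psi> \<in> borel_measurable borel" "bounded_measurable S (\<lambda>y. \<psi> (kf y))" "\<And>y. W i (z(i := y)) = \<psi> (kf y)"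
        using dep i by metis
      have b: "bounded_measurable S (\<lambda>y. (\<psi> (kf y))\<^sup>2)" using \<psi>(2) by (rule bounded_measurable_power2)
      have "(LINT y|S. \<sigma>\<^sup>2 * (\<psi> (kf y))\<^sup>2 - (e y)\<^sup>2 * (\<psi> (kf y))\<^sup>2)
          = (LINT y|S. \<sigma>\<^sup>2 * (\<psi> (kf y))\<^sup>2) - (LINT y|S. (e y)\<^sup>2 * (\<psi> (kf y))\<^sup>2)"
        by (intro Bochner_Integration.integral_diff integrable_mult_bounded_measurable e_square b
            bounded_measurable_integrable bm_intros)
      then have "0 \<le> (LINT y|S. \<sigma>\<^sup>2 * (\<psi> (kf y))\<^sup>2 - (e y)\<^sup>2 * (\<psi> (kf y))\<^sup>2)"
        using e_variance[of "\<lambda>x. (\<psi> x)\<^sup>2"] \<psi>(1) b by simp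
      then show "0 \<le> (LINT y|S. \<sigma>\<^sup>2 * (W i (z(i := y)))\<^sup>2 - ?X i i (z(i := y)))"
        by (simp add: \<psi>(3) power2_eq_square)
    qed
    then show ?thesis using Wi int[OF i i] by (simp add: Bochner_Integration.integral_diff)
  qed
  have "finite L" using L finite_I finite_subset by blast
  have "(LINT z|P. (\<Sum>i\<in>L. e (z i) * W i z)\<^sup>2) = (\<Sum>i\<in>L. \<Sum>l\<in>L. LINT z|P. ?X i l z)"
    unfolding square using int by (simp add: Bochner_Integration.integral_sum Bochner_Integration.integrable_sum)
  also have "\<dots> = (\<Sum>i\<in>L. LINT z|P. ?X i i z)"
  proof (rule sum.cong[OF refl])
    fix i assume i: "i \<in> L"
    have "(\<Sum>l\<in>L. LINT z|P. ?X i l z) = (\<Sum>l\<in>L. if l = i then (LINT z|P. ?X i i z) else 0)"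
      using off i by (intro sum.cong) auto
    then show "(\<Sum>l\<in>L. LINT z|P. ?X i l z) = (LINT z|P. ?X i i z)" using i \<open>finite L\<close> by simp
  qed
  also have "\<dots> \<le> (\<Sum>i\<in>L. \<sigma>\<^sup>2 * (LINT z|P. (W i z)\<^sup>2))" by (intro sum_mono diag)
  also have "\<dots> = \<sigma>\<^sup>2 * (LINT z|P. (\<Sum>i\<in>L. (W i z)\<^sup>2))"
    using W by (simp add: sum_distrib_left Bochner_Integration.integral_sum
        P.bounded_measurable_integrable bounded_measurable_power2)
  finally show "(LINT z|P. (\<Sum>i\<in>L. e (z i) * W i z)\<^sup>2) \<le> \<sigma>\<^sup>2 * (LINT z|P. (\<Sum>i\<in>L. (W i z)\<^sup>2))" .
qed

lemma weight_dependence: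
  assumes B: "finite B" "j \<notin> B'" "i \<in> B'" "l \<in> B'" "0 < t"
  shows "\<exists>\<psi>. \<psi> \<in> borel_measurable borel \<and> bounded_measurable S (\<lambda>y. \<psi> (kf y)) \<and>
    (\<forall>y. weight_vec (\<lambda>i. kf ((z(l := y)) i)) t B j i = \<psi> (kf y))"
proof -
  let ?k = "\<lambda>x i. if i = l then x else kf (z i)"
  let ?\<psi> = "\<lambda>x. weight_vec (?k x) t B j i"
  have k: "(\<lambda>x. ?k x i) \<in> borel_measurable borel" for i by simp
  have res: "(\<lambda>x. res (?k x) t B (f x)) \<in> borel_measurable borel" if "f \<in> borel_measurable borel" for f
    using borel_measurable_res[of B "\<lambda>i x. ?k x i" borel t f] B k that by simp
  have meas: "?\<psi> \<in> borel_measurable borel"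
    unfolding weight_vec_def
    by (intro borel_measurable_inner borel_measurable_add borel_measurable_scaleR borel_measurable_const res k)
  \<comment> \<open>Only replacements in the range of \<open>kf\<close> are bounded; an arbitrary x
    is not.\<close>
  have "\<bar>?\<psi> (kf y)\<bar> \<le> \<kappa> * (\<kappa> / t + t * (\<kappa> / t / t))" for y
  proof -
    have kb: "norm (?k (kf y) i) \<le> \<kappa>" for i by (simp add: norm_kf)
    let ?r = "res (?k (kf y)) t B (?k (kf y) i)"
    have r: "norm ?r \<le> \<kappa> / t"
      by (rule order_trans[OF norm_res_le[OF \<open>0 < t\<close>] divide_right_mono[OF kb]]) (use \<open>0 < t\<close> in simp)
    have "norm (res (?k (kf y)) t B ?r) \<le> norm ?r / t" by (rule norm_res_le[OF \<open>0 < t\<close>])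
    also have "\<dots> \<le> \<kappa> / t / t" using r \<open>0 < t\<close> by (intro divide_right_mono) auto
    finally have rr: "norm (res (?k (kf y)) t B ?r) \<le> \<kappa> / t / t" .
    have "\<bar>?\<psi> (kf y)\<bar> \<le> norm (?k (kf y) j) * norm (?r + t *\<^sub>R res (?k (kf y)) t B ?r)"
      unfolding weight_vec_def by (rule Cauchy_Schwarz_ineq2)
    also have "\<dots> \<le> \<kappa> * (\<kappa> / t + t * (\<kappa> / t / t))"
    proof (intro mult_mono kb norm_triangle_mono r)
      show "norm (t *\<^sub>R res (?k (kf y)) t B ?r) \<le> t * (\<kappa> / t / t)"
        using mult_left_mono[OF rr, of t] \<open>0 < t\<close> by simp
    qed (auto simp: kappa_nonneg)
    finally show ?thesis .
  qed
  then have "bounded_measurable S (\<lambda>y. ?\<psi> (kf y))"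
    using measurable_compose[OF kf_measurable meas] by (intro bounded_measurableI) auto
  moreover have "weight_vec (\<lambda>i. kf ((z(l := y)) i)) t B j i = ?\<psi> (kf y)" for y
  proof -
    have "(\<lambda>i. kf ((z(l := y)) i)) = ?k (kf y)" by auto
    then show ?thesis by simp
  qed
  ultimately show ?thesis using meas by (intro exI[of _ ?\<psi>]) blast
qed

end

definition block_error :: "(nat \<Rightarrow> 'h::{real_inner,banach}) \<Rightarrow> (nat \<Rightarrow> real) \<Rightarrow> real \<Rightarrow> nat set \<Rightarrow> 'h \<Rightarrow> 'h" where
  "block_error k e t B g = (\<Sum>i\<in>B. e i *\<^sub>R (res k t B (k i) + t *\<^sub>R res k t B (res k t B (k i))))
     - t\<^sup>2 *\<^sub>R res k t B (res k t B g)"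

text \<open>For exact data a single regularisation leaves the bias - t G g. Applying 1 + t G to the
  estimator cancels this first order term, because (1 + t G) (1 - t G) = 1 - t^2 G^2.\<close>

lemma block_error_eq:
  fixes k :: "nat \<Rightarrow> 'h::{real_inner,banach}"
  assumes t: "0 < t" and y: "\<And>i. i \<in> B \<Longrightarrow> y i = inner (k i) g + e i"
  shows "res k t B (\<Sum>i\<in>B. y i *\<^sub>R k i) + t *\<^sub>R res k t B (res k t B (\<Sum>i\<in>B. y i *\<^sub>R k i)) - g
    = block_error k e t B g"
proof -
  note lin = linear_res[OF t, of k B]
  let ?G = "res k t B"
  let ?u = "\<Sum>i\<in>B. e i *\<^sub>R k i"
  have "(\<Sum>i\<in>B. y i *\<^sub>R k i) = (\<Sum>i\<in>B. inner (k i) g *\<^sub>R k i) + ?u"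
    by (simp add: y scaleR_add_left sum.distrib)
  also have "(\<Sum>i\<in>B. inner (k i) g *\<^sub>R k i) = reg k t B g - t *\<^sub>R g" by (simp add: reg_def)
  finally have 1: "?G (\<Sum>i\<in>B. y i *\<^sub>R k i) = g - t *\<^sub>R ?G g + ?G ?u"
    by (simp add: linear_add[OF lin] linear_diff[OF lin] linear_cmul[OF lin] res_reg[OF t])
  then have 2: "?G (?G (\<Sum>i\<in>B. y i *\<^sub>R k i)) = ?G g - t *\<^sub>R ?G (?G g) + ?G (?G ?u)"
    by (simp add: linear_add[OF lin] linear_diff[OF lin] linear_cmul[OF lin])
  have "x + t *\<^sub>R y - g = u + t *\<^sub>R w - t\<^sup>2 *\<^sub>R b" if "x = g - t *\<^sub>R a + u" "y = a - t *\<^sub>R b + w"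
    for x y u w a b :: 'h
    unfolding that by (simp add: power2_eq_square algebra_simps)
  from this[OF 1 2] have "?G (\<Sum>i\<in>B. y i *\<^sub>R k i) + t *\<^sub>R ?G (?G (\<Sum>i\<in>B. y i *\<^sub>R k i)) - g
      = ?G ?u + t *\<^sub>R ?G (?G ?u) - t\<^sup>2 *\<^sub>R ?G (?G g)" .
  also have "?G ?u + t *\<^sub>R ?G (?G ?u) = (\<Sum>i\<in>B. e i *\<^sub>R (?G (k i) + t *\<^sub>R ?G (?G (k i))))"
    by (simp add: linear_sum[OF lin] linear_cmul[OF lin] scaleR_sum_right scaleR_add_right sum.distrib
        mult.commute)
  finally show ?thesis by (simp add: block_error_def)
qed

context noisy_design
begin

lemma block_bounds:
  assumes j: "j \<in> I" and B: "B \<subseteq> I - {j}" and n: "n = real (card B) + 1" and t: "1 \<le> t" "t \<le> n"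
    and trace: "\<exists>B. orthonormal_basis B \<and>
      (\<forall>F. finite F \<longrightarrow> F \<subseteq> B \<longrightarrow> (\<Sum>e\<in>F. inner e e - t * inner e (pop_res S kf t n e)) \<le> D)"
  shows "bounded_measurable P (\<lambda>z. inner (kf (z j)) (t\<^sup>2 *\<^sub>R res (\<lambda>i. kf (z i)) t B (res (\<lambda>i. kf (z i)) t B g)))" (is ?A)
    and "(LINT z|P. (inner (kf (z j)) (t\<^sup>2 *\<^sub>R res (\<lambda>i. kf (z i)) t B (res (\<lambda>i. kf (z i)) t B g)))\<^sup>2)
      \<le> bias_const \<kappa> / n * (t ^ 4 * inner (pop_res S kf t n g) (pop_res S kf t n (pop_res S kf t n g))
          + t\<^sup>2 * D * (norm (pop_res S kf t n g))\<^sup>2)" (is ?B)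
    and "i \<in> B \<Longrightarrow> bounded_measurable P (\<lambda>z. weight_vec (\<lambda>i. kf (z i)) t B j i)"
    and "(LINT z|P. (\<Sum>i\<in>B. (weight_vec (\<lambda>i. kf (z i)) t B j i)\<^sup>2)) \<le> 4 * (1 + \<kappa>\<^sup>2) * D / n" (is ?C)
proof -
  have "finite B" using B finite_I finite_subset by blast
  have jB: "j \<notin> B" "insert j B - {j} = B" using B by auto
  \<comment> \<open>The locale's set J is the block together with the test point, so the training
    set \<open>J - {j}\<close> is the block itself.\<close>
  interpret loo: leave_one_out S kf \<kappa> I "insert j B" j t n D
  proof unfold_locales
    show "n = real (card (insert j B))" using \<open>finite B\<close> jB by (simp add: n)
  qed (use j B t trace in auto)
  show ?A using loo.bias_bm by (simp add: jB)
  show ?B using loo.E_bias_le by (simp add: jB)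
  have w: "loo.weight z (kf (z i)) = weight_vec (\<lambda>i. kf (z i)) t B j i" for z i
    by (simp add: loo.weight_def weight_vec_def jB)
  show ?C using loo.E_weight_le by (simp only: w jB)
  show "bounded_measurable P (\<lambda>z. weight_vec (\<lambda>i. kf (z i)) t B j i)" if "i \<in> B"
    using loo.weight_bm[of "\<lambda>z. kf (z i)"] kf_coordinate_bm[of i] that B by (auto simp: w)
qed

theorem aggregated_error:
  fixes g :: 'h
  assumes j: "j \<in> I" and part: "partition_on (I - {j}) \<P>" and ne: "\<P> \<noteq> {}"
    and card: "\<And>B. B \<in> \<P> \<Longrightarrow> n = real (card B) + 1" and t: "1 \<le> t" "t \<le> n"
    and trace: "\<exists>B. orthonormal_basis B \<and>
      (\<forall>F. finite F \<longrightarrow> F \<subseteq> B \<longrightarrow> (\<Sum>e\<in>F. inner e e - t * inner e (pop_res S kf t n e)) \<le> D)"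
  defines "m \<equiv> real (card \<P>)"
  defines "err \<equiv> \<lambda>z. \<Sum>B\<in>\<P>. (1 / m) *\<^sub>R block_error (\<lambda>i. kf (z i)) (\<lambda>i. e (z i)) t B g"
  shows "integrable P (\<lambda>z. (inner (kf (z j)) (err z))\<^sup>2)" (is ?int)
    and "(LINT z|P. (inner (kf (z j)) (err z))\<^sup>2) \<le>
      2 * (bias_const \<kappa> / n * (t ^ 4 * inner (pop_res S kf t n g) (pop_res S kf t n (pop_res S kf t n g))
          + t\<^sup>2 * D * (norm (pop_res S kf t n g))\<^sup>2)) + 8 * \<sigma>\<^sup>2 * (1 + \<kappa>\<^sup>2) * D / (m * n)" (is ?le)
proof -
  have sub: "B \<subseteq> I - {j}" if "B \<in> \<P>" for B using part that by (auto simp: partition_on_def)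
  have finP: "finite \<P>" using finite_I part by (metis finite_Diff finite_elements)
  have finB: "finite B" if "B \<in> \<P>" for B using sub[OF that] finite_I finite_subset by blast
  have un: "\<Union>\<P> = I - {j}" using part by (auto simp: partition_on_def)
  have m: "0 < m" using finP ne by (simp add: m_def card_gt_0_iff)
  have blocks: "\<exists>!B. B \<in> \<P> \<and> i \<in> B" if "i \<in> I - {j}" for i
    using part that by (auto simp: partition_on_def disjoint_def)
  \<comment> \<open>With the block as a function of the index, the noise of all blocks is one sum
    over the whole sample, and a single use of \<open>noise_sum\<close> also removes the
    correlations between blocks.\<close>
  define blk where "blk i = (THE B. B \<in> \<P> \<and> i \<in> B)" for i
  have blk: "blk i \<in> \<P>" "i \<in> blk i" if "i \<in> I - {j}" for i
    using theI'[OF blocks[OF that]] by (auto simp: blk_def)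
  have blk_eq: "blk i = B" if "B \<in> \<P>" "i \<in> B" for i B
    using blocks[of i] sub[OF that(1)] that unfolding blk_def by (intro the1_equality) auto
  have resum: "(\<Sum>i\<in>I - {j}. f (blk i) i) = (\<Sum>B\<in>\<P>. \<Sum>i\<in>B. f B i)" for f :: "nat set \<Rightarrow> nat \<Rightarrow> real"
  proof -
    have "(\<Sum>i\<in>I - {j}. f (blk i) i) = (\<Sum>B\<in>\<P>. \<Sum>i\<in>B. f (blk i) i)"
      unfolding un[symmetric] using finB part
      by (subst sum.Union_disjoint) (auto simp: partition_on_def disjoint_def)
    also have "\<dots> = (\<Sum>B\<in>\<P>. \<Sum>i\<in>B. f B i)" using blk_eq by (intro sum.cong) auto
    finally show ?thesis .
  qed
  note bb = block_bounds[OF j sub card t trace]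
  let ?w = "\<lambda>B i z. weight_vec (\<lambda>i. kf (z i)) t B j i"
  let ?b = "\<lambda>B z. inner (kf (z j)) (t\<^sup>2 *\<^sub>R res (\<lambda>i. kf (z i)) t B (res (\<lambda>i. kf (z i)) t B g))"
  let ?N = "\<lambda>z. \<Sum>i\<in>I - {j}. e (z i) * ?w (blk i) i z"
  let ?bias = "bias_const \<kappa> / n * (t ^ 4 * inner (pop_res S kf t n g) (pop_res S kf t n (pop_res S kf t n g))
          + t\<^sup>2 * D * (norm (pop_res S kf t n g))\<^sup>2)"
  have n: "0 < n" and t0: "0 < t" using t by auto
  have Wbm: "bounded_measurable P (\<lambda>z. ?w (blk i) i z)" if "i \<in> I - {j}" for i
    using bb(3)[OF blk(1) blk(1) blk(2)] that by blast
  have dep: "\<exists>\<psi>. \<psi> \<in> borel_measurable borel \<and> bounded_measurable S (\<lambda>y. \<psi> (kf y)) \<and>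
      (\<forall>y. ?w (blk i) i (z(l := y)) = \<psi> (kf y))" if "i \<in> I - {j}" "l \<in> I - {j}" for i l z
    using that by (intro weight_dependence[where B' = "I - {j}"] finB blk t0) auto
  have noise_int: "integrable P (\<lambda>z. (?N z)\<^sup>2)"
    by (rule noise_sum[OF _ Wbm dep]) auto
  have "(LINT z|P. (?N z)\<^sup>2) \<le> \<sigma>\<^sup>2 * (LINT z|P. (\<Sum>i\<in>I - {j}. (?w (blk i) i z)\<^sup>2))"
    by (rule noise_sum[OF _ Wbm dep]) auto
  also have "(LINT z|P. (\<Sum>i\<in>I - {j}. (?w (blk i) i z)\<^sup>2)) = (LINT z|P. (\<Sum>B\<in>\<P>. \<Sum>i\<in>B. (?w B i z)\<^sup>2))"
    by (simp only: resum[of "\<lambda>B i. (?w B i _)\<^sup>2"])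
  also have "\<dots> = (\<Sum>B\<in>\<P>. LINT z|P. (\<Sum>i\<in>B. (?w B i z)\<^sup>2))"
    using bb(3) by (intro Bochner_Integration.integral_sum P.bounded_measurable_integrable bm_intros) auto
  also have "\<dots> \<le> (\<Sum>B\<in>\<P>. 4 * (1 + \<kappa>\<^sup>2) * D / n)" by (intro sum_mono bb(4))
  also have "\<dots> = m * (4 * (1 + \<kappa>\<^sup>2) * D / n)" by (simp add: m_def)
  finally have noise: "(LINT z|P. (?N z)\<^sup>2) \<le> \<sigma>\<^sup>2 * (m * (4 * (1 + \<kappa>\<^sup>2) * D / n))"
    by (simp add: mult_left_mono)
  have err: "inner (kf (z j)) (err z) = (1 / m) * ?N z - (1 / m) * (\<Sum>B\<in>\<P>. ?b B z)" for z
  proof -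
    have "inner (kf (z j)) (block_error (\<lambda>i. kf (z i)) (\<lambda>i. e (z i)) t B g) = (\<Sum>i\<in>B. e (z i) * ?w B i z) - ?b B z" for B
      by (simp add: block_error_def weight_vec_def inner_diff_right inner_sum_right)
    then have "inner (kf (z j)) (err z) = (\<Sum>B\<in>\<P>. (1 / m) * ((\<Sum>i\<in>B. e (z i) * ?w B i z) - ?b B z))"
      by (simp add: err_def inner_sum_right)
    also have "\<dots> = (1 / m) * ((\<Sum>B\<in>\<P>. \<Sum>i\<in>B. e (z i) * ?w B i z) - (\<Sum>B\<in>\<P>. ?b B z))"
      by (simp only: sum_distrib_left[symmetric] sum_subtractf)
    also have "(\<Sum>B\<in>\<P>. \<Sum>i\<in>B. e (z i) * ?w B i z) = ?N z"
      by (rule resum[of "\<lambda>B i. e (z i) * ?w B i z", symmetric])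
    finally show ?thesis by (simp only: right_diff_distrib)
  qed
  have le: "(inner (kf (z j)) (err z))\<^sup>2 \<le> 2 / m\<^sup>2 * (?N z)\<^sup>2 + (\<Sum>B\<in>\<P>. 2 / m * (?b B z)\<^sup>2)" for z
  proof -
    have "(inner (kf (z j)) (err z))\<^sup>2 \<le> 2 * ((1 / m) * ?N z)\<^sup>2 + 2 * ((1 / m) * (\<Sum>B\<in>\<P>. ?b B z))\<^sup>2"
      unfolding err using sum_power2_le[of "(1 / m) * ?N z" "- ((1 / m) * (\<Sum>B\<in>\<P>. ?b B z))"] by simp
    also have "\<dots> \<le> 2 * ((1 / m) * ?N z)\<^sup>2 + 2 * ((1 / m)\<^sup>2 * ((\<Sum>B\<in>\<P>. (?b B z)\<^sup>2) * m))"
    proof -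
      \<comment> \<open>Cauchy-Schwarz over the blocks: all biases share one bound, which their
        average inherits without gain. The noise instead has m block contributions against 1 /
        m^2.\<close>
      have "(\<Sum>B\<in>\<P>. ?b B z)\<^sup>2 \<le> (\<Sum>B\<in>\<P>. (?b B z)\<^sup>2) * m"
        unfolding m_def by (rule sum_squared_le_sum_of_squares)
      from mult_left_mono[OF this, of "(1 / m)\<^sup>2"]
      have "((1 / m) * (\<Sum>B\<in>\<P>. ?b B z))\<^sup>2 \<le> (1 / m)\<^sup>2 * ((\<Sum>B\<in>\<P>. (?b B z)\<^sup>2) * m)"
        by (simp only: power_mult_distrib zero_le_power2 simp_thms)
      then show ?thesis by linarith
    qed
    also have "\<dots> = 2 / m\<^sup>2 * (?N z)\<^sup>2 + 2 / m * (\<Sum>B\<in>\<P>. (?b B z)\<^sup>2)"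
      using m by (simp add: power_mult_distrib power_divide power2_eq_square)
    finally show ?thesis by (simp only: sum_distrib_left)
  qed
  have bint: "integrable P (\<lambda>z. 2 / m * (?b B z)\<^sup>2)" if "B \<in> \<P>" for B
    by (intro P.bounded_measurable_integrable bounded_measurable_mult bounded_measurable_power2
        bounded_measurable_const bb(1) that)
  have Nint: "integrable P (\<lambda>z. 2 / m\<^sup>2 * (?N z)\<^sup>2)" using noise_int by simp
  have bsum: "integrable P (\<lambda>z. \<Sum>B\<in>\<P>. 2 / m * (?b B z)\<^sup>2)"
    by (intro Bochner_Integration.integrable_sum bint)
  note dom = Bochner_Integration.integrable_add[OF Nint bsum]
  have meas: "(\<lambda>z. (inner (kf (z j)) (err z))\<^sup>2) \<in> borel_measurable P"
    unfolding err
  proof (intro borel_measurable_power borel_measurable_diff borel_measurable_times borel_measurable_const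
      borel_measurable_sum)
    show "(\<lambda>z. ?w (blk i) i z) \<in> borel_measurable P" if "i \<in> I - {j}" for i
      using Wbm[OF that] by (simp add: bounded_measurable_def)
    show "(\<lambda>z. e (z i)) \<in> borel_measurable P" if "i \<in> I - {j}" for i
      using that by (intro measurable_compose[of "\<lambda>z. z i" P S e borel] measurable_component_singleton e_measurable) auto
    show "(\<lambda>z. ?b B z) \<in> borel_measurable P" if "B \<in> \<P>" for B
      using bb(1)[OF that that] unfolding bounded_measurable_def by blast
  qed
  show ?int
    by (rule Bochner_Integration.integrable_bound[OF dom meas])
      (use le in \<open>auto intro!: AE_I2 order_trans[OF le] abs_ge_self\<close>)
  then have "(LINT z|P. (inner (kf (z j)) (err z))\<^sup>2)
      \<le> (LINT z|P. 2 / m\<^sup>2 * (?N z)\<^sup>2 + (\<Sum>B\<in>\<P>. 2 / m * (?b B z)\<^sup>2))"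
    by (intro integral_mono dom le)
  also have "\<dots> = (LINT z|P. 2 / m\<^sup>2 * (?N z)\<^sup>2) + (LINT z|P. (\<Sum>B\<in>\<P>. 2 / m * (?b B z)\<^sup>2))"
    by (rule Bochner_Integration.integral_add[OF Nint bsum])
  also have "(LINT z|P. 2 / m\<^sup>2 * (?N z)\<^sup>2) = 2 / m\<^sup>2 * (LINT z|P. (?N z)\<^sup>2)"
    by (rule integral_mult_right_zero)
  also have "(LINT z|P. (\<Sum>B\<in>\<P>. 2 / m * (?b B z)\<^sup>2)) = (\<Sum>B\<in>\<P>. LINT z|P. 2 / m * (?b B z)\<^sup>2)"
    by (intro Bochner_Integration.integral_sum bint)
  also have "\<dots> = (\<Sum>B\<in>\<P>. 2 / m * (LINT z|P. (?b B z)\<^sup>2))"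
    by (simp only: integral_mult_right_zero)
  also have "2 / m\<^sup>2 * (LINT z|P. (?N z)\<^sup>2) + (\<Sum>B\<in>\<P>. 2 / m * (LINT z|P. (?b B z)\<^sup>2))
      \<le> 2 / m\<^sup>2 * (\<sigma>\<^sup>2 * (m * (4 * (1 + \<kappa>\<^sup>2) * D / n))) + (\<Sum>B\<in>\<P>. 2 / m * ?bias)"
    using m by (intro add_mono mult_left_mono sum_mono noise bb(2)) auto
  also have "(\<Sum>B\<in>\<P>. 2 / m * ?bias) = 2 * ?bias" using m by (simp add: m_def)
  also have "2 / m\<^sup>2 * (\<sigma>\<^sup>2 * (m * (4 * (1 + \<kappa>\<^sup>2) * D / n))) = 8 * \<sigma>\<^sup>2 * (1 + \<kappa>\<^sup>2) * D / (m * n)"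
    using m n by (simp add: power2_eq_square)
  finally show ?le by linarith
qed

end

section \<open>Kernel regression\<close>

lemma nn_integral_square_add_le:
  fixes f g :: "'c \<Rightarrow> real"
  assumes [measurable]: "f \<in> borel_measurable M" "g \<in> borel_measurable M"
  shows "(\<integral>\<^sup>+x. ennreal ((f x + g x)\<^sup>2) \<partial>M)
    \<le> 2 * (\<integral>\<^sup>+x. ennreal ((f x)\<^sup>2) \<partial>M) + 2 * (\<integral>\<^sup>+x. ennreal ((g x)\<^sup>2) \<partial>M)"
proof -
  have "ennreal ((f x + g x)\<^sup>2) \<le> 2 * ennreal ((f x)\<^sup>2) + 2 * ennreal ((g x)\<^sup>2)" for x
  proof -
    have "ennreal ((f x + g x)\<^sup>2) \<le> ennreal (2 * (f x)\<^sup>2 + 2 * (g x)\<^sup>2)"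
      by (intro ennreal_leI sum_power2_le)
    also have "\<dots> = 2 * ennreal ((f x)\<^sup>2) + 2 * ennreal ((g x)\<^sup>2)"
      by (simp add: ennreal_plus ennreal_mult)
    finally show ?thesis .
  qed
  then have "(\<integral>\<^sup>+x. ennreal ((f x + g x)\<^sup>2) \<partial>M) \<le> (\<integral>\<^sup>+x. 2 * ennreal ((f x)\<^sup>2) + 2 * ennreal ((g x)\<^sup>2) \<partial>M)"
    by (intro nn_integral_mono)
  then show ?thesis by (simp add: nn_integral_add nn_integral_cmult)
qed

locale kernel_regression =
  fixes K :: "'a::{metric_space, second_countable_topology} \<Rightarrow> 'a \<Rightarrow> real"
    and emb :: "'h::{real_inner, banach, second_countable_topology} \<Rightarrow> 'a \<Rightarrow> real"
    and \<rho> :: "('a \<times> real) measure" and \<rho>X :: "'a measure"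
  assumes compact_UNIV: "compact (UNIV :: 'a set)"
    and prob_\<rho>: "prob_space \<rho>" and sets_\<rho>: "sets \<rho> = sets (borel \<Otimes>\<^sub>M borel)"
    and \<rho>X_def: "\<rho>X = distr \<rho> borel fst"
    and mercer: "mercer_kernel K" and rkhs: "rkhs K emb"
begin

abbreviation "kx \<equiv> kernel_section K emb"
abbreviation "kf y \<equiv> kx (fst y)"

lemma emb_kx: "emb (kx x) = K x" and inner_kx: "inner f (kx x) = emb f x"
proof -
  obtain k where k: "emb k = K x" "\<And>f. inner f k = emb f x" using rkhs by (auto simp: rkhs_def)
  moreover have "inj emb" using rkhs by (simp add: rkhs_def)
  ultimately have "kx x = k" unfolding kernel_section_def by (metis inv_f_f)
  then show "emb (kx x) = K x" "inner f (kx x) = emb f x" using k by auto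
qed

lemma K_commute: "K x y = K y x"
  using mercer by (simp add: mercer_kernel_def)

lemma inner_kx_kx: "inner (kx x) (kx y) = K x y"
  by (simp add: inner_kx emb_kx)

lemma continuous_K: "continuous_on UNIV (\<lambda>(x, t). K x t)"
  using mercer by (simp add: mercer_kernel_def)

text \<open>The squared distance of two kernel sections is a combination of kernel values.
  Measurability of the feature map and, by compactness, its boundedness follow.\<close>

lemma continuous_kx: "continuous_on UNIV kx"
proof (rule continuous_on_sequentiallyI)
  fix u :: "nat \<Rightarrow> 'a" and a assume u: "u \<longlonglongrightarrow> a"
  have K_lim: "(\<lambda>m. K (v m) (w m)) \<longlonglongrightarrow> K a a" if "v \<longlonglongrightarrow> a" "w \<longlonglongrightarrow> a" for v w :: "nat \<Rightarrow> 'a"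
    using continuous_on_tendsto_compose[OF continuous_K tendsto_Pair[OF that]] by simp
  have "(\<lambda>m. K (u m) (u m) - 2 * K (u m) a + K a a) \<longlonglongrightarrow> K a a - 2 * K a a + K a a"
    by (intro tendsto_intros K_lim u)
  moreover have "(norm (kx (u m) - kx a))\<^sup>2 = K (u m) (u m) - 2 * K (u m) a + K a a" for m
    by (simp add: power2_norm_eq_inner inner_diff_left inner_diff_right inner_kx_kx
        K_commute[of a "u m"])
  ultimately have "(\<lambda>m. (norm (kx (u m) - kx a))\<^sup>2) \<longlonglongrightarrow> 0" by simp
  then have "(\<lambda>m. sqrt ((norm (kx (u m) - kx a))\<^sup>2)) \<longlonglongrightarrow> sqrt 0" by (rule tendsto_real_sqrt)
  then have "(\<lambda>m. norm (kx (u m) - kx a)) \<longlonglongrightarrow> 0" by simp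
  then show "(\<lambda>m. kx (u m)) \<longlonglongrightarrow> kx a" by (metis LIM_zero_cancel tendsto_norm_zero_cancel)
qed

lemma kx_measurable [measurable]: "kx \<in> borel_measurable borel"
  by (rule borel_measurable_continuous_onI[OF continuous_kx])

lemma emb_measurable [measurable]: "emb f \<in> borel_measurable borel"
proof -
  have "(\<lambda>x. inner f (kx x)) \<in> borel_measurable borel" by measurable
  then show ?thesis by (simp add: inner_kx)
qed

definition \<kappa> :: real where "\<kappa> = (SOME c. \<forall>x. norm (kx x) \<le> c)"

lemma norm_kx: "norm (kx x) \<le> \<kappa>"
proof -
  have "bounded (range kx)"
    using compact_continuous_image[OF continuous_kx compact_UNIV] by (rule compact_imp_bounded)
  then obtain c where "\<forall>x. norm (kx x) \<le> c" by (auto simp: bounded_iff)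
  then have "\<forall>x. norm (kx x) \<le> \<kappa>" unfolding \<kappa>_def by (rule someI)
  then show ?thesis by blast
qed

sublocale prob_space \<rho> by (rule prob_\<rho>)

lemma fst_measurable [measurable]: "fst \<in> measurable \<rho> borel" "snd \<in> borel_measurable \<rho>"
  by (simp_all add: measurable_cong_sets[OF sets_\<rho> refl])

sublocale random_design \<rho> kf \<kappa>
  by unfold_locales (measurable, rule norm_kx)

sublocale X: prob_space \<rho>X
  unfolding \<rho>X_def by (rule prob_space_distr) (rule fst_measurable)

lemma sets_\<rho>X [measurable_cong]: "sets \<rho>X = sets borel" by (simp add: \<rho>X_def)

lemma space_\<rho>X [simp]: "space \<rho>X = UNIV" by (simp add: \<rho>X_def)

lemma T_eq: "T f = (LINT x|\<rho>X. emb f x *\<^sub>R kx x)"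
  unfolding cov_op_def \<rho>X_def by (subst integral_distr) (simp_all add: inner_commute[of _ f] inner_kx)

lemma inner_T_emb: "inner g (T f) = (LINT x|\<rho>X. emb g x * emb f x)"
  unfolding inner_T \<rho>X_def by (subst integral_distr) (simp_all add: inner_commute[of "kx _"] inner_kx)

lemma rkhs_integral_op_eq: "rkhs_integral_op K emb \<rho>X = T"
proof
  fix f
  have "emb (T f) = integral_op K \<rho>X (emb f)"
  proof
    fix x
    have "emb (T f) x = inner (kx x) (T f)" by (simp only: inner_commute[of "kx x"] inner_kx)
    also have "\<dots> = integral_op K \<rho>X (emb f) x"
      by (simp add: inner_T_emb integral_op_def emb_kx)
    finally show "emb (T f) x = integral_op K \<rho>X (emb f) x" .
  qed
  moreover have "inj emb" using rkhs by (simp add: rkhs_def)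
  ultimately show "rkhs_integral_op K emb \<rho>X f = T f"
    unfolding rkhs_integral_op_def by (metis inv_f_f)
qed

text \<open>The operator in \<open>effective_dim\<close> is 1 - t R. The basis is the one selected
  inside \<open>positive_trace\<close>, so the finite sums are literally partial sums of that trace,
  and its terms are nonnegative.\<close>

lemma trace_bound:
  assumes t: "0 < t" "0 < n" and D: "0 \<le> D" "effective_dim K emb \<rho>X (t / n) \<le> ennreal D"
  shows "\<exists>B::'h set. orthonormal_basis B \<and>
      (\<forall>F. finite F \<longrightarrow> F \<subseteq> B \<longrightarrow> (\<Sum>e\<in>F. inner e e - t * inner e (pop_res \<rho> kf t n e)) \<le> D)"
proof -
  interpret T: bounded_linear T by (rule bounded_linear_T)
  let ?R = "pop_res \<rho> kf t n"
  let ?L = "\<lambda>f. inv (\<lambda>g. T g + (t / n) *\<^sub>R g) (T f)"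
  define B :: "'h set" where "B = (SOME B. orthonormal_basis B)"
  have B: "orthonormal_basis B" unfolding B_def using orthonormal_basis_exists by (rule someI_ex)
  have L: "?L e = e - t *\<^sub>R ?R e" for e
  proof -
    have R: "t *\<^sub>R ?R e + n *\<^sub>R T (?R e) = e" using t by (intro pop_res_right) auto
    have TR: "T (?R e) = (1 / n) *\<^sub>R (e - t *\<^sub>R ?R e)"
    proof -
      have "(1 / n) *\<^sub>R (e - t *\<^sub>R ?R e) = (1 / n) *\<^sub>R (n *\<^sub>R T (?R e))"
        by (subst (1) R[symmetric]) (simp only: add_diff_cancel_left')
      then show ?thesis using t by (simp only: scaleR_scaleR) simp
    qed
    have "bij (\<lambda>g. (t / n) *\<^sub>R g + 1 *\<^sub>R T g)" using t by (intro bij_pop) auto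
    then have "inj (\<lambda>g. T g + (t / n) *\<^sub>R g)" by (simp add: bij_def add.commute)
    moreover have "T (e - t *\<^sub>R ?R e) + (t / n) *\<^sub>R (e - t *\<^sub>R ?R e) = T e"
      by (simp add: T.diff T.scaleR TR)
    ultimately show ?thesis
      using inv_f_f[of "\<lambda>g. T g + (t / n) *\<^sub>R g" "e - t *\<^sub>R ?R e"] by simp
  qed
  have "(\<Sum>e\<in>F. inner e e - t * inner e (?R e)) \<le> D" if F: "finite F" "F \<subseteq> B" for F
  proof -
    have nonneg: "0 \<le> inner e e - t * inner e (?R e)" for e
    proof -
      have "inner e (?R e) \<le> norm e * norm (?R e)" by (rule norm_cauchy_schwarz)
      also have "\<dots> \<le> norm e * (norm e / t)" using t by (intro mult_left_mono norm_pop_res_le) auto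
      finally show ?thesis using t by (simp add: field_simps power2_norm_eq_inner[symmetric] power2_eq_square)
    qed
    have "ennreal (\<Sum>e\<in>F. inner e e - t * inner e (?R e)) = (\<Sum>e\<in>F. ennreal (inner (?L e) e))"
    proof -
      have "inner (?L e) e = inner e e - t * inner e (?R e)" for e
        by (simp add: L inner_diff_left inner_commute[of "?R e" e])
      then show ?thesis using nonneg by (simp only: sum_ennreal)
    qed
    also have "\<dots> \<le> (\<Sum>\<^sub>\<infinity>e\<in>B. ennreal (inner (?L e) e))"
      using F by (subst nonneg_infsum_complete) (auto intro!: SUP_upper)
    also have "\<dots> \<le> ennreal D"
      using D(2) by (simp add: effective_dim_def positive_trace_def rkhs_integral_op_eq B_def)
    finally show ?thesis using D(1) by simp
  qed
  then show ?thesis using B by blast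
qed

text \<open>A test function of \<open>kf\<close> factors through the input, hence is measurable for
  the conditioning algebra and can be moved inside the conditional expectation. The noise is
  rewritten with \<open>emb g\<close>, which agrees with \<open>fstar\<close> only almost
  everywhere.\<close>

lemma noise_conditions:
  fixes fstar :: "'a \<Rightarrow> real" and g :: 'h
  assumes model: "regression_model \<rho> fstar \<sigma>" and fg: "AE x in \<rho>X. fstar x = emb g x" and I: "finite I"
  shows "noisy_design \<rho> kf \<kappa> I (\<lambda>y. snd y - emb g (fst y)) \<sigma>"
proof -
  let ?e = "\<lambda>y. snd y - emb g (fst y)" and ?G = "vimage_algebra (space \<rho>) fst (borel :: 'a measure)"
  have [measurable]: "fstar \<in> borel_measurable borel"
    and sq: "integrable \<rho> (\<lambda>z. (noise fstar z)\<^sup>2)"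
    and mean: "AE z in \<rho>. real_cond_exp \<rho> ?G (noise fstar) z = 0"
    and var: "AE z in \<rho>. real_cond_exp \<rho> ?G (\<lambda>z. (noise fstar z)\<^sup>2) z \<le> \<sigma>\<^sup>2"
    using model by (auto simp: regression_model_def Let_def)
  have [measurable]: "noise fstar \<in> borel_measurable \<rho>" unfolding noise_def by measurable
  have e_eq: "AE z in \<rho>. ?e z = noise fstar z"
  proof -
    have "AE z in \<rho>. fstar (fst z) = emb g (fst z)"
      using fg unfolding \<rho>X_def by (subst (asm) AE_distr_iff) auto
    then show ?thesis by eventually_elim (simp add: noise_def)
  qed
  have "subalgebra \<rho> ?G"
    unfolding subalgebra_def by (auto simp: sets_vimage_algebra2 measurable_sets)
  then interpret finite_measure_subalgebra \<rho> ?G by unfold_locales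
  have int: "integrable \<rho> (noise fstar)"
  proof (rule Bochner_Integration.integrable_bound)
    show "integrable \<rho> (\<lambda>y. 1 + (noise fstar y)\<^sup>2)" using sq by simp
    have "\<bar>a\<bar> \<le> 1 + a\<^sup>2" for a :: real
      using zero_le_power2[of "\<bar>a\<bar> - 1"] by (simp add: power2_eq_square algebra_simps)
    then show "AE y in \<rho>. norm (noise fstar y) \<le> norm (1 + (noise fstar y)\<^sup>2)" by simp
  qed measurable
  have G_meas: "(\<lambda>y. \<psi> (kf y)) \<in> borel_measurable ?G" if "\<psi> \<in> borel_measurable borel" for \<psi> :: "'h \<Rightarrow> real"
  proof -
    have "fst \<in> measurable ?G (borel :: 'a measure)" by (rule measurable_vimage_algebra1) auto
    moreover have "(\<lambda>x. \<psi> (kx x)) \<in> borel_measurable borel"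
      using that kx_measurable by (rule measurable_compose[rotated])
    ultimately show ?thesis by (rule measurable_compose)
  qed
  show ?thesis
  proof unfold_locales
    show "finite I" by fact
    show "?e \<in> borel_measurable \<rho>" by measurable
    show "integrable \<rho> (\<lambda>y. (?e y)\<^sup>2)"
      using sq by (rule integrable_cong_AE_imp) (use e_eq in auto)
  next
    fix \<psi> :: "'h \<Rightarrow> real" assume \<psi>: "\<psi> \<in> borel_measurable borel" "bounded_measurable \<rho> (\<lambda>y. \<psi> (kf y))"
    have [measurable]: "(\<lambda>y. \<psi> (kf y)) \<in> borel_measurable \<rho>" using \<psi>(2) by (simp add: bounded_measurable_def)
    have i: "integrable \<rho> (\<lambda>y. \<psi> (kf y) * noise fstar y)"
      using integrable_mult_bounded_measurable[OF int \<psi>(2)] by (simp add: mult.commute)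
    have "(LINT y|\<rho>. ?e y * \<psi> (kf y)) = (LINT y|\<rho>. \<psi> (kf y) * noise fstar y)"
      using e_eq by (intro integral_cong_AE) auto
    also have "\<dots> = (LINT y|\<rho>. \<psi> (kf y) * real_cond_exp \<rho> ?G (noise fstar) y)"
      by (rule real_cond_exp_intg(2)[symmetric, OF i G_meas[OF \<psi>(1)]]) measurable
    also have "\<dots> = (LINT y|\<rho>. 0)"
      using mean by (intro integral_cong_AE) auto
    finally show "(LINT y|\<rho>. ?e y * \<psi> (kf y)) = 0" by simp
    assume pos: "\<And>x. 0 \<le> \<psi> x"
    have i: "integrable \<rho> (\<lambda>y. \<psi> (kf y) * (noise fstar y)\<^sup>2)"
      using integrable_mult_bounded_measurable[OF sq \<psi>(2)] by (simp add: mult.commute)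
    have "(LINT y|\<rho>. (?e y)\<^sup>2 * \<psi> (kf y)) = (LINT y|\<rho>. \<psi> (kf y) * (noise fstar y)\<^sup>2)"
      using e_eq by (intro integral_cong_AE) auto
    also have "\<dots> = (LINT y|\<rho>. \<psi> (kf y) * real_cond_exp \<rho> ?G (\<lambda>y. (noise fstar y)\<^sup>2) y)"
      by (rule real_cond_exp_intg(2)[symmetric, OF i G_meas[OF \<psi>(1)]]) measurable
    also have "\<dots> \<le> (LINT y|\<rho>. \<sigma>\<^sup>2 * \<psi> (kf y))"
    proof (rule integral_mono_AE)
      show "integrable \<rho> (\<lambda>y. \<psi> (kf y) * real_cond_exp \<rho> ?G (\<lambda>y. (noise fstar y)\<^sup>2) y)"
        by (rule real_cond_exp_intg(1)[OF i G_meas[OF \<psi>(1)]]) measurable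
      show "integrable \<rho> (\<lambda>y. \<sigma>\<^sup>2 * \<psi> (kf y))"
        using bounded_measurable_integrable[OF \<psi>(2)] by simp
      show "AE y in \<rho>. \<psi> (kf y) * real_cond_exp \<rho> ?G (\<lambda>y. (noise fstar y)\<^sup>2) y \<le> \<sigma>\<^sup>2 * \<psi> (kf y)"
        using var by eventually_elim (simp add: mult.commute[of "\<psi> _"] mult_right_mono pos)
    qed
    finally show "(LINT y|\<rho>. (?e y)\<^sup>2 * \<psi> (kf y)) \<le> \<sigma>\<^sup>2 * (LINT y|\<rho>. \<psi> (kf y))" by simp
  qed
qed

end

section \<open>Bessel's inequality, spectral filters and the source condition\<close>

lemma L2_mult_integrable:
  assumes "f \<in> L2 M" "g \<in> L2 M"
  shows "integrable M (\<lambda>x. f x * g x)"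
proof (rule Bochner_Integration.integrable_bound)
  have [measurable]: "f \<in> borel_measurable M" "g \<in> borel_measurable M" using assms by (auto simp: L2_def)
  show "integrable M (\<lambda>x. (f x)\<^sup>2 + (g x)\<^sup>2)" using assms by (auto simp: L2_def)
  have "\<bar>a * b\<bar> \<le> a\<^sup>2 + b\<^sup>2" for a b :: real
  proof -
    have "2 * (\<bar>a\<bar> * \<bar>b\<bar>) \<le> a\<^sup>2 + b\<^sup>2"
      using zero_le_power2[of "\<bar>a\<bar> - \<bar>b\<bar>"] by (simp add: power2_eq_square algebra_simps)
    moreover have "0 \<le> \<bar>a\<bar> * \<bar>b\<bar>" by simp
    ultimately show ?thesis by (simp only: abs_mult)
  qed
  then show "AE x in M. norm (f x * g x) \<le> norm ((f x)\<^sup>2 + (g x)\<^sup>2)" by simp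
  show "(\<lambda>x. f x * g x) \<in> borel_measurable M" by measurable
qed

lemma L2_bessel:
  assumes F: "finite F" and u: "u \<in> L2 M" and \<phi>: "\<And>i. i \<in> F \<Longrightarrow> \<phi> i \<in> L2 M"
    and on: "\<And>i j. i \<in> F \<Longrightarrow> j \<in> F \<Longrightarrow> L2_inner M (\<phi> i) (\<phi> j) = (if i = j then 1 else 0)"
  shows "(\<Sum>i\<in>F. (L2_inner M u (\<phi> i))\<^sup>2) \<le> (LINT x|M. (u x)\<^sup>2)"
proof -
  let ?c = "\<lambda>i. L2_inner M u (\<phi> i)"
  let ?w = "\<lambda>x. \<Sum>i\<in>F. ?c i * \<phi> i x"
  have uw: "u x * ?w x = (\<Sum>i\<in>F. ?c i * (u x * \<phi> i x))" for x by (simp add: sum_distrib_left mult_ac)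
  have ww: "?w x * ?w x = (\<Sum>i\<in>F. \<Sum>j\<in>F. ?c i * ?c j * (\<phi> i x * \<phi> j x))" for x
    by (simp add: sum_product mult_ac)
  have int: "integrable M (\<lambda>x. ?c i * (u x * \<phi> i x))" "integrable M (\<lambda>x. ?c i * ?c j * (\<phi> i x * \<phi> j x))"
    if "i \<in> F" "j \<in> F" for i j
    using L2_mult_integrable u \<phi> that by auto
  have iu: "integrable M (\<lambda>x. (u x)\<^sup>2)" using u by (simp add: L2_def)
  have iuw: "integrable M (\<lambda>x. u x * ?w x)" unfolding uw by (intro Bochner_Integration.integrable_sum int)
  have iww: "integrable M (\<lambda>x. ?w x * ?w x)" unfolding ww by (intro Bochner_Integration.integrable_sum int)
  have "(LINT x|M. u x * ?w x) = (\<Sum>i\<in>F. LINT x|M. ?c i * (u x * \<phi> i x))"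
    unfolding uw by (intro Bochner_Integration.integral_sum int)
  also have "\<dots> = (\<Sum>i\<in>F. (?c i)\<^sup>2)" by (simp add: L2_inner_def power2_eq_square)
  finally have euw: "(LINT x|M. u x * ?w x) = (\<Sum>i\<in>F. (?c i)\<^sup>2)" .
  have "(LINT x|M. ?w x * ?w x) = (\<Sum>i\<in>F. LINT x|M. (\<Sum>j\<in>F. ?c i * ?c j * (\<phi> i x * \<phi> j x)))"
    unfolding ww by (intro Bochner_Integration.integral_sum Bochner_Integration.integrable_sum int)
  also have "\<dots> = (\<Sum>i\<in>F. \<Sum>j\<in>F. LINT x|M. ?c i * ?c j * (\<phi> i x * \<phi> j x))"
    by (intro sum.cong refl Bochner_Integration.integral_sum int)
  also have "\<dots> = (\<Sum>i\<in>F. \<Sum>j\<in>F. if i = j then (?c i)\<^sup>2 else 0)"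
  proof (intro sum.cong refl)
    fix i j assume "i \<in> F" "j \<in> F"
    then have "(LINT x|M. \<phi> i x * \<phi> j x) = (if i = j then 1 else 0)" using on by (simp add: L2_inner_def)
    then show "(LINT x|M. ?c i * ?c j * (\<phi> i x * \<phi> j x)) = (if i = j then (?c i)\<^sup>2 else 0)"
      by (simp add: power2_eq_square)
  qed
  also have "\<dots> = (\<Sum>i\<in>F. (?c i)\<^sup>2)" using F by simp
  finally have eww: "(LINT x|M. ?w x * ?w x) = (\<Sum>i\<in>F. (?c i)\<^sup>2)" .
  have "0 \<le> (LINT x|M. (u x)\<^sup>2 - 2 * (u x * ?w x) + ?w x * ?w x)"
  proof (rule Bochner_Integration.integral_nonneg)
    fix x
    have "0 \<le> a\<^sup>2 - 2 * (a * b) + b * b" for a b :: real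
      using zero_le_power2[of "a - b"] by (simp add: power2_eq_square algebra_simps)
    then show "0 \<le> (u x)\<^sup>2 - 2 * (u x * ?w x) + ?w x * ?w x" .
  qed
  also have "\<dots> = (LINT x|M. (u x)\<^sup>2) - 2 * (LINT x|M. u x * ?w x) + (LINT x|M. ?w x * ?w x)"
    using iu iuw iww by (simp add: Bochner_Integration.integral_add Bochner_Integration.integral_diff)
  finally show ?thesis by (simp add: euw eww)
qed

text \<open>In the first bound \<open>r \<le> 2\<close> makes the exponent 2 r - 4 nonpositive, so
  \<mu> alone dominates. In the second the exponent 2 r - 3 changes sign at r = 3/2; beyond it the
  filter saturates, which explains the minimum, and 1 + c bounds \<mu> + s to a power of at most
  1.\<close>

lemma tikhonov_filter_bounds:
  fixes s \<mu> r c :: real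
  assumes s: "0 < s" "s \<le> c" and \<mu>: "0 < \<mu>" "\<mu> \<le> 1" and r: "1 / 2 \<le> r" "r \<le> 2"
  shows "\<mu> ^ 4 * (s powr (2 * r - 1) / (\<mu> + s) ^ 3) \<le> \<mu> powr (2 * r)"
    and "s powr (2 * r - 1) / (\<mu> + s)\<^sup>2 \<le> (1 + c) * \<mu> powr (min (2 * r - 3) 0)"
proof -
  have pos: "0 < \<mu> + s" using s \<mu> by simp
  have le: "s powr (2 * r - 1) \<le> (\<mu> + s) powr (2 * r - 1)"
    using s \<mu> r by (intro powr_mono2) auto
  have "s powr (2 * r - 1) / (\<mu> + s) ^ 3 \<le> (\<mu> + s) powr (2 * r - 1) / (\<mu> + s) powr 3"
    using pos le by (simp add: divide_right_mono powr_numeral)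
  also have "\<dots> = (\<mu> + s) powr (2 * r - 4)" by (simp flip: powr_diff)
  also have "\<dots> \<le> \<mu> powr (2 * r - 4)" using s \<mu> r by (intro powr_mono2') auto
  finally have "\<mu> ^ 4 * (s powr (2 * r - 1) / (\<mu> + s) ^ 3) \<le> \<mu> ^ 4 * \<mu> powr (2 * r - 4)"
    by (rule mult_left_mono) simp
  also have "\<mu> ^ 4 * \<mu> powr (2 * r - 4) = \<mu> powr 4 * \<mu> powr (2 * r - 4)"
    using \<mu> by (simp add: powr_numeral)
  also have "\<dots> = \<mu> powr (2 * r)" by (simp flip: powr_add)
  finally show "\<mu> ^ 4 * (s powr (2 * r - 1) / (\<mu> + s) ^ 3) \<le> \<mu> powr (2 * r)" .
  have "s powr (2 * r - 1) / (\<mu> + s)\<^sup>2 \<le> (\<mu> + s) powr (2 * r - 1) / (\<mu> + s) powr 2"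
    using pos le by (simp add: divide_right_mono powr_numeral)
  also have "\<dots> = (\<mu> + s) powr (2 * r - 3)" by (simp flip: powr_diff)
  also have "\<dots> \<le> (1 + c) * \<mu> powr (min (2 * r - 3) 0)"
  proof (cases "2 * r \<le> 3")
    case True
    have "(\<mu> + s) powr (2 * r - 3) \<le> \<mu> powr (2 * r - 3)" using s \<mu> True by (intro powr_mono2') auto
    also have "\<dots> \<le> (1 + c) * \<mu> powr (2 * r - 3)" using s by (simp add: mult_le_cancel_right1)
    finally show ?thesis using True by simp
  next
    case False
    have "(\<mu> + s) powr (2 * r - 3) \<le> (1 + c) powr (2 * r - 3)" using s \<mu> False by (intro powr_mono2) auto
    also have "\<dots> \<le> (1 + c) powr 1" using s r by (intro powr_mono) auto
    finally show ?thesis using False s \<mu> by simp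
  qed
  finally show "s powr (2 * r - 1) / (\<mu> + s)\<^sup>2 \<le> (1 + c) * \<mu> powr (min (2 * r - 3) 0)" .
qed

context kernel_regression
begin

context
  fixes J :: "nat set" and s :: "nat \<Rightarrow> real" and \<phi> :: "nat \<Rightarrow> 'a \<Rightarrow> real"
  assumes spec: "spectral_system K \<rho>X J s \<phi>"
begin

text \<open>The eigenvalue equation holds only almost everywhere, and \<open>\<phi> i\<close> itself
  may fail to be the function of an element of the Hilbert space. Smoothing by the kernel produces
  such an element.\<close>

definition eigenvector :: "nat \<Rightarrow> 'h" where
  "eigenvector i = (LINT x|\<rho>X. \<phi> i x *\<^sub>R kx x)"

lemma phi_L2: "i \<in> J \<Longrightarrow> \<phi> i \<in> L2 \<rho>X" and s_pos: "i \<in> J \<Longrightarrow> 0 < s i"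
  and phi_eigen: "i \<in> J \<Longrightarrow> AE x in \<rho>X. integral_op K \<rho>X (\<phi> i) x = s i * \<phi> i x"
  and phi_orthonormal: "i \<in> J \<Longrightarrow> j \<in> J \<Longrightarrow> L2_inner \<rho>X (\<phi> i) (\<phi> j) = (if i = j then 1 else 0)"
  using spec by (auto simp: spectral_system_def)

lemma integrable_eigenvector:
  assumes "i \<in> J"
  shows "integrable \<rho>X (\<lambda>x. \<phi> i x *\<^sub>R kx x)"
proof -
  have [measurable]: "\<phi> i \<in> borel_measurable \<rho>X" using phi_L2[OF assms] by (simp add: L2_def)
  have "(\<lambda>_. 1) \<in> L2 \<rho>X" by (simp add: L2_def)
  from L2_mult_integrable[OF phi_L2[OF assms] this] have int: "integrable \<rho>X (\<phi> i)" by simp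
  show ?thesis
  proof (rule Bochner_Integration.integrable_bound)
    show "integrable \<rho>X (\<lambda>x. \<kappa> * \<phi> i x)" using int by simp
    have "norm (\<phi> i x *\<^sub>R kx x) \<le> norm (\<kappa> * \<phi> i x)" for x
      using mult_left_mono[OF norm_kx[of x], of "\<bar>\<phi> i x\<bar>"] kappa_nonneg by (simp add: abs_mult mult.commute)
    then show "AE x in \<rho>X. norm (\<phi> i x *\<^sub>R kx x) \<le> norm (\<kappa> * \<phi> i x)" by simp
  qed measurable
qed

lemma inner_eigenvector: "i \<in> J \<Longrightarrow> inner f (eigenvector i) = (LINT x|\<rho>X. \<phi> i x * emb f x)"
  unfolding eigenvector_def
  by (subst integral_inner_right[symmetric]) (simp_all add: integrable_eigenvector inner_kx)

lemma emb_eigenvector: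
  assumes "i \<in> J"
  shows "AE x in \<rho>X. emb (eigenvector i) x = s i * \<phi> i x"
proof -
  have "emb (eigenvector i) x = integral_op K \<rho>X (\<phi> i) x" for x
  proof -
    have "emb (eigenvector i) x = inner (kx x) (eigenvector i)"
      by (simp only: inner_commute[of "kx x"] inner_kx)
    also have "\<dots> = integral_op K \<rho>X (\<phi> i) x"
      by (simp add: inner_eigenvector[OF assms] emb_kx integral_op_def mult.commute)
    finally show ?thesis .
  qed
  then show ?thesis using phi_eigen[OF assms] by simp
qed

lemma T_eigenvector:
  assumes "i \<in> J"
  shows "T (eigenvector i) = s i *\<^sub>R eigenvector i"
proof -
  have [measurable]: "\<phi> i \<in> borel_measurable \<rho>X" using phi_L2[OF assms] by (simp add: L2_def)
  have "T (eigenvector i) = (LINT x|\<rho>X. s i *\<^sub>R (\<phi> i x *\<^sub>R kx x))"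
    unfolding T_eq
  proof (rule integral_cong_AE)
    show "AE x in \<rho>X. emb (eigenvector i) x *\<^sub>R kx x = s i *\<^sub>R (\<phi> i x *\<^sub>R kx x)"
      using emb_eigenvector[OF assms] by eventually_elim simp
  qed measurable
  then show ?thesis by (simp only: integral_scaleR_right eigenvector_def)
qed

lemma inner_eigenvectors:
  assumes "i \<in> J" "j \<in> J"
  shows "inner (eigenvector j) (eigenvector i) = (if i = j then s i else 0)"
proof -
  have [measurable]: "\<phi> i \<in> borel_measurable \<rho>X" "\<phi> j \<in> borel_measurable \<rho>X"
    using phi_L2 assms by (auto simp: L2_def)
  have "inner (eigenvector j) (eigenvector i) = (LINT x|\<rho>X. s j * (\<phi> i x * \<phi> j x))"
    unfolding inner_eigenvector[OF assms(1)]
  proof (rule integral_cong_AE)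
    show "AE x in \<rho>X. \<phi> i x * emb (eigenvector j) x = s j * (\<phi> i x * \<phi> j x)"
      using emb_eigenvector[OF assms(2)] by eventually_elim simp
  qed measurable
  also have "\<dots> = s j * L2_inner \<rho>X (\<phi> i) (\<phi> j)" by (simp add: L2_inner_def)
  finally show ?thesis using phi_orthonormal[OF assms] by simp
qed

lemma s_le: "i \<in> J \<Longrightarrow> s i \<le> \<kappa>\<^sup>2"
proof -
  assume i: "i \<in> J"
  let ?b = "eigenvector i"
  have "inner ?b (T ?b) \<le> \<kappa>\<^sup>2 * (norm ?b)\<^sup>2"
  proof -
    have "inner ?b (T ?b) = (LINT y|\<rho>. (inner (kf y) ?b)\<^sup>2)" by (simp add: inner_T power2_eq_square)
    also have "\<dots> \<le> (LINT y|\<rho>. \<kappa>\<^sup>2 * (norm ?b)\<^sup>2)"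
      by (intro integral_mono inner_kf_le) (auto intro!: bounded_measurable_integrable bm_intros kf_bm)
    finally show ?thesis by (simp add: prob_space)
  qed
  then have "s i * s i \<le> \<kappa>\<^sup>2 * s i"
    using i by (simp add: T_eigenvector inner_eigenvectors power2_norm_eq_inner)
  then show ?thesis using s_pos[OF i] by simp
qed

lemma inner_eigen_sum:
  assumes "finite F" "F \<subseteq> J"
  shows "inner (\<Sum>i\<in>F. x i *\<^sub>R eigenvector i) (\<Sum>i\<in>F. y i *\<^sub>R eigenvector i) = (\<Sum>i\<in>F. x i * y i * s i)"
proof -
  have "inner (\<Sum>i\<in>F. x i *\<^sub>R eigenvector i) (\<Sum>i\<in>F. y i *\<^sub>R eigenvector i)
      = (\<Sum>i\<in>F. \<Sum>j\<in>F. x i * y j * inner (eigenvector i) (eigenvector j))"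
    unfolding inner_sum_left by (simp add: inner_sum_right sum_distrib_left mult.assoc mult.left_commute)
  also have "\<dots> = (\<Sum>i\<in>F. \<Sum>j\<in>F. if i = j then x i * y i * s i else 0)"
    using assms by (intro sum.cong refl) (auto simp: inner_eigenvectors subset_iff)
  also have "\<dots> = (\<Sum>i\<in>F. x i * y i * s i)" using assms by simp
  finally show ?thesis .
qed

lemma norm_eigen_sum:
  assumes "finite F" "F \<subseteq> J"
  shows "(norm (\<Sum>i\<in>F. x i *\<^sub>R eigenvector i))\<^sup>2 = (\<Sum>i\<in>F. (x i)\<^sup>2 * s i)"
  by (simp add: power2_norm_eq_inner inner_eigen_sum[OF assms] power2_eq_square[of "x _"])

lemma pop_res_eigen_sum:
  assumes "finite F" "F \<subseteq> J" "0 < t" "0 \<le> n"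
  shows "pop_res \<rho> kf t n (\<Sum>i\<in>F. x i *\<^sub>R eigenvector i) = (\<Sum>i\<in>F. (x i / (t + n * s i)) *\<^sub>R eigenvector i)"
proof (rule pop_res_unique[OF assms(3,4)])
  interpret T: bounded_linear T by (rule bounded_linear_T)
  let ?y = "\<lambda>i. x i / (t + n * s i)"
  have "t *\<^sub>R (\<Sum>i\<in>F. ?y i *\<^sub>R eigenvector i) + n *\<^sub>R T (\<Sum>i\<in>F. ?y i *\<^sub>R eigenvector i)
      = (\<Sum>i\<in>F. (?y i * (t + n * s i)) *\<^sub>R eigenvector i)"
    using assms by (simp add: T.sum T.scaleR T_eigenvector subset_iff scaleR_sum_right sum.distrib[symmetric] add_divide_distrib algebra_simps)
  also have "\<dots> = (\<Sum>i\<in>F. x i *\<^sub>R eigenvector i)"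
  proof (rule sum.cong[OF refl])
    fix i assume "i \<in> F"
    then have "0 < s i" using assms s_pos by auto
    then have "0 < t + n * s i" using assms by (simp add: add_pos_nonneg)
    then show "(?y i * (t + n * s i)) *\<^sub>R eigenvector i = x i *\<^sub>R eigenvector i" by simp
  qed
  finally show "t *\<^sub>R (\<Sum>i\<in>F. ?y i *\<^sub>R eigenvector i) + n *\<^sub>R T (\<Sum>i\<in>F. ?y i *\<^sub>R eigenvector i)
      = (\<Sum>i\<in>F. x i *\<^sub>R eigenvector i)" .
qed

lemma emb_eigen_sum:
  assumes "finite F" "F \<subseteq> J"
  shows "AE x in \<rho>X. emb (\<Sum>i\<in>F. c i *\<^sub>R eigenvector i) x = (\<Sum>i\<in>F. c i * s i * \<phi> i x)"
proof -
  have "AE x in \<rho>X. \<forall>i\<in>F. emb (eigenvector i) x = s i * \<phi> i x"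
    using assms emb_eigenvector by (intro AE_finite_allI) auto
  then show ?thesis
    by eventually_elim (simp add: inner_kx[symmetric] inner_sum_left mult.assoc)
qed

end

text \<open>In \<open>H\<^sub>K\<close> the eigenfunction \<open>\<phi>\<^sub>i\<close> is represented by \<open>eigenvector i\<close>, the function
  \<open>L \<phi>\<^sub>i = s\<^sub>i \<phi>\<^sub>i\<close> (almost everywhere) of squared norm \<open>s\<^sub>i\<close>; hence the exponent \<open>r - 1\<close> in the
  coefficients of \<open>g\<close>.\<close>

lemma source_condition:
  assumes power: "is_integral_op_power K \<rho>X r u fstar" and r: "1 / 2 \<le> r" "r \<le> 2"
  obtains g :: 'h and V :: real where "0 \<le> V" "AE x in \<rho>X. fstar x = emb g x"
    "\<And>t n. 0 < t \<Longrightarrow> t \<le> n \<Longrightarrow>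
      t ^ 4 * inner (pop_res \<rho> kf t n g) (pop_res \<rho> kf t n (pop_res \<rho> kf t n g)) \<le> n * (t / n) powr (2 * r) * V"
    "\<And>t n. 0 < t \<Longrightarrow> t \<le> n \<Longrightarrow>
      n\<^sup>2 * (norm (pop_res \<rho> kf t n g))\<^sup>2 \<le> (1 + \<kappa>\<^sup>2) * (t / n) powr (min (2 * r - 3) 0) * V"
proof -
  obtain J s \<phi> where spec: "spectral_system K \<rho>X J s \<phi>" and lim:
      "(\<lambda>m. L2_norm_sq \<rho>X (\<lambda>x. fstar x - (\<Sum>i\<in>J \<inter> {..<m}. s i powr r * L2_inner \<rho>X u (\<phi> i) * \<phi> i x))) \<longlonglongrightarrow> 0"
    and u: "u \<in> L2 \<rho>X" and fstar: "fstar \<in> L2 \<rho>X"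
    using power by (auto simp: is_integral_op_power_def)
  note s_pos = s_pos[OF spec] and s_le = s_le[OF spec]
  define b where "b = eigenvector \<phi>"
  define c where "c i = L2_inner \<rho>X u (\<phi> i)" for i
  define x where "x i = s i powr (r - 1) * c i" for i
  define V where "V = (LINT x|\<rho>X. (u x)\<^sup>2)"
  define F where "F m = J \<inter> {..<m}" for m :: nat
  define X where "X m = (\<Sum>i\<in>F m. x i *\<^sub>R b i)" for m
  have F: "finite (F m)" "F m \<subseteq> J" for m by (auto simp: F_def)
  have V: "0 \<le> V" by (simp add: V_def)
  have bessel: "(\<Sum>i\<in>G. (c i)\<^sup>2) \<le> V" if "finite G" "G \<subseteq> J" for G
    unfolding c_def V_def
  proof (rule L2_bessel[OF that(1) u])
    show "\<phi> i \<in> L2 \<rho>X" if "i \<in> G" for i using phi_L2[OF spec] that \<open>G \<subseteq> J\<close> by blast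
    show "L2_inner \<rho>X (\<phi> i) (\<phi> j) = (if i = j then 1 else 0)" if "i \<in> G" "j \<in> G" for i j
      using that \<open>G \<subseteq> J\<close> by (intro phi_orthonormal[OF spec]) auto
  qed
  have xs: "(x i)\<^sup>2 * s i = s i powr (2 * r - 1) * (c i)\<^sup>2" if "i \<in> J" for i
  proof -
    have "(s i powr (r - 1))\<^sup>2 * s i = s i powr (r - 1) * s i powr (r - 1) * s i powr 1"
      using s_pos[OF that] by (simp add: power2_eq_square)
    also have "\<dots> = s i powr ((r - 1) + (r - 1) + 1)" by (simp only: powr_add)
    also have "(r - 1) + (r - 1) + 1 = 2 * r - 1" by simp
    finally show ?thesis by (simp add: x_def power_mult_distrib)
  qed
  \<comment> \<open>From \<open>s i \<le> \<kappa>\<^sup>2\<close> and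
    \<open>2 * r - 1 \<ge> 0\<close>: this is where \<open>r \<ge> 1/2\<close> puts the target into
    the Hilbert space.\<close>
  define M where "M = (\<kappa>\<^sup>2) powr (2 * r - 1)"
  define a where "a i = (if i \<in> J then (x i)\<^sup>2 * s i else 0)" for i
  have a_nonneg: "0 \<le> a i" for i using less_imp_le[OF s_pos] by (simp add: a_def)
  have a_sum: "sum a {m..<k} = (\<Sum>i\<in>J \<inter> {m..<k}. (x i)\<^sup>2 * s i)" for m k
    by (subst Int_commute) (simp add: a_def sum.inter_restrict)
  have "summable a"
  proof (rule bounded_imp_summable[OF a_nonneg])
    fix k
    have "sum a {..k} = sum a {0..<Suc k}" by (simp only: atLeast0LessThan lessThan_Suc_atMost)
    also have "\<dots> = (\<Sum>i\<in>J \<inter> {0..<Suc k}. (x i)\<^sup>2 * s i)" by (rule a_sum)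
    also have "\<dots> \<le> (\<Sum>i\<in>J \<inter> {0..<Suc k}. M * (c i)\<^sup>2)"
    proof (rule sum_mono)
      fix i assume "i \<in> J \<inter> {0..<Suc k}"
      then have i: "i \<in> J" by simp
      then show "(x i)\<^sup>2 * s i \<le> M * (c i)\<^sup>2"
        unfolding xs[OF i] M_def using s_pos[OF i] s_le[OF i] r
        by (intro mult_right_mono powr_mono2) auto
    qed
    also have "\<dots> = M * (\<Sum>i\<in>J \<inter> {0..<Suc k}. (c i)\<^sup>2)" by (simp add: sum_distrib_left)
    also have "\<dots> \<le> M * V" by (intro mult_left_mono bessel) (auto simp: M_def)
    finally show "sum a {..k} \<le> M * V" .
  qed
  \<comment> \<open>By orthogonality the squared norm of a block of this series is the same block of
    \<open>a\<close>, so the Cauchy criterion transfers.\<close>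
  define f where "f i = (if i \<in> J then x i *\<^sub>R b i else 0)" for i
  have f_sum: "sum f {m..<k} = (\<Sum>i\<in>J \<inter> {m..<k}. x i *\<^sub>R b i)" for m k
    by (subst Int_commute) (simp add: f_def sum.inter_restrict)
  have f_norm: "(norm (sum f {m..<k}))\<^sup>2 = sum a {m..<k}" for m k
    unfolding f_sum a_sum b_def by (rule norm_eigen_sum[OF spec]) auto
  have "summable f"
  proof (subst summable_Cauchy, intro allI impI)
    fix \<epsilon> :: real assume "0 < \<epsilon>"
    then have "0 < \<epsilon>\<^sup>2" by simp
    then obtain N where N: "\<And>m k. N \<le> m \<Longrightarrow> norm (sum a {m..<k}) < \<epsilon>\<^sup>2"
      using \<open>summable a\<close> unfolding summable_Cauchy by metis
    have "norm (sum f {m..<k}) < \<epsilon>" if "N \<le> m" for m k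
    proof (rule power2_less_imp_less)
      show "(norm (sum f {m..<k}))\<^sup>2 < \<epsilon>\<^sup>2" using N[OF that, of k] by (simp add: f_norm)
    qed (use \<open>0 < \<epsilon>\<close> in simp)
    then show "\<exists>N. \<forall>m\<ge>N. \<forall>k. norm (sum f {m..<k}) < \<epsilon>" by blast
  qed
  define g where "g = suminf f"
  have "X = (\<lambda>m. sum f {..<m})"
    using f_sum[of 0] by (simp add: fun_eq_iff X_def F_def atLeast0LessThan)
  then have X: "X \<longlonglongrightarrow> g" using summable_LIMSEQ[OF \<open>summable f\<close>] by (simp add: g_def)
  have emb_X: "AE y in \<rho>X. emb (X m) y = (\<Sum>i\<in>J \<inter> {..<m}. s i powr r * L2_inner \<rho>X u (\<phi> i) * \<phi> i y)" for m
  proof -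
    have "AE y in \<rho>X. emb (X m) y = (\<Sum>i\<in>F m. x i * s i * \<phi> i y)"
      unfolding X_def b_def by (rule emb_eigen_sum[OF spec F])
    moreover have "(\<Sum>i\<in>F m. x i * s i * \<phi> i y) = (\<Sum>i\<in>J \<inter> {..<m}. s i powr r * L2_inner \<rho>X u (\<phi> i) * \<phi> i y)" for y
      unfolding F_def
    proof (rule sum.cong[OF refl])
      fix i assume "i \<in> J \<inter> {..<m}"
      then have "0 < s i" using s_pos by auto
      then have "s i powr (r - 1) * s i = s i powr (r - 1) * s i powr 1" by simp
      also have "\<dots> = s i powr (r - 1 + 1)" by (simp only: powr_add)
      finally have "s i powr (r - 1) * s i * c i = s i powr r * c i" by simp
      then have "x i * s i = s i powr r * c i" by (simp only: x_def mult.assoc mult.commute[of "c i"])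
      then show "x i * s i * \<phi> i y = s i powr r * L2_inner \<rho>X u (\<phi> i) * \<phi> i y" by (simp add: c_def)
    qed
    ultimately show ?thesis by simp
  qed
  \<comment> \<open>The embedding into the square integrable functions is bounded by
    \<open>\<kappa>\<close>, so the partial sums converge there both to \<open>fstar\<close> and to
    the function of g.\<close>
  have ae: "AE y in \<rho>X. fstar y = emb g y"
  proof -
    have [measurable]: "fstar \<in> borel_measurable \<rho>X" using fstar by (simp add: L2_def)
    let ?L = "\<lambda>m. L2_norm_sq \<rho>X (\<lambda>x. fstar x - (\<Sum>i\<in>J \<inter> {..<m}. s i powr r * L2_inner \<rho>X u (\<phi> i) * \<phi> i x))"
    have bound: "L2_norm_sq \<rho>X (\<lambda>y. fstar y - emb g y) \<le> 2 * ?L m + 2 * ennreal (\<kappa>\<^sup>2 * (norm (X m - g))\<^sup>2)" for m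
    proof -
      have "L2_norm_sq \<rho>X (\<lambda>y. fstar y - emb g y)
          = (\<integral>\<^sup>+y. ennreal (((fstar y - emb (X m) y) + (emb (X m) y - emb g y))\<^sup>2) \<partial>\<rho>X)"
        by (simp add: L2_norm_sq_def)
      also have "\<dots> \<le> 2 * (\<integral>\<^sup>+y. ennreal ((fstar y - emb (X m) y)\<^sup>2) \<partial>\<rho>X)
          + 2 * (\<integral>\<^sup>+y. ennreal ((emb (X m) y - emb g y)\<^sup>2) \<partial>\<rho>X)"
        by (rule nn_integral_square_add_le) measurable
      also have "(\<integral>\<^sup>+y. ennreal ((fstar y - emb (X m) y)\<^sup>2) \<partial>\<rho>X) = ?L m"
        unfolding L2_norm_sq_def
      proof (rule nn_integral_cong_AE)
        show "AE y in \<rho>X. ennreal ((fstar y - emb (X m) y)\<^sup>2)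
          = ennreal ((fstar y - (\<Sum>i\<in>J \<inter> {..<m}. s i powr r * L2_inner \<rho>X u (\<phi> i) * \<phi> i y))\<^sup>2)"
          using emb_X[of m] by eventually_elim simp
      qed
      also have "(\<integral>\<^sup>+y. ennreal ((emb (X m) y - emb g y)\<^sup>2) \<partial>\<rho>X) \<le> (\<integral>\<^sup>+y. ennreal (\<kappa>\<^sup>2 * (norm (X m - g))\<^sup>2) \<partial>\<rho>X)"
      proof (intro nn_integral_mono ennreal_leI)
        fix y
        \<comment> \<open>\<open>kf\<close> reads only the input; the response 0 is a dummy.\<close>
        have "emb (X m) y - emb g y = inner (kf (y, 0)) (X m - g)"
          by (simp add: inner_diff_right inner_commute[of "kx y"] inner_kx)
        then show "(emb (X m) y - emb g y)\<^sup>2 \<le> \<kappa>\<^sup>2 * (norm (X m - g))\<^sup>2"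
          using inner_kf_le[of "(y, 0)" "X m - g"] by simp
      qed
      also have "\<dots> = ennreal (\<kappa>\<^sup>2 * (norm (X m - g))\<^sup>2)" by (simp add: X.emeasure_space_1[unfolded space_\<rho>X])
      finally show ?thesis by (simp add: add_left_mono mult_left_mono)
    qed
    have "(\<lambda>m. 2 * ?L m + 2 * ennreal (\<kappa>\<^sup>2 * (norm (X m - g))\<^sup>2)) \<longlonglongrightarrow> 2 * 0 + 2 * ennreal (\<kappa>\<^sup>2 * (norm (g - g))\<^sup>2)"
      by (intro tendsto_add tendsto_mult_ennreal tendsto_const lim tendsto_ennrealI tendsto_mult
          tendsto_power tendsto_norm tendsto_diff X) auto
    then have "(\<lambda>m. 2 * ?L m + 2 * ennreal (\<kappa>\<^sup>2 * (norm (X m - g))\<^sup>2)) \<longlonglongrightarrow> 0" by simp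
    then have "L2_norm_sq \<rho>X (\<lambda>y. fstar y - emb g y) \<le> 0"
      using bound by (intro LIMSEQ_le_const) auto
    then have "(\<integral>\<^sup>+y. ennreal ((fstar y - emb g y)\<^sup>2) \<partial>\<rho>X) = 0" by (simp add: L2_norm_sq_def)
    then have "AE y in \<rho>X. ennreal ((fstar y - emb g y)\<^sup>2) = 0"
      by (subst (asm) nn_integral_0_iff_AE) measurable
    then show ?thesis by eventually_elim simp
  qed
  \<comment> \<open>Both estimates hold coefficientwise for the finite sums \<open>X m\<close>,
    uniformly in m by Bessel, and pass to g because the population resolvent is continuous.\<close>
  have bounds: "t ^ 4 * inner (pop_res \<rho> kf t n g) (pop_res \<rho> kf t n (pop_res \<rho> kf t n g)) \<le> n * (t / n) powr (2 * r) * V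
      \<and> n\<^sup>2 * (norm (pop_res \<rho> kf t n g))\<^sup>2 \<le> (1 + \<kappa>\<^sup>2) * (t / n) powr (min (2 * r - 3) 0) * V"
    if tn: "0 < t" "t \<le> n" for t n
  proof -
    let ?R = "pop_res \<rho> kf t n"
    let ?\<mu> = "t / n"
    have n: "0 < n" using tn by simp
    have \<mu>: "0 < ?\<mu>" "?\<mu> \<le> 1" using tn by auto
    interpret R: bounded_linear ?R using tn by (intro bounded_linear_pop_res) auto
    have RX: "(\<lambda>m. ?R (X m)) \<longlonglongrightarrow> ?R g" by (rule R.tendsto[OF X])
    have RRX: "(\<lambda>m. ?R (?R (X m))) \<longlonglongrightarrow> ?R (?R g)" by (rule R.tendsto[OF RX])
    have R1: "?R (X m) = (\<Sum>i\<in>F m. (x i / (t + n * s i)) *\<^sub>R b i)" for m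
      unfolding X_def b_def using tn by (intro pop_res_eigen_sum[OF spec F]) auto
    have R2: "?R (?R (X m)) = (\<Sum>i\<in>F m. (x i / (t + n * s i) / (t + n * s i)) *\<^sub>R b i)" for m
      unfolding R1 unfolding b_def using tn by (intro pop_res_eigen_sum[OF spec F]) auto
    have tns: "t + n * s i = n * (?\<mu> + s i)" for i using n by (simp add: field_simps)
    have sJ: "0 < s i" "s i \<le> \<kappa>\<^sup>2" if "i \<in> F m" for i m
      using that s_pos s_le F by blast+
    have A: "t ^ 4 * inner (?R (X m)) (?R (?R (X m))) \<le> n * ?\<mu> powr (2 * r) * V" for m
    proof -
      have "t ^ 4 * inner (?R (X m)) (?R (?R (X m)))
          = (\<Sum>i\<in>F m. t ^ 4 * (x i / (t + n * s i) * (x i / (t + n * s i) / (t + n * s i)) * s i))"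
        unfolding R2 unfolding R1 unfolding b_def by (subst inner_eigen_sum[OF spec F]) (simp add: sum_distrib_left)
      also have "\<dots> \<le> (\<Sum>i\<in>F m. n * ?\<mu> powr (2 * r) * (c i)\<^sup>2)"
      proof (rule sum_mono)
        fix i assume i: "i \<in> F m"
        then have iJ: "i \<in> J" using F by auto
        have p: "0 < ?\<mu> + s i" using \<mu> sJ[OF i] by simp
        have "t ^ 4 * (x i / (t + n * s i) * (x i / (t + n * s i) / (t + n * s i)) * s i)
            = t ^ 4 / n ^ 3 * ((x i)\<^sup>2 * s i / (?\<mu> + s i) ^ 3)"
          unfolding tns using n p by (simp add: power2_eq_square power3_eq_cube)
        also have "t ^ 4 / n ^ 3 = n * ?\<mu> ^ 4" using n by (simp add: power_divide power4_eq_xxxx power3_eq_cube)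
        also have "n * ?\<mu> ^ 4 * ((x i)\<^sup>2 * s i / (?\<mu> + s i) ^ 3)
            = n * (?\<mu> ^ 4 * (s i powr (2 * r - 1) / (?\<mu> + s i) ^ 3)) * (c i)\<^sup>2"
          unfolding xs[OF iJ] by simp
        also have "\<dots> \<le> n * ?\<mu> powr (2 * r) * (c i)\<^sup>2"
          using n by (intro mult_right_mono mult_left_mono tikhonov_filter_bounds(1)[OF sJ[OF i] \<mu> r]) auto
        finally show "t ^ 4 * (x i / (t + n * s i) * (x i / (t + n * s i) / (t + n * s i)) * s i)
            \<le> n * ?\<mu> powr (2 * r) * (c i)\<^sup>2" .
      qed
      also have "\<dots> = n * ?\<mu> powr (2 * r) * (\<Sum>i\<in>F m. (c i)\<^sup>2)" by (simp add: sum_distrib_left)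
      also have "\<dots> \<le> n * ?\<mu> powr (2 * r) * V" using n by (intro mult_left_mono bessel F) auto
      finally show ?thesis .
    qed
    have B: "n\<^sup>2 * (norm (?R (X m)))\<^sup>2 \<le> (1 + \<kappa>\<^sup>2) * ?\<mu> powr (min (2 * r - 3) 0) * V" for m
    proof -
      have "n\<^sup>2 * (norm (?R (X m)))\<^sup>2 = (\<Sum>i\<in>F m. n\<^sup>2 * ((x i / (t + n * s i))\<^sup>2 * s i))"
        unfolding R1 unfolding b_def by (subst norm_eigen_sum[OF spec F]) (simp add: sum_distrib_left)
      also have "\<dots> \<le> (\<Sum>i\<in>F m. (1 + \<kappa>\<^sup>2) * ?\<mu> powr (min (2 * r - 3) 0) * (c i)\<^sup>2)"
      proof (rule sum_mono)
        fix i assume i: "i \<in> F m"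
        then have iJ: "i \<in> J" using F by auto
        have p: "0 < ?\<mu> + s i" using \<mu> sJ[OF i] by simp
        have "n\<^sup>2 * ((x i / (t + n * s i))\<^sup>2 * s i) = (x i)\<^sup>2 * s i / (?\<mu> + s i)\<^sup>2"
          unfolding tns using n p by (simp add: power_divide power_mult_distrib)
        also have "\<dots> = s i powr (2 * r - 1) / (?\<mu> + s i)\<^sup>2 * (c i)\<^sup>2"
          unfolding xs[OF iJ] by simp
        also have "\<dots> \<le> (1 + \<kappa>\<^sup>2) * ?\<mu> powr (min (2 * r - 3) 0) * (c i)\<^sup>2"
          by (intro mult_right_mono tikhonov_filter_bounds(2)[OF sJ[OF i] \<mu> r]) auto
        finally show "n\<^sup>2 * ((x i / (t + n * s i))\<^sup>2 * s i) \<le> (1 + \<kappa>\<^sup>2) * ?\<mu> powr (min (2 * r - 3) 0) * (c i)\<^sup>2" .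
      qed
      also have "\<dots> = (1 + \<kappa>\<^sup>2) * ?\<mu> powr (min (2 * r - 3) 0) * (\<Sum>i\<in>F m. (c i)\<^sup>2)" by (simp add: sum_distrib_left)
      also have "\<dots> \<le> (1 + \<kappa>\<^sup>2) * ?\<mu> powr (min (2 * r - 3) 0) * V" by (intro mult_left_mono bessel F) auto
      finally show ?thesis .
    qed
    have "(\<lambda>m. t ^ 4 * inner (?R (X m)) (?R (?R (X m)))) \<longlonglongrightarrow> t ^ 4 * inner (?R g) (?R (?R g))"
      by (intro tendsto_intros RX RRX)
    moreover have "(\<lambda>m. n\<^sup>2 * (norm (?R (X m)))\<^sup>2) \<longlonglongrightarrow> n\<^sup>2 * (norm (?R g))\<^sup>2"
      by (intro tendsto_intros RX)
    ultimately show ?thesis using A B by (blast intro: LIMSEQ_le_const2)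
  qed
  show ?thesis by (rule that[OF V ae conjunct1[OF bounds] conjunct2[OF bounds]])
qed

end

section \<open>From the estimator to the block errors\<close>

lemma block_error_cong:
  "(\<And>i. i \<in> B \<Longrightarrow> k i = k' i) \<Longrightarrow> (\<And>i. i \<in> B \<Longrightarrow> e i = e' i) \<Longrightarrow>
    block_error k e t B g = block_error k' e' t B g"
  by (simp add: block_error_def cong: res_cong)

context kernel_regression
begin

text \<open>The normalised operator is 1 / n times \<open>reg\<close>, so its inverse is the
  resolvent applied to n h. This n cancels the 1 / n in front of the data, and in the correction
  step it turns \<open>lam\<close> into t.\<close>

lemma bcrkn_eq:
  assumes "0 < card B" "0 < lam"
  defines "t \<equiv> real (card B) * lam" and "G \<equiv> \<lambda>z. res (\<lambda>i. kf (z i)) (real (card B) * lam) B"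
  shows "bcrkn K emb lam B z = G z (\<Sum>i\<in>B. snd (z i) *\<^sub>R kf (z i)) + t *\<^sub>R G z (G z (\<Sum>i\<in>B. snd (z i) *\<^sub>R kf (z i)))"
proof -
  define n where "n = real (card B)"
  have n: "0 < n" and t: "0 < n * lam" using assms by (auto simp: n_def)
  let ?A = "reg (\<lambda>i. kf (z i)) (n * lam) B"
  have A: "lam *\<^sub>R f + empirical_op K emb B z f = (1 / n) *\<^sub>R ?A f" for f
    using n by (simp add: empirical_op_def sampling_adj_def sampling_op_def reg_def n_def[symmetric]
        inner_commute[of _ f] inner_kx scaleR_add_right)
  have r: "empirical_resolvent K emb lam B z h = G z (n *\<^sub>R h)" for h
    unfolding empirical_resolvent_def
  proof (rule inv_f_eq)
    show "inj (\<lambda>f. lam *\<^sub>R f + empirical_op K emb B z f)"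
    proof (rule injI)
      fix f g assume "lam *\<^sub>R f + empirical_op K emb B z f = lam *\<^sub>R g + empirical_op K emb B z g"
      then have "?A f = ?A g" unfolding A using n by simp
      then show "f = g" using res_reg[OF t] by metis
    qed
    have "?A (G z (n *\<^sub>R h)) = n *\<^sub>R h" unfolding G_def n_def[symmetric] by (rule reg_res[OF t])
    then show "lam *\<^sub>R G z (n *\<^sub>R h) + empirical_op K emb B z (G z (n *\<^sub>R h)) = h"
      unfolding A using n by simp
  qed
  have lin: "G z (c *\<^sub>R h) = c *\<^sub>R G z h" for c h
    unfolding G_def n_def[symmetric] by (rule res_scaleR[OF t])
  show ?thesis
    using n by (simp add: bcrkn_def rkn_def r sampling_adj_def n_def[symmetric] t_def lin mult.commute)
qed

lemma distributed_bcrkn_error: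
  assumes part: "partition_on {..<N} \<P>" and N: "1 \<le> N" and lam: "0 < lam"
    and card: "\<And>B. B \<in> \<P> \<Longrightarrow> real (card B) = n"
  shows "distributed_bcrkn K emb lam \<P> z - g = (\<Sum>B\<in>\<P>. (1 / real (card \<P>)) *\<^sub>R
    block_error (\<lambda>i. kf (z i)) (\<lambda>i. snd (z i) - emb g (fst (z i))) (n * lam) B g)"
    and "real (card \<P>) * n = real N"
proof -
  have un: "\<Union>\<P> = {..<N}" using part by (auto simp: partition_on_def)
  have finP: "finite \<P>" using part by (metis finite_elements finite_lessThan)
  have ne: "\<P> \<noteq> {}" using un N by (metis Union_empty lessThan_empty_iff not_one_le_zero)
  have sub: "B \<subseteq> {..<N}" if "B \<in> \<P>" for B using un that by auto
  have finB: "finite B" if "B \<in> \<P>" for B using sub[OF that] finite_subset by blast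
  have neB: "B \<noteq> {}" if "B \<in> \<P>" for B using part that by (auto simp: partition_on_def)
  have "card (\<Union>\<P>) = (\<Sum>B\<in>\<P>. card B)"
    using part finB by (intro card_Union_disjoint) (auto simp: partition_on_def)
  then have "real N = (\<Sum>B\<in>\<P>. real (card B))" by (simp add: un)
  then show mn: "real (card \<P>) * n = real N" using card by simp
  have m: "0 < real (card \<P>)" using finP ne by (simp add: card_gt_0_iff)
  have w: "real (card B) / real (card (\<Union>\<P>)) = 1 / real (card \<P>)" if "B \<in> \<P>" for B
    using mn N m by (simp add: un card[OF that] field_simps)
  have b: "bcrkn K emb lam B z = block_error (\<lambda>i. kf (z i)) (\<lambda>i. snd (z i) - emb g (fst (z i))) (n * lam) B g + g"
    if B: "B \<in> \<P>" for B
  proof -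
    have c: "0 < card B" using finB[OF B] neB[OF B] by (simp add: card_gt_0_iff)
    then have "0 < n * lam" using card[OF B] lam by simp
    then have "bcrkn K emb lam B z - g = block_error (\<lambda>i. kf (z i)) (\<lambda>i. snd (z i) - emb g (fst (z i))) (n * lam) B g"
      unfolding bcrkn_eq[OF c lam] card[OF B]
      by (rule block_error_eq) (simp add: inner_commute[of _ g] inner_kx)
    then show ?thesis by (simp only: diff_eq_eq)
  qed
  have "distributed_bcrkn K emb lam \<P> z = (\<Sum>B\<in>\<P>. (1 / real (card \<P>)) *\<^sub>R
    (block_error (\<lambda>i. kf (z i)) (\<lambda>i. snd (z i) - emb g (fst (z i))) (n * lam) B g + g))"
    unfolding distributed_bcrkn_def by (intro sum.cong refl) (simp only: w b)
  also have "\<dots> = (\<Sum>B\<in>\<P>. (1 / real (card \<P>)) *\<^sub>R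
    block_error (\<lambda>i. kf (z i)) (\<lambda>i. snd (z i) - emb g (fst (z i))) (n * lam) B g) + g"
    using m by (simp add: scaleR_add_right sum.distrib sum_constant_scaleR)
  finally show "distributed_bcrkn K emb lam \<P> z - g = (\<Sum>B\<in>\<P>. (1 / real (card \<P>)) *\<^sub>R
    block_error (\<lambda>i. kf (z i)) (\<lambda>i. snd (z i) - emb g (fst (z i))) (n * lam) B g)" by simp
qed

text \<open>The squared distance in the marginal is an integral over one more independent
  observation. Given the index N, it becomes a further coordinate of the product space, and
  \<open>aggregated_error\<close> applies with j = N.\<close>

lemma expected_risk_le:
  fixes g :: 'h and \<sigma> :: real
  assumes model: "regression_model \<rho> fstar \<sigma>" and fg: "AE x in \<rho>X. fstar x = emb g x"
    and part: "partition_on {..<N} \<P>" and N: "1 \<le> N" and lam: "0 < lam"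
    and card: "\<And>B. B \<in> \<P> \<Longrightarrow> real (card B) = k"
    and t_def: "t = k * lam" and n_def: "n = k + 1"
    and t: "1 \<le> t" "t \<le> n" and D: "0 \<le> D" "effective_dim K emb \<rho>X (t / n) \<le> ennreal D"
  shows "(\<integral>\<^sup>+z. L2_norm_sq \<rho>X (\<lambda>x. emb (distributed_bcrkn K emb lam \<P> z) x - fstar x) \<partial>(Pi\<^sub>M {..<N} (\<lambda>_. \<rho>)))
    \<le> ennreal (2 * (bias_const \<kappa> / n * (t ^ 4 * inner (pop_res \<rho> kf t n g) (pop_res \<rho> kf t n (pop_res \<rho> kf t n g))
          + t\<^sup>2 * D * (norm (pop_res \<rho> kf t n g))\<^sup>2)) + 8 * \<sigma>\<^sup>2 * (1 + \<kappa>\<^sup>2) * D / (real (card \<P>) * n))"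
    (is "_ \<le> ennreal ?bound")
proof -
  let ?e = "\<lambda>y. snd y - emb g (fst y)"
  let ?err = "\<lambda>z. \<Sum>B\<in>\<P>. (1 / real (card \<P>)) *\<^sub>R block_error (\<lambda>i. kf (z i)) (\<lambda>i. ?e (z i)) t B g"
  let ?h = "\<lambda>z. ennreal ((inner (kf (z N)) (?err z))\<^sup>2)"
  interpret noisy_design \<rho> kf \<kappa> "insert N {..<N}" ?e \<sigma>
    by (rule noise_conditions[OF model fg]) simp
  have part': "partition_on (insert N {..<N} - {N}) \<P>" using part by simp
  have ne: "\<P> \<noteq> {}"
    using partition_onD1[OF part] N by (metis Union_empty lessThan_empty_iff not_one_le_zero)
  have sub: "B \<subseteq> {..<N}" if "B \<in> \<P>" for B using part that by (auto simp: partition_on_def)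
  have pos: "0 < t" "0 < n" using t by auto
  note agg = aggregated_error[OF insertI1 part' ne _ t trace_bound[OF pos D], of g]
  have card': "n = real (card B) + 1" if "B \<in> \<P>" for B using card[OF that] by (simp add: n_def)
  have int: "integrable P (\<lambda>z. (inner (kf (z N)) (?err z))\<^sup>2)"
    and le: "(LINT z|P. (inner (kf (z N)) (?err z))\<^sup>2) \<le> ?bound"
    using agg card' by blast+
  have "L2_norm_sq \<rho>X (\<lambda>x. emb (distributed_bcrkn K emb lam \<P> z) x - fstar x) = (\<integral>\<^sup>+y. ?h (z(N := y)) \<partial>\<rho>)" for z
  proof -
    let ?f = "distributed_bcrkn K emb lam \<P> z"
    have err: "?f - g = ?err z"
      unfolding t_def by (rule distributed_bcrkn_error(1)[OF part N lam card])
    \<comment> \<open>No block contains N, so the error vector ignores the test point.\<close>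
    have upd: "?err (z(N := y)) = ?err z" for y :: "'a \<times> real"
      using sub by (intro sum.cong refl arg_cong[where f = "scaleR _"] block_error_cong) fastforce+
    have "L2_norm_sq \<rho>X (\<lambda>x. emb ?f x - fstar x) = (\<integral>\<^sup>+x. ennreal ((emb ?f x - emb g x)\<^sup>2) \<partial>\<rho>X)"
      unfolding L2_norm_sq_def by (intro nn_integral_cong_AE) (use fg in \<open>eventually_elim, simp\<close>)
    also have "\<dots> = (\<integral>\<^sup>+y. ennreal ((emb ?f (fst y) - emb g (fst y))\<^sup>2) \<partial>\<rho>)"
      unfolding \<rho>X_def by (rule nn_integral_distr) measurable
    also have "\<dots> = (\<integral>\<^sup>+y. ?h (z(N := y)) \<partial>\<rho>)"
    proof (rule nn_integral_cong)
      fix y :: "'a \<times> real"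
      have "emb ?f (fst y) - emb g (fst y) = inner (kf y) (?f - g)"
        by (simp add: inner_diff_right inner_commute[of "kf y"] inner_kx)
      then show "ennreal ((emb ?f (fst y) - emb g (fst y))\<^sup>2) = ?h (z(N := y))"
        unfolding upd err by simp
    qed
    finally show ?thesis .
  qed
  then have "(\<integral>\<^sup>+z. L2_norm_sq \<rho>X (\<lambda>x. emb (distributed_bcrkn K emb lam \<P> z) x - fstar x) \<partial>(Pi\<^sub>M {..<N} (\<lambda>_. \<rho>)))
      = (\<integral>\<^sup>+z. \<integral>\<^sup>+y. ?h (z(N := y)) \<partial>\<rho> \<partial>(Pi\<^sub>M {..<N} (\<lambda>_. \<rho>)))" by simp
  also have "\<dots> = (\<integral>\<^sup>+z. ?h z \<partial>P)"
  proof (rule PS.product_nn_integral_insert[symmetric])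
    show "?h \<in> borel_measurable P"
      using borel_measurable_integrable[OF int] by (rule measurable_compose) simp
  qed auto
  also have "\<dots> = ennreal (LINT z|P. (inner (kf (z N)) (?err z))\<^sup>2)"
    by (rule nn_integral_eq_integral[OF int]) simp
  also have "\<dots> \<le> ennreal ?bound" by (rule ennreal_leI[OF le])
  finally show ?thesis .
qed

end

section \<open>The rate\<close>

text \<open>Everything is expressed by powers of \<open>lam\<close>. The limit on m says that m is
  at most \<open>lam\<close> to the power - min 2 (2 r - 1), which bounds the block size k from
  below. That exponent of k is at least 1 in absolute value, hence
  \<open>1 \<le> k * lam\<close>.\<close>

lemma sample_size_arith:
  fixes r \<beta> N m k lam :: real
  assumes r: "1 / 2 \<le> r" "r \<le> 2" and \<beta>: "0 < \<beta>" and N: "1 \<le> N"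
    and m: "1 \<le> m" "m \<le> N powr min (2 / (2 * r + \<beta>)) ((2 * r - 1) / (2 * r + \<beta>))" and mk: "m * k = N"
    and lam: "lam = N powr (- 1 / (2 * r + \<beta>))"
  shows "0 < lam" "lam \<le> 1" "N = lam powr - (2 * r + \<beta>)"
    "lam powr - (max (2 * r - 2) 1 + \<beta>) \<le> k" "1 \<le> k * lam" "k * lam \<le> k + 1"
    "lam / 2 \<le> k * lam / (k + 1)" "k * lam / (k + 1) \<le> lam" "1 \<le> k"
proof -
  let ?d = "2 * r + \<beta>"
  have d: "0 < ?d" using r \<beta> by simp
  show lam0: "0 < lam" using N by (simp add: lam)
  show lam1: "lam \<le> 1" unfolding lam using powr_mono[of "- 1 / ?d" 0 N] N d by simp
  have "lam powr - ?d = N powr ((- 1 / ?d) * - ?d)" unfolding lam by (rule powr_powr)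
  moreover have "(- 1 / x) * - x = 1" if "0 < x" for x :: real using that by simp
  from this[OF d] have "(- 1 / ?d) * - ?d = 1" .
  ultimately show NL: "N = lam powr - ?d" using N by (simp only: powr_one)
  have "m \<le> lam powr - (min 2 (2 * r - 1))"
  proof -
    have "min (2 / ?d) ((2 * r - 1) / ?d) = min 2 (2 * r - 1) / ?d"
      using d by (simp add: min_def divide_right_mono divide_le_cancel)
    then have "N powr min (2 / ?d) ((2 * r - 1) / ?d) = lam powr - (min 2 (2 * r - 1))"
    proof -
      have x: "- x * (M / x) = - M" if "0 < x" for x M :: real using that by simp
      have "N powr (min 2 (2 * r - 1) / ?d) = lam powr (- ?d * (min 2 (2 * r - 1) / ?d))"
        by (subst NL) (rule powr_powr)
      then show ?thesis
        by (simp only: x[OF d] \<open>min (2 / ?d) ((2 * r - 1) / ?d) = min 2 (2 * r - 1) / ?d\<close>)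
    qed
    then show ?thesis using m(2) by simp
  qed
  moreover have k: "k = N / m" using mk m by (simp add: field_simps)
  moreover have "N / m \<ge> N / lam powr - (min 2 (2 * r - 1))"
    using \<open>m \<le> lam powr _\<close> m N lam0 by (intro divide_left_mono mult_pos_pos) auto
  moreover have "N / lam powr - (min 2 (2 * r - 1)) = lam powr - (max (2 * r - 2) 1 + \<beta>)"
  proof -
    have "N / lam powr - (min 2 (2 * r - 1)) = lam powr (- ?d - - (min 2 (2 * r - 1)))"
      unfolding NL by (rule powr_diff[symmetric])
    also have "- ?d - - (min 2 (2 * r - 1)) = - (max (2 * r - 2) 1 + \<beta>)"
      by (simp add: min_def max_def)
    finally show ?thesis .
  qed
  ultimately show k_ge: "lam powr - (max (2 * r - 2) 1 + \<beta>) \<le> k" by simp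
  have "lam powr - 1 \<le> lam powr - (max (2 * r - 2) 1 + \<beta>)"
    using lam0 lam1 \<beta> by (intro powr_mono') auto
  then have "1 / lam \<le> k" using k_ge lam0 by (simp add: powr_minus_divide)
  then show "1 \<le> k * lam" using lam0 by (simp add: field_simps)
  have k0: "0 < k" using k N m by simp
  show "1 \<le> k" using \<open>1 \<le> k * lam\<close> mult_left_mono[OF lam1, of k] k0 by linarith
  then have "k * lam \<le> k" using lam1 mult_left_mono[OF lam1, of k] by simp
  then show "k * lam \<le> k + 1" by simp
  show "k * lam / (k + 1) \<le> lam" using k0 lam0 by (simp add: field_simps)
  have "lam * (k + 1) \<le> lam * (2 * k)" using \<open>1 \<le> k\<close> lam0 by (intro mult_left_mono) auto
  then show "lam / 2 \<le> k * lam / (k + 1)" using k0 by (simp add: field_simps)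
qed

text \<open>t / n lies between lam / 2 and lam, and \<open>\<beta> \<le> 1\<close> limits the loss
  in D to a factor 2. In the fluctuation term the exponents max (2 r - 2) 1, 2 and min (2 r - 3) 0
  add up to 2 r on both sides of r = 3/2. The noise term needs only m n \<ge> N.\<close>

lemma rate_bound:
  fixes r \<beta> N m k lam bc V C0 \<kappa> \<sigma> a b :: real
  assumes r: "1 / 2 \<le> r" "r \<le> 2" and \<beta>: "0 < \<beta>" "\<beta> \<le> 1" and N: "1 \<le> N"
    and m: "1 \<le> m" "m \<le> N powr min (2 / (2 * r + \<beta>)) ((2 * r - 1) / (2 * r + \<beta>))" and mk: "m * k = N"
    and lam: "lam = N powr (- 1 / (2 * r + \<beta>))" and t: "t = k * lam" and n: "n = k + 1"
    and D: "D = C0 * (t / n) powr - \<beta>"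
    and nonneg: "0 \<le> bc" "0 \<le> V" "0 < C0" "0 \<le> b"
    and a: "t ^ 4 * a \<le> n * (t / n) powr (2 * r) * V"
    and b: "n\<^sup>2 * b \<le> (1 + \<kappa>\<^sup>2) * (t / n) powr (min (2 * r - 3) 0) * V"
  shows "2 * (bc / n * (t ^ 4 * a + t\<^sup>2 * D * b)) + 8 * \<sigma>\<^sup>2 * (1 + \<kappa>\<^sup>2) * D / (m * n)
    \<le> (2 * bc * V * (1 + 2 * C0 * (1 + \<kappa>\<^sup>2)) + 16 * \<sigma>\<^sup>2 * (1 + \<kappa>\<^sup>2) * C0) * N powr (- (2 * r) / (2 * r + \<beta>))"
proof -
  note ar = sample_size_arith[OF r \<beta>(1) N m mk lam]
  define \<mu> where "\<mu> = t / n"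
  let ?M = "max (2 * r - 2) 1"
  let ?L = "lam powr (2 * r)"
  have n0: "0 < n" "k \<le> n" "0 < k" using ar(9) by (auto simp: n)
  have \<mu>: "0 < \<mu>" "lam / 2 \<le> \<mu>" "\<mu> \<le> lam" using ar n0 by (auto simp: \<mu>_def t n)
  have L: "N powr (- (2 * r) / (2 * r + \<beta>)) = ?L"
  proof -
    have "N powr (- (2 * r) / (2 * r + \<beta>)) = lam powr (- (2 * r + \<beta>) * (- (2 * r) / (2 * r + \<beta>)))"
      by (subst ar(3)) (rule powr_powr)
    also have "- (2 * r + \<beta>) * (- (2 * r) / (2 * r + \<beta>)) = 2 * r"
      using r \<beta> by (simp add: field_simps)
    finally show ?thesis .
  qed
  have D0: "0 \<le> D" using nonneg by (simp add: D)
  have D_le: "D \<le> 2 * C0 * lam powr - \<beta>"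
  proof -
    have "\<mu> powr - \<beta> \<le> (lam / 2) powr - \<beta>" using \<mu> ar(1) \<beta> by (intro powr_mono2') auto
    also have "\<dots> = lam powr - \<beta> * 2 powr \<beta>" using ar(1) by (simp add: powr_divide powr_minus_divide)
    also have "\<dots> \<le> lam powr - \<beta> * 2" using \<beta> powr_mono[of \<beta> 1 2] by (intro mult_left_mono) auto
    finally have "C0 * \<mu> powr - \<beta> \<le> C0 * (lam powr - \<beta> * 2)" using nonneg by (intro mult_left_mono) auto
    then show ?thesis by (simp add: D \<mu>_def mult_ac)
  qed
  have Dn: "D / n \<le> 2 * C0 * lam powr ?M"
  proof -
    have "D / n \<le> 2 * C0 * lam powr - \<beta> / lam powr - (?M + \<beta>)"
      using D_le D0 ar(1,4) n0 by (intro frac_le) auto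
    also have "\<dots> = 2 * C0 * lam powr (- \<beta> - - (?M + \<beta>))" by (simp only: powr_diff times_divide_eq_right)
    finally show ?thesis by simp
  qed
  have first: "bc / n * (t ^ 4 * a) \<le> bc * V * ?L"
  proof -
    have "bc / n * (t ^ 4 * a) \<le> bc / n * (n * \<mu> powr (2 * r) * V)"
      using a nonneg n0 by (intro mult_left_mono) (auto simp: \<mu>_def)
    also have "\<dots> = bc * V * \<mu> powr (2 * r)" using n0 by simp
    also have "\<dots> \<le> bc * V * ?L" using \<mu> nonneg r by (intro mult_left_mono powr_mono2) auto
    finally show ?thesis .
  qed
  have second: "bc / n * (t\<^sup>2 * D * b) \<le> bc * V * (2 * C0 * (1 + \<kappa>\<^sup>2)) * ?L"
  proof -
    have "bc / n * (t\<^sup>2 * D * b) = bc * (D / n) * (\<mu>\<^sup>2 * (n\<^sup>2 * b))"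
      using n0 by (simp add: \<mu>_def power_divide)
    also have "\<dots> \<le> bc * (2 * C0 * lam powr ?M) * (\<mu>\<^sup>2 * ((1 + \<kappa>\<^sup>2) * \<mu> powr (min (2 * r - 3) 0) * V))"
      using nonneg D0 n0
      by (intro mult_mono[OF mult_left_mono[OF Dn] mult_left_mono[OF b[folded \<mu>_def]]]) auto
    also have "\<dots> = bc * V * (2 * C0 * (1 + \<kappa>\<^sup>2)) * (lam powr ?M * (\<mu>\<^sup>2 * \<mu> powr (min (2 * r - 3) 0)))"
      by (simp add: mult_ac)
    also have "\<mu>\<^sup>2 * \<mu> powr (min (2 * r - 3) 0) = \<mu> powr 2 * \<mu> powr (min (2 * r - 3) 0)"
      using \<mu> by (simp add: powr_numeral)
    also have "\<dots> = \<mu> powr (2 + min (2 * r - 3) 0)" by (rule powr_add[symmetric])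
    also have "bc * V * (2 * C0 * (1 + \<kappa>\<^sup>2)) * (lam powr ?M * \<mu> powr (2 + min (2 * r - 3) 0))
        \<le> bc * V * (2 * C0 * (1 + \<kappa>\<^sup>2)) * (lam powr ?M * lam powr (2 + min (2 * r - 3) 0))"
      using \<mu> nonneg r by (intro mult_left_mono powr_mono2) auto
    also have "lam powr ?M * lam powr (2 + min (2 * r - 3) 0) = lam powr (?M + (2 + min (2 * r - 3) 0))"
      by (rule powr_add[symmetric])
    also have "?M + (2 + min (2 * r - 3) 0) = 2 * r" by (simp add: max_def min_def)
    finally show ?thesis .
  qed
  have third: "8 * \<sigma>\<^sup>2 * (1 + \<kappa>\<^sup>2) * D / (m * n) \<le> 16 * \<sigma>\<^sup>2 * (1 + \<kappa>\<^sup>2) * C0 * ?L"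
  proof -
    have "N \<le> m * n" using mk n m by (simp add: distrib_left)
    then have "8 * \<sigma>\<^sup>2 * (1 + \<kappa>\<^sup>2) * D / (m * n) \<le> 8 * \<sigma>\<^sup>2 * (1 + \<kappa>\<^sup>2) * (2 * C0 * lam powr - \<beta>) / N"
      using N D_le D0 nonneg by (intro frac_le mult_left_mono mult_nonneg_nonneg) auto
    also have "\<dots> = 16 * \<sigma>\<^sup>2 * (1 + \<kappa>\<^sup>2) * C0 * (lam powr - \<beta> / N)" by simp
    also have "lam powr - \<beta> / N = lam powr (- \<beta> - - (2 * r + \<beta>))"
      by (subst ar(3)) (rule powr_diff[symmetric])
    also have "- \<beta> - - (2 * r + \<beta>) = 2 * r" by simp
    finally show ?thesis .
  qed
  have "2 * (bc / n * (t ^ 4 * a + t\<^sup>2 * D * b)) + 8 * \<sigma>\<^sup>2 * (1 + \<kappa>\<^sup>2) * D / (m * n)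
     = 2 * (bc / n * (t ^ 4 * a) + bc / n * (t\<^sup>2 * D * b)) + 8 * \<sigma>\<^sup>2 * (1 + \<kappa>\<^sup>2) * D / (m * n)"
    by (simp only: distrib_left)
  also have "\<dots> \<le> 2 * (bc * V * ?L + bc * V * (2 * C0 * (1 + \<kappa>\<^sup>2)) * ?L) + 16 * \<sigma>\<^sup>2 * (1 + \<kappa>\<^sup>2) * C0 * ?L"
    by (intro add_mono mult_left_mono first second third) auto
  also have "\<dots> = (2 * bc * V * (1 + 2 * C0 * (1 + \<kappa>\<^sup>2)) + 16 * \<sigma>\<^sup>2 * (1 + \<kappa>\<^sup>2) * C0) * ?L"
    by (simp add: algebra_simps)
  finally show ?thesis unfolding L .
qed

theorem theorem2p6:
  fixes K :: "'a::{metric_space, second_countable_topology} \<Rightarrow> 'a \<Rightarrow> real"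
    and emb :: "'h::{real_inner, banach, second_countable_topology} \<Rightarrow> 'a \<Rightarrow> real"
    and \<rho> :: "('a \<times> real) measure"
    and \<rho>X :: "'a measure"
    and fstar ustar :: "'a \<Rightarrow> real"
    and r \<beta> C0 \<sigma> :: real
  assumes "compact (UNIV :: 'a set)"
    and "prob_space \<rho>" and "sets \<rho> = sets (borel \<Otimes>\<^sub>M borel)"
    and "\<rho>X = distr \<rho> borel fst"
    and "mercer_kernel K" and "rkhs K emb"
    and "regression_model \<rho> fstar \<sigma>"
    and "1/2 \<le> r" and "r \<le> 2"
    and "is_integral_op_power K \<rho>X r ustar fstar"
    and "0 < C0" and "0 < \<beta>" and "\<beta> \<le> 1"
    and "\<And>lam. 0 < lam \<Longrightarrow> effective_dim K emb \<rho>X lam \<le> ennreal (C0 * lam powr (-\<beta>))"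
  shows "\<exists>C::real. \<forall>(N::nat) (P::nat set set).
    1 \<le> N \<longrightarrow> partition_on {..<N} P \<longrightarrow> (\<forall>A\<in>P. \<forall>B\<in>P. card A = card B) \<longrightarrow>
    real (card P) \<le> real N powr min (2 / (2*r + \<beta>)) ((2*r - 1) / (2*r + \<beta>)) \<longrightarrow>
    (\<integral>\<^sup>+z. L2_norm_sq \<rho>X
        (\<lambda>x. emb (distributed_bcrkn K emb (real N powr (- 1 / (2*r + \<beta>))) P z) x - fstar x)
      \<partial>(Pi\<^sub>M {..<N} (\<lambda>_. \<rho>)))
    \<le> ennreal (C * real N powr (- (2*r) / (2*r + \<beta>)))"
proof -
  interpret kr: kernel_regression K emb \<rho> \<rho>X
    by (rule kernel_regression.intro[OF assms(1-6)])
  obtain g :: 'h and V :: real where V: "0 \<le> V" and fg: "AE x in \<rho>X. fstar x = emb g x"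
    and a: "\<And>t n. 0 < t \<Longrightarrow> t \<le> n \<Longrightarrow> t ^ 4 * inner (pop_res \<rho> kr.kf t n g) (pop_res \<rho> kr.kf t n (pop_res \<rho> kr.kf t n g))
        \<le> n * (t / n) powr (2 * r) * V"
    and b: "\<And>t n. 0 < t \<Longrightarrow> t \<le> n \<Longrightarrow>
        n\<^sup>2 * (norm (pop_res \<rho> kr.kf t n g))\<^sup>2 \<le> (1 + kr.\<kappa>\<^sup>2) * (t / n) powr (min (2 * r - 3) 0) * V"
    by (rule kr.source_condition[OF assms(10,8,9)], rule that)
  show ?thesis
  \<comment> \<open>The constant is left open here and read off from the final bound; g and V are
    fixed before N and the partition, so it depends on neither.\<close>
  proof (intro exI allI impI)
    fix N :: nat and P :: "nat set set"
    assume N: "1 \<le> N" and part: "partition_on {..<N} P" and eq: "\<forall>A\<in>P. \<forall>B\<in>P. card A = card B"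
      and m: "real (card P) \<le> real N powr min (2 / (2*r + \<beta>)) ((2*r - 1) / (2*r + \<beta>))"
    define lam where "lam = real N powr (- 1 / (2*r + \<beta>))"
    have lam0: "0 < lam" using N by (simp add: lam_def)
    have "P \<noteq> {}"
      using partition_onD1[OF part] N by (metis Union_empty lessThan_empty_iff not_one_le_zero)
    then obtain A where A: "A \<in> P" by blast
    define k where "k = real (card A)"
    have card: "real (card B) = k" if "B \<in> P" for B
      unfolding k_def using eq[rule_format, OF that A] by (rule arg_cong)
    have mk: "real (card P) * k = real N"
      by (rule kr.distributed_bcrkn_error(2)[OF part N lam0 card])
    then have m1: "1 \<le> real (card P)" using N by (cases "card P") auto
    have N1: "1 \<le> real N" using N by simp
    note ar = sample_size_arith[OF assms(8,9,12) N1 m1 m mk lam_def]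
    define t where "t = k * lam"
    \<comment> \<open>The test point is counted, so the effective dimension is evaluated at t / n,
      slightly below \<open>lam\<close>.\<close>
    define n where "n = k + 1"
    define D where "D = C0 * (t / n) powr - \<beta>"
    have t: "1 \<le> t" "t \<le> n" "0 < t" using ar by (auto simp: t_def n_def)
    have D: "0 \<le> D" "effective_dim K emb \<rho>X (t / n) \<le> ennreal D"
      using assms(11) assms(14)[of "t / n"] t by (auto simp: D_def)
    have "(\<integral>\<^sup>+z. L2_norm_sq \<rho>X (\<lambda>x. emb (distributed_bcrkn K emb lam P z) x - fstar x) \<partial>(Pi\<^sub>M {..<N} (\<lambda>_. \<rho>)))
      \<le> ennreal (2 * (bias_const kr.\<kappa> / n * (t ^ 4 * inner (pop_res \<rho> kr.kf t n g) (pop_res \<rho> kr.kf t n (pop_res \<rho> kr.kf t n g))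
          + t\<^sup>2 * D * (norm (pop_res \<rho> kr.kf t n g))\<^sup>2)) + 8 * \<sigma>\<^sup>2 * (1 + kr.\<kappa>\<^sup>2) * D / (real (card P) * n))"
      by (rule kr.expected_risk_le[OF assms(7) fg part N lam0 card t_def n_def t(1,2) D])
    also have "\<dots> \<le> ennreal ((2 * bias_const kr.\<kappa> * V * (1 + 2 * C0 * (1 + kr.\<kappa>\<^sup>2)) + 16 * \<sigma>\<^sup>2 * (1 + kr.\<kappa>\<^sup>2) * C0)
        * real N powr (- (2*r) / (2*r + \<beta>)))"
      by (intro ennreal_leI rate_bound[OF assms(8,9,12,13) N1 m1 m mk lam_def t_def n_def D_def
            bias_const_nonneg V assms(11) _ a[OF t(3,2)] b[OF t(3,2)]]) simp
    finally show "(\<integral>\<^sup>+z. L2_norm_sq \<rho>X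
        (\<lambda>x. emb (distributed_bcrkn K emb (real N powr (- 1 / (2*r + \<beta>))) P z) x - fstar x)
      \<partial>(Pi\<^sub>M {..<N} (\<lambda>_. \<rho>)))
      \<le> ennreal ((2 * bias_const kr.\<kappa> * V * (1 + 2 * C0 * (1 + kr.\<kappa>\<^sup>2)) + 16 * \<sigma>\<^sup>2 * (1 + kr.\<kappa>\<^sup>2) * C0)
        * real N powr (- (2*r) / (2*r + \<beta>)))"
      by (simp only: lam_def)
  qed
qed

end
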